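(* Consider the BRCMNBINAR(1) recursion $X_{i,t}=\alpha_{i,t}\diamond X_{i,t-1}+Z_{i,t}$, $i=1,2$, $t\in\mathbb N$. If $0<\alpha_i^2+\sigma_{\alpha_i}^2<1$ for $i=1,2$, where $\alpha_i=E(\alpha_{i,t})$ and $\sigma^2_{\alpha_i}=\mathrm{Var}(\alpha_{i,t})$, then there exists a unique strictly stationary and ergodic process $\{\mathbf X_t\}_{t\in\mathbb N}=\{(X_{1,t},X_{2,t})^T\}_{t\in\mathbb N}$ satisfying this recursion.
   Context: $\mathbb N_0=\{0,1,2,\dots\}$. Modified negative binomial operator: for $\alpha>0$ and an $\mathbb N_0$-valued random variable $X$, $\alpha\diamond X=\sum_{j=1}^{X+1}G_j$, where $\{G_j\}$ are i.i.d. geometric with parameter $\frac{\alpha}{1+\alpha}$, i.e. $P(G_j=k)=\frac{\alpha^k}{(1+\alpha)^{k+1}}$, $k\in\mathbb N_0$ (mean $\alpha$), independent of $X$. When $\alpha$ is random, this is understood conditionally on $\alpha$. BRCMNBINAR(1) process: an $\mathbb N_0^2$-valued process $\mathbf X_t=(X_{1,t},X_{2,t})^T$ with $X_{i,t}=\alpha_{i,t}\diamond X_{i,t-1}+Z_{i,t}$, $i=1,2$, $t\in\mathbb N$, where: (i) for $i=1,2$, $\{\alpha_{i,t}\}_t$ is i.i.d. Beta prime with density $f(x)=x^{m_i-1}(1+x)^{-m_i-l-1}/B(m_i,l+1)$, $x>0$ ($B$ is the Beta function), where $l>1$ is a known constant and $0<m_i<l$; so $E(\alpha_{i,t})=\alpha_i=m_i/l$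 and $\mathrm{Var}(\alpha_{i,t})=\sigma_{\alpha_i}^2=\frac{m_i(m_i+l)}{(l-1)l^2}$; $\{\alpha_{1,t}\}$ and $\{\alpha_{2,t}\}$ are mutually independent; (ii) $\mathbf Z_t=(Z_{1,t},Z_{2,t})^T$ are i.i.d. $\mathbb N_0^2$-valued random vectors with joint pmf $f_{\mathbf Z}(x,y)$, $E(Z_{i,t})=\mu_i$, $\mathrm{Var}(Z_{i,t})=\sigma_{Z_i}^2<\infty$, $\mathrm{Cov}(Z_{1,t},Z_{2,t})=\phi$; $\mathbf Z_t$ is independent of $(\alpha_{1,t}\diamond X_{1,t-1},\alpha_{2,t}\diamond X_{2,t-1})$ and of $\mathbf X_s$ for $s<t$; (iii) given the coefficients $\alpha_{i,t}$, the counting variables $G_j$ used in different components $i$ and at different times $t$ are independent; the triples (coefficients $(\alpha_{1,t},\alpha_{2,t})$, counting variables at time $t$, $\mathbf Z_t$) are independent over $t$ and independent of $\mathbf X_s$, $s<t$; (iv) $(m_1,\mu_1)\neq(m_2,\mu_2)$. *)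

theory Defs
  imports "HOL-Probability.Probability"
begin

section \<open>Stationarity and ergodicity of sequences of random elements\<close>

definition process_law :: "'a measure \<Rightarrow> 'b measure \<Rightarrow> (nat \<Rightarrow> 'a \<Rightarrow> 'b) \<Rightarrow> (nat \<Rightarrow> 'b) measure" where
  "process_law M N Y = distr M (\<Pi>\<^sub>M t\<in>UNIV. N) (\<lambda>\<omega> t. Y t \<omega>)"

definition strictly_stationary :: "'a measure \<Rightarrow> 'b measure \<Rightarrow> (nat \<Rightarrow> 'a \<Rightarrow> 'b) \<Rightarrow> bool" where
  "strictly_stationary M N Y \<longleftrightarrow>
     (\<forall>T h. finite T \<longrightarrow>
        distr M (\<Pi>\<^sub>M t\<in>T. N) (\<lambda>\<omega>. \<lambda>t\<in>T. Y (t + h) \<omega>) =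
        distr M (\<Pi>\<^sub>M t\<in>T. N) (\<lambda>\<omega>. \<lambda>t\<in>T. Y t \<omega>))"

text \<open>The law of the process gives every (strictly) shift-invariant event probability 0 or 1.\<close>

definition ergodic_process :: "'a measure \<Rightarrow> 'b measure \<Rightarrow> (nat \<Rightarrow> 'a \<Rightarrow> 'b) \<Rightarrow> bool" where
  "ergodic_process M N Y \<longleftrightarrow>
     (\<forall>A \<in> sets (\<Pi>\<^sub>M t\<in>(UNIV :: nat set). N).
        {x \<in> space (\<Pi>\<^sub>M t\<in>(UNIV :: nat set). N). (\<lambda>t. x (Suc t)) \<in> A} = A \<longrightarrow>
        measure (process_law M N Y) A = 0 \<or> measure (process_law M N Y) A = 1)"


section \<open>The Beta prime distribution\<close>

text \<open>The shape parameters are \<open>m\<close> and \<open>l + 1\<close>.\<close>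

definition beta_prime_density :: "real \<Rightarrow> real \<Rightarrow> real \<Rightarrow> real" where
  "beta_prime_density m l x =
     (if x > 0 then x powr (m - 1) * (1 + x) powr (- m - l - 1) / Beta m (l + 1) else 0)"

definition beta_prime :: "real \<Rightarrow> real \<Rightarrow> real measure" where
  "beta_prime m l = density lborel (\<lambda>x. ennreal (beta_prime_density m l x))"


section \<open>The modified negative binomial operator\<close>

text \<open>
  \<open>mnb_op g x\<close> is the value of \<open>\<alpha> \<diamond> X\<close> at an outcome where \<open>X\<close> has the value \<open>x\<close> and the
  counting variable \<open>G\<^sub>j\<close> has the value \<open>g j\<close>. The coefficient \<open>\<alpha>\<close> enters
  only through the conditional law of the counting variables, which is \<open>mnb_count_pmf \<alpha>\<close>.
\<close>

definition mnb_op :: "(nat \<Rightarrow> nat) \<Rightarrow> nat \<Rightarrow> nat" where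
  "mnb_op g x = (\<Sum>j = 1..x + 1. g j)"

definition mnb_count_pmf :: "real \<Rightarrow> nat \<Rightarrow> real" where
  "mnb_count_pmf a k = a ^ k / (1 + a) ^ (k + 1)"


section \<open>BRCMNBINAR(1) processes\<close>

definition coord :: "2 \<Rightarrow> 'b \<times> 'b \<Rightarrow> 'b" where
  "coord i z = (if i = 1 then fst z else snd z)"

text \<open>
  \<open>prob_space.indep_var\<close> requires both random elements to have values in the same type. This is
  the same notion (compare \<open>indep_var_eq\<close>) without that restriction.
\<close>

definition (in prob_space) indep_pair ::
    "'b measure \<Rightarrow> ('a \<Rightarrow> 'b) \<Rightarrow> 'c measure \<Rightarrow> ('a \<Rightarrow> 'c) \<Rightarrow> bool" where
  "indep_pair S U T V \<longleftrightarrow>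
     U \<in> measurable M S \<and> V \<in> measurable M T \<and>
     indep_set {U -` A \<inter> space M | A. A \<in> sets S} {V -` A \<inter> space M | A. A \<in> sets T}"

text \<open>
  The two components are indexed by the two-element type \<open>2\<close>. The process \<open>X\<close> is indexed
  by \<open>t \<ge> 0\<close>, with \<open>X 0\<close> the initial vector; coefficients \<open>\<alpha> i t\<close>, counting variables \<open>G i t j\<close>
  and innovations \<open>Z t\<close> are only constrained for \<open>t \<ge> 1\<close> and \<open>j \<ge> 1\<close>.
  \<open>thinned G X t\<close> is the vector with components \<open>\<alpha> i t \<diamond> X i (t - 1)\<close>.
\<close>

definition thinned ::
    "(2 \<Rightarrow> nat \<Rightarrow> nat \<Rightarrow> 'a \<Rightarrow> nat) \<Rightarrow> (nat \<Rightarrow> 'a \<Rightarrow> nat \<times> nat) \<Rightarrow> nat \<Rightarrow> 'a \<Rightarrow> nat \<times> nat" where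
  "thinned G X t \<omega> =
     (mnb_op (\<lambda>j. G 1 t j \<omega>) (coord 1 (X (t - 1) \<omega>)),
      mnb_op (\<lambda>j. G 2 t j \<omega>) (coord 2 (X (t - 1) \<omega>)))"

definition past :: "(nat \<Rightarrow> 'a \<Rightarrow> nat \<times> nat) \<Rightarrow> nat \<Rightarrow> 'a \<Rightarrow> nat \<Rightarrow> nat \<times> nat" where
  "past X t \<omega> = (\<lambda>s\<in>{..<t}. X s \<omega>)"

abbreviation past_space :: "nat \<Rightarrow> (nat \<Rightarrow> nat \<times> nat) measure" where
  "past_space t \<equiv> \<Pi>\<^sub>M s\<in>{..<t}. count_space UNIV"

definition coeffs :: "(2 \<Rightarrow> nat \<Rightarrow> 'a \<Rightarrow> real) \<Rightarrow> 'a \<Rightarrow> 2 \<times> nat \<Rightarrow> real" where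
  "coeffs \<alpha> \<omega> = (\<lambda>(i, t)\<in>UNIV \<times> {1..}. \<alpha> i t \<omega>)"

text \<open>The coefficients, the counting variables and the innovation at time \<open>t\<close>.\<close>

definition driver ::
    "(2 \<Rightarrow> nat \<Rightarrow> 'a \<Rightarrow> real) \<Rightarrow> (2 \<Rightarrow> nat \<Rightarrow> nat \<Rightarrow> 'a \<Rightarrow> nat) \<Rightarrow> (nat \<Rightarrow> 'a \<Rightarrow> nat \<times> nat) \<Rightarrow>
     nat \<Rightarrow> 'a \<Rightarrow> (real \<times> real) \<times> (2 \<times> nat \<Rightarrow> nat) \<times> (nat \<times> nat)" where
  "driver \<alpha> G Z t \<omega> =
     ((\<alpha> 1 t \<omega>, \<alpha> 2 t \<omega>), (\<lambda>(i, j)\<in>UNIV \<times> {1..}. G i t j \<omega>), Z t \<omega>)"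

abbreviation driver_space ::
    "((real \<times> real) \<times> (2 \<times> nat \<Rightarrow> nat) \<times> (nat \<times> nat)) measure" where
  "driver_space \<equiv>
     (borel \<Otimes>\<^sub>M borel) \<Otimes>\<^sub>M (\<Pi>\<^sub>M p\<in>UNIV \<times> {1..}. count_space UNIV) \<Otimes>\<^sub>M count_space UNIV"

locale brcmnbinar = prob_space M
  for M :: "'a measure" +
  fixes l :: real
    and m :: "2 \<Rightarrow> real"
    and f\<^sub>Z :: "(nat \<times> nat) pmf"
    and \<alpha> :: "2 \<Rightarrow> nat \<Rightarrow> 'a \<Rightarrow> real"
    and G :: "2 \<Rightarrow> nat \<Rightarrow> nat \<Rightarrow> 'a \<Rightarrow> nat"
    and Z :: "nat \<Rightarrow> 'a \<Rightarrow> nat \<times> nat"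
    and X :: "nat \<Rightarrow> 'a \<Rightarrow> nat \<times> nat"
  assumes X_measurable: "\<And>t. X t \<in> measurable M (count_space UNIV)"
    and recursion:
      "\<And>t. t \<ge> 1 \<Longrightarrow>
         AE \<omega> in M. \<forall>i. coord i (X t \<omega>) = coord i (thinned G X t \<omega>) + coord i (Z t \<omega>)"
    and coeff_distributed:
      "\<And>i t. t \<ge> 1 \<Longrightarrow> distributed M lborel (\<alpha> i t) (\<lambda>x. ennreal (beta_prime_density (m i) l x))"
    and coeff_indep: "\<And>i. indep_vars (\<lambda>_. borel) (\<alpha> i) {1..}"
    and coeff_components_indep:
      "indep_var (\<Pi>\<^sub>M t\<in>{1..}. borel) (\<lambda>\<omega>. \<lambda>t\<in>{1..}. \<alpha> 1 t \<omega>)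
                 (\<Pi>\<^sub>M t\<in>{1..}. borel) (\<lambda>\<omega>. \<lambda>t\<in>{1..}. \<alpha> 2 t \<omega>)"
    and innov_distr: "\<And>t. t \<ge> 1 \<Longrightarrow> distr M (count_space UNIV) (Z t) = measure_pmf f\<^sub>Z"
    and innov_indep: "indep_vars (\<lambda>_. count_space UNIV) Z {1..}"
    and innov_indep_thinned_past:
      "\<And>t. t \<ge> 1 \<Longrightarrow>
         indep_pair (count_space UNIV) (Z t)
           (count_space UNIV \<Otimes>\<^sub>M past_space t) (\<lambda>\<omega>. (thinned G X t \<omega>, past X t \<omega>))"
    \<comment> \<open>Given all coefficients, the counting variables are independent over \<open>i\<close>, \<open>t\<close> and \<open>j\<close>, and
        \<open>G i t j\<close> has the pmf \<open>mnb_count_pmf (\<alpha> i t)\<close>.\<close>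
    and counting_cond_law:
      "\<And>J k. finite J \<Longrightarrow> J \<subseteq> UNIV \<times> {1..} \<times> {1..} \<Longrightarrow>
         AE \<omega> in M.
           real_cond_exp M
             (vimage_algebra (space M) (coeffs \<alpha>) (\<Pi>\<^sub>M p\<in>UNIV \<times> {1..}. borel))
             (indicator {\<omega> \<in> space M. \<forall>(i, t, j)\<in>J. G i t j \<omega> = k i t j}) \<omega> =
           (\<Prod>(i, t, j)\<in>J. mnb_count_pmf (\<alpha> i t \<omega>) (k i t j))"
    and driver_indep: "indep_vars (\<lambda>_. driver_space) (driver \<alpha> G Z) {1..}"
    and driver_indep_past:
      "\<And>t. t \<ge> 1 \<Longrightarrow> indep_pair driver_space (driver \<alpha> G Z t) (past_space t) (past X t)"

definition stationary_ergodic_brcmnbinar where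
  "stationary_ergodic_brcmnbinar M l m f\<^sub>Z \<alpha> G Z X \<longleftrightarrow>
     brcmnbinar M l m f\<^sub>Z \<alpha> G Z X \<and>
     strictly_stationary M (count_space UNIV) X \<and>
     ergodic_process M (count_space UNIV) X"

end

theory Submission
  imports Defs
begin

text \<open>
  A solution is a Markov chain whose transition kernel is determined by the parameters. Two copies
  driven by the same counting variables and innovations contract in mean by the factor
  \<open>max (m\<^sub>1 / l) (m\<^sub>2 / l) < 1\<close>, and every function into \<open>[0, 1]\<close> is 1-Lipschitz on the integer
  lattice. So the chain forgets its initial state: there is at most one invariant law, and bounded
  harmonic functions are constant, which makes every stationary solution ergodic.

  For existence, let the driving variables be indexed by the integers, and start the recursion in 0
  at time \<open>t - n\<close>. The state at time \<open>t\<close> is increasing in \<open>n\<close> and bounded in mean, because the mean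
  coefficients are below 1. Hence it is eventually constant almost surely, and the limit is a
  stationary solution.
\<close>

section \<open>Discrete Markov chains\<close>

text \<open>Solutions to be compared may live on unrelated probability spaces, so the kernel has to
  be a formula in the parameters alone. The counts of one component at one time share a random
  coefficient and are only conditionally independent; the formula therefore integrates the
  coefficient out of a product of geometric weights. The contraction factor is the mean m_i / l of
  one counting variable. Thinning two states x and y with the same counts leaves exactly |x_i - y_i|
  unshared counts in component i, and the common innovation cancels. The conditional probability of
  an invariant event is meaningful only at states of positive probability. Stationarity ensures that
  the chain never leaves these states except with probability 0. In the construction each count is a
  function of a coefficient and of a uniform variable of its own. Independence, and the law of the
  counts given the coefficients, then become statements about which coordinates of a product measure
  a function reads.\<close>

definition traj :: "(nat \<Rightarrow> 'a \<Rightarrow> 's) \<Rightarrow> nat \<Rightarrow> 'a \<Rightarrow> 's list" where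
  "traj X n \<omega> = map (\<lambda>s. X s \<omega>) [0..<n]"

definition cyl :: "'a measure \<Rightarrow> (nat \<Rightarrow> 'a \<Rightarrow> 's) \<Rightarrow> 's list \<Rightarrow> real" where
  "cyl M X zs = measure M {\<omega> \<in> space M. traj X (length zs) \<omega> = zs}"

text \<open>The Markov property is multiplied out on finite trajectories, so trajectories of
  probability 0 need no exception. The initial law is left free.\<close>

definition markov_chain :: "'a measure \<Rightarrow> ('s \<Rightarrow> 's pmf) \<Rightarrow> (nat \<Rightarrow> 'a \<Rightarrow> 's) \<Rightarrow> bool" where
  "markov_chain M \<kappa> X \<longleftrightarrow>
     (\<forall>n. X n \<in> measurable M (count_space UNIV)) \<and>
     (\<forall>xs x y. cyl M X (xs @ [x, y]) = cyl M X (xs @ [x]) * pmf (\<kappa> x) y)"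

lemma length_traj [simp]: "length (traj X n \<omega>) = n"
  by (simp add: traj_def)

lemma traj_eq_iff: "length zs = n \<Longrightarrow> traj X n \<omega> = zs \<longleftrightarrow> (\<forall>s<n. X s \<omega> = zs ! s)"
  by (auto simp: traj_def list_eq_iff_nth_eq)

lemma measurable_traj:
  fixes X :: "nat \<Rightarrow> 'a \<Rightarrow> 's::countable"
  assumes X: "\<And>n. X n \<in> measurable M (count_space UNIV)"
  shows "traj X n \<in> measurable M (count_space UNIV)"
proof -
  have "traj X n -` {zs} \<inter> space M \<in> sets M" for zs
  proof (cases "length zs = n")
    case True
    have "traj X n -` {zs} \<inter> space M = {\<omega> \<in> space M. \<forall>s<n. X s \<omega> = zs ! s}"
      using traj_eq_iff[OF True, of X] by auto
    also have "\<dots> \<in> sets M"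
      using X by measurable
    finally show ?thesis .
  next
    case False
    then have "traj X n -` {zs} \<inter> space M = {}"
      using length_traj[of X n] by auto
    then show ?thesis by simp
  qed
  then show ?thesis
    by (simp add: measurable_count_space_eq2_countable)
qed

lemma sets_cyl:
  fixes X :: "nat \<Rightarrow> 'a \<Rightarrow> 's::countable"
  assumes "\<And>n. X n \<in> measurable M (count_space UNIV)"
  shows "{\<omega> \<in> space M. traj X n \<omega> = zs} \<in> sets M"
  using measurable_sets[OF measurable_traj[OF assms, where n=n], of "{zs}"]
  by (auto simp: vimage_def Int_def conj_commute)

lemma measurable_process:
  assumes "\<And>n. X n \<in> measurable M N"
  shows "(\<lambda>\<omega> t. X t \<omega>) \<in> measurable M (\<Pi>\<^sub>M t\<in>UNIV. N)"
  using assms by (intro measurable_PiM_single') (auto simp: measurable_def)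

text \<open>Cylinders of length 0 are excluded: they hold no information, but they would have to be
  treated separately in each application.\<close>

lemma process_law_eqI:
  fixes X :: "nat \<Rightarrow> 'a \<Rightarrow> 's::countable" and X' :: "nat \<Rightarrow> 'b \<Rightarrow> 's"
  assumes M: "prob_space M" and M': "prob_space M'"
    and X: "\<And>n. X n \<in> measurable M (count_space UNIV)"
    and X': "\<And>n. X' n \<in> measurable M' (count_space UNIV)"
    and eq: "\<And>zs. zs \<noteq> [] \<Longrightarrow> cyl M X zs = cyl M' X' zs"
  shows "process_law M (count_space UNIV) X = process_law M' (count_space UNIV) X'"
proof -
  interpret M: prob_space M by fact
  interpret M': prob_space M' by fact
  note [measurable] = measurable_traj[OF X] measurable_traj[OF X'] X X'
    measurable_process[OF X] measurable_process[OF X']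
  have traj_eq: "distr M (count_space UNIV) (traj X n) = distr M' (count_space UNIV) (traj X' n)"
    if n: "n > 0" for n
  proof (rule measure_eqI_countable[of _ UNIV])
    fix zs :: "'s list"
    show "emeasure (distr M (count_space UNIV) (traj X n)) {zs} =
          emeasure (distr M' (count_space UNIV) (traj X' n)) {zs}"
    proof (cases "length zs = n")
      case True
      then show ?thesis
        using eq[of zs] n
        by (auto simp: emeasure_distr M.emeasure_eq_measure M'.emeasure_eq_measure cyl_def
            vimage_def Int_def conj_commute)
    next
      case False
      then have "traj X n -` {zs} \<inter> space M = {}" "traj X' n -` {zs} \<inter> space M' = {}"
        using length_traj[of X n] length_traj[of X' n] by auto
      then show ?thesis by (simp add: emeasure_distr)
    qed
  qed auto
  interpret L: prob_space "process_law M (count_space UNIV) X"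
    unfolding process_law_def by (rule M.prob_space_distr) simp
  show ?thesis
  proof (rule measure_eqI_PiM_infinite[where I=UNIV and M="\<lambda>_. count_space UNIV"])
    show "finite_measure (process_law M (count_space UNIV) X)"
      by unfold_locales
    fix A :: "nat \<Rightarrow> 's set" and J :: "nat set"
    assume J: "finite J"
    then obtain k where k: "\<And>j. j \<in> J \<Longrightarrow> j < k"
      by (metis finite_nat_set_iff_bounded)
    \<comment> \<open>The successor keeps \<open>n\<close> positive even for empty \<open>J\<close>,
      because \<open>eq\<close> is available for nonempty trajectories only.\<close>
    define n where "n = Suc k"
    have n: "n > 0" "\<And>j. j \<in> J \<Longrightarrow> j < n"
      using k by (auto simp: n_def less_SucI)
    define B where "B = {zs. \<forall>j\<in>J. zs ! j \<in> A j}"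
    let ?E = "prod_emb UNIV (\<lambda>_. count_space UNIV) J (Pi\<^sub>E J A)"
    have E: "?E \<in> sets (\<Pi>\<^sub>M t\<in>UNIV. count_space UNIV)"
      using J by (intro sets_PiM_I) auto
    \<comment> \<open>A cylinder with base in \<open>J\<close> looks only at times below
      \<open>n\<close>, so it is an event about the trajectory of length \<open>n\<close>.\<close>
    have *: "(\<lambda>\<omega> t. Y t \<omega>) -` ?E \<inter> S = traj Y n -` B \<inter> S"
      for Y :: "nat \<Rightarrow> 'c \<Rightarrow> 's" and S
      using n by (auto simp: prod_emb_def B_def traj_def PiE_def restrict_def Pi_def extensional_def)
    have "emeasure (process_law M (count_space UNIV) X) ?E =
        emeasure (distr M (count_space UNIV) (traj X n)) B"
      using E by (simp add: process_law_def emeasure_distr *)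
    also have "\<dots> = emeasure (process_law M' (count_space UNIV) X') ?E"
      unfolding traj_eq[OF n(1)] using E by (simp add: process_law_def emeasure_distr *)
    finally show "emeasure (process_law M (count_space UNIV) X) ?E =
        emeasure (process_law M' (count_space UNIV) X') ?E" .
  qed (simp_all add: process_law_def)
qed

lemma cyl_nonneg [simp]: "0 \<le> cyl M X zs"
  by (simp add: cyl_def)

lemma cyl_singleton: "cyl M X [x] = measure M {\<omega> \<in> space M. X 0 \<omega> = x}"
  by (simp add: cyl_def traj_def)

lemma markov_chain_cyl_eq:
  assumes "markov_chain M \<kappa> X" and "markov_chain M' \<kappa> X'"
    and init: "\<And>x. cyl M X [x] = cyl M' X' [x]"
    and "zs \<noteq> []"
  shows "cyl M X zs = cyl M' X' zs"
  using \<open>zs \<noteq> []\<close>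
proof (induction zs rule: rev_induct)
  case Nil
  then show ?case by simp
next
  case (snoc y zs)
  show ?case
  proof (cases zs rule: rev_cases)
    case Nil
    then show ?thesis using init by simp
  next
    case (snoc xs x)
    then show ?thesis
      using assms snoc.IH by (simp add: markov_chain_def)
  qed
qed

lemma markov_chain_law_eq:
  fixes X :: "nat \<Rightarrow> 'a \<Rightarrow> 's::countable" and X' :: "nat \<Rightarrow> 'b \<Rightarrow> 's"
  assumes "prob_space M" and "prob_space M'"
    and X: "markov_chain M \<kappa> X" and X': "markov_chain M' \<kappa> X'"
    and init: "\<And>x. cyl M X [x] = cyl M' X' [x]"
  shows "process_law M (count_space UNIV) X = process_law M' (count_space UNIV) X'"
  using assms markov_chain_cyl_eq[OF X X' init]
  by (intro process_law_eqI) (auto simp: markov_chain_def)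

text \<open>Given the past and the present state \<open>x\<close>, the future is again a chain with
  the same kernel, started in \<open>x\<close>. Conditional cylinder probabilities are quotients
  with a common denominator, which cancels in the Markov equation. The present belongs both to the
  conditioning trajectory and, as time 0, to \<open>Y\<close>.\<close>

lemma markov_chain_restart:
  fixes X :: "nat \<Rightarrow> 'a \<Rightarrow> 's::countable"
  assumes M: "prob_space M" and X: "markov_chain M \<kappa> X"
    and pos: "cyl M X (xs @ [x]) \<noteq> 0"
  defines "U \<equiv> uniform_measure M {\<omega> \<in> space M. traj X (Suc (length xs)) \<omega> = xs @ [x]}"
    and "Y \<equiv> \<lambda>k. X (length xs + k)"
  shows "prob_space U" and "markov_chain U \<kappa> Y" and "cyl U Y [z] = indicator {x} z"
proof -
  interpret M: prob_space M by fact
  have mX [measurable]: "\<And>n. X n \<in> measurable M (count_space UNIV)"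
    using X by (simp add: markov_chain_def)
  define E where "E = {\<omega> \<in> space M. traj X (Suc (length xs)) \<omega> = xs @ [x]}"
  have E [measurable]: "E \<in> sets M"
    unfolding E_def by (rule sets_cyl) simp
  have pE: "measure M E = cyl M X (xs @ [x])"
    by (simp add: E_def cyl_def)
  have U: "U = uniform_measure M E"
    by (simp add: U_def E_def)
  show "prob_space U"
    unfolding U using pos measure_nonneg[of M E] pE
    by (intro prob_space_uniform_measure) (auto simp: M.emeasure_eq_measure)
  have Y: "\<And>n. Y n \<in> measurable U (count_space UNIV)"
    by (simp add: Y_def U)
  have cyl_Y: "cyl U Y (z # ys) = (if z = x then cyl M X (xs @ z # ys) / cyl M X (xs @ [x]) else 0)"
    for z ys
  proof -
    let ?C = "{\<omega> \<in> space M. traj Y (Suc (length ys)) \<omega> = z # ys}"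
    have C: "?C \<in> sets M"
      by (rule sets_cyl) (simp add: Y_def)
    have "cyl U Y (z # ys) = measure M (E \<inter> ?C) / measure M E"
      using C pE pos measure_nonneg[of M E] unfolding cyl_def U length_Cons
      by (subst measure_uniform_measure) (auto simp: M.emeasure_eq_measure)
    also have "E \<inter> ?C = (if z = x then {\<omega> \<in> space M. traj X (length (xs @ z # ys)) \<omega> = xs @ z # ys} else {})"
    proof -
      have t: "traj X (length xs + k) \<omega> = traj X (length xs) \<omega> @ traj Y k \<omega>" for k \<omega>
        by (rule nth_equalityI) (auto simp: traj_def Y_def nth_append)
      have t1: "traj X (Suc (length xs)) \<omega> = traj X (length xs) \<omega> @ [Y 0 \<omega>]" for \<omega>
        by (simp add: traj_def Y_def)
      have t2: "traj Y (Suc k) \<omega> = Y 0 \<omega> # tl (traj Y (Suc k) \<omega>)" for k \<omega>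
        by (simp add: traj_def upt_conv_Cons del: upt_Suc)
      have "\<omega> \<in> E \<inter> ?C \<longleftrightarrow> z = x \<and> \<omega> \<in> space M \<and> traj X (length (xs @ z # ys)) \<omega> = xs @ z # ys" for \<omega>
      proof -
        have "traj X (length (xs @ z # ys)) \<omega> = traj X (length xs) \<omega> @ traj Y (Suc (length ys)) \<omega>"
          using t[of "Suc (length ys)" \<omega>] by simp
        then show ?thesis
          using t2[of "length ys" \<omega>] by (auto simp: E_def t1 append_eq_append_conv)
      qed
      then show ?thesis by auto
    qed
    finally show ?thesis
      by (simp add: cyl_def pE)
  qed
  have "cyl U Y (us @ [u, v]) = cyl U Y (us @ [u]) * pmf (\<kappa> u) v" for us u v
  proof -
    have step: "cyl M X (as @ [a, b]) = cyl M X (as @ [a]) * pmf (\<kappa> a) b" for as a b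
      using X by (simp add: markov_chain_def)
    show ?thesis
    proof (cases us)
      case Nil
      then show ?thesis
        using step[of xs u v] pos by (cases "u = x") (simp_all add: cyl_Y)
    next
      case (Cons w ws)
      then show ?thesis
        using step[of "xs @ w # ws" u v] by (cases "w = x") (simp_all add: cyl_Y)
    qed
  qed
  then show "markov_chain U \<kappa> Y"
    using Y by (simp add: markov_chain_def)
  show "cyl U Y [z] = indicator {x} z"
    using cyl_Y[of z "[]"] pos by (auto simp: indicator_def)
qed

section \<open>Averaging operators and kernels that forget their initial state\<close>

lemma (in prob_space) distr_count_space_pmf:
  fixes f :: "'a \<Rightarrow> 's::countable"
  assumes f: "f \<in> measurable M (count_space UNIV)"
  obtains p :: "'s pmf" where "measure_pmf p = distr M (count_space UNIV) f"
proof -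
  interpret D: prob_space "distr M (count_space UNIV) f"
    by (rule prob_space_distr[OF f])
  have "AE x in distr M (count_space UNIV) f. measure (distr M (count_space UNIV) f) {x} \<noteq> 0"
    by (subst D.AE_support_countable) (auto intro: exI[of _ UNIV])
  then show thesis
    using that[of "Abs_pmf (distr M (count_space UNIV) f)"] D.prob_space_axioms
    by (simp add: Abs_pmf_inverse)
qed

text \<open>The Markov operator of \<kappa>: its n-th power applied to \<open>h\<close> is the
  expected value of \<open>h\<close> after n steps, as a function of the initial state.\<close>

definition kernel_op :: "('s \<Rightarrow> 's pmf) \<Rightarrow> ('s \<Rightarrow> real) \<Rightarrow> 's \<Rightarrow> real" where
  "kernel_op \<kappa> h x = measure_pmf.expectation (\<kappa> x) h"

lemma kernel_op_bounds:
  assumes "\<And>z. 0 \<le> h z \<and> h z \<le> 1"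
  shows "0 \<le> (kernel_op \<kappa> ^^ n) h x \<and> (kernel_op \<kappa> ^^ n) h x \<le> 1"
proof (induction n arbitrary: x)
  case (Suc n)
  have "integrable (measure_pmf (\<kappa> x)) ((kernel_op \<kappa> ^^ n) h)"
    using Suc by (intro measure_pmf.integrable_const_bound[where B=1]) auto
  then have "kernel_op \<kappa> ((kernel_op \<kappa> ^^ n) h) x \<le> 1"
    unfolding kernel_op_def[of _ "(kernel_op \<kappa> ^^ n) h"]
    using Suc by (intro measure_pmf.integral_le_const) auto
  moreover have "0 \<le> kernel_op \<kappa> ((kernel_op \<kappa> ^^ n) h) x"
    unfolding kernel_op_def[of _ "(kernel_op \<kappa> ^^ n) h"]
    using Suc by (intro integral_nonneg_AE) auto
  ultimately show ?case by simp
qed (use assms in simp)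

text \<open>Convergence is pointwise in the pair of initial states, without any rate. The bounds on
  \<open>h\<close> supply the domination when the limit is taken under an integral over initial
  states.\<close>

locale forgetful_kernel =
  fixes \<kappa> :: "'s::countable \<Rightarrow> 's pmf"
  assumes forget: "\<And>h x y. (\<And>z. 0 \<le> h z \<and> h z \<le> 1) \<Longrightarrow>
    (\<lambda>n. (kernel_op \<kappa> ^^ n) h x - (kernel_op \<kappa> ^^ n) h y) \<longlonglongrightarrow> 0"
begin

text \<open>Under an invariant law the expectation of the n-th iterate does not depend on n.
  Integrating the difference of two iterates over the product of \<open>p\<close> and
  \<open>q\<close> therefore gives a constant sequence, and dominated convergence shows that the
  constant is 0. The indicator of a point turns this into equality of the two mass
  functions.\<close>

lemma invariant_pmf_unique:
  assumes p: "bind_pmf p \<kappa> = p" and q: "bind_pmf q \<kappa> = q"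
  shows "p = q"
proof (rule pmf_eqI)
  fix s
  define h where "h = (indicator {s} :: 's \<Rightarrow> real)"
  define T where "T n = (kernel_op \<kappa> ^^ n) h" for n
  have h: "\<And>z. 0 \<le> h z \<and> h z \<le> 1"
    by (auto simp: h_def indicator_def)
  have T: "\<And>n z. 0 \<le> T n z \<and> T n z \<le> 1"
    unfolding T_def by (rule kernel_op_bounds[OF h])
  have invariant: "measure_pmf.expectation r (T n) = pmf r s" if r: "bind_pmf r \<kappa> = r" for r n
  proof (induction n)
    case 0
    then show ?case by (simp add: T_def h_def measure_pmf_single)
  next
    case (Suc n)
    have "measure_pmf.expectation r (T n) = measure_pmf.expectation (bind_pmf r \<kappa>) (T n)"
      by (simp add: r)
    also have "\<dots> = measure_pmf.expectation r (\<lambda>x. measure_pmf.expectation (\<kappa> x) (T n))"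
      unfolding measure_pmf_bind
      using T by (intro integral_bind[where K="count_space UNIV" and B=1 and B'=1])
        (auto simp: measure_pmf.emeasure_space_1 intro: measure_pmf_in_subprob_algebra)
    also have "\<dots> = measure_pmf.expectation r (T (Suc n))"
      by (simp add: T_def kernel_op_def[abs_def])
    finally show ?case using Suc by simp
  qed
  have "(\<lambda>n. \<integral>z. T n (fst z) - T n (snd z) \<partial>measure_pmf (pair_pmf p q)) \<longlonglongrightarrow>
      (\<integral>z. 0 \<partial>measure_pmf (pair_pmf p q))"
  proof (rule integral_dominated_convergence[where w="\<lambda>_. 1"])
    show "AE z in measure_pmf (pair_pmf p q). (\<lambda>n. T n (fst z) - T n (snd z)) \<longlonglongrightarrow> 0"
      unfolding T_def by (intro AE_I2 forget h)
    show "AE z in measure_pmf (pair_pmf p q). norm (T n (fst z) - T n (snd z)) \<le> 1" for n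
    proof (intro AE_I2)
      fix z
      show "norm (T n (fst z) - T n (snd z)) \<le> 1"
        using T[of n "fst z"] T[of n "snd z"] by (auto simp: abs_if)
    qed
  qed auto
  moreover have "(\<integral>z. T n (fst z) - T n (snd z) \<partial>measure_pmf (pair_pmf p q)) = pmf p s - pmf q s" for n
  proof -
    have i: "integrable (measure_pmf r) (\<lambda>z. T n (g z))" for r :: "('s \<times> 's) pmf" and g
      using T by (intro measure_pmf.integrable_const_bound[where B=1]) auto
    have "(\<integral>z. T n (fst z) \<partial>measure_pmf (pair_pmf p q)) = measure_pmf.expectation (map_pmf fst (pair_pmf p q)) (T n)"
      by (simp only: integral_map_pmf)
    moreover have "(\<integral>z. T n (snd z) \<partial>measure_pmf (pair_pmf p q)) = measure_pmf.expectation (map_pmf snd (pair_pmf p q)) (T n)"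
      by (simp only: integral_map_pmf)
    ultimately show ?thesis
      using i[of "pair_pmf p q"] by (simp add: map_fst_pair_pmf map_snd_pair_pmf invariant p q)
  qed
  ultimately show "pmf p s = pmf q s"
    by (simp add: LIMSEQ_const_iff)
qed

end

section \<open>Stationary chains: uniqueness of the law and ergodicity\<close>

lemma strictly_stationary_marginal:
  fixes X :: "nat \<Rightarrow> 'a \<Rightarrow> 's::countable"
  assumes "strictly_stationary M (count_space UNIV) X"
    and X [measurable]: "\<And>n. X n \<in> measurable M (count_space UNIV)"
  shows "distr M (count_space UNIV) (X n) = distr M (count_space UNIV) (X 0)"
proof -
  let ?P = "\<Pi>\<^sub>M t\<in>{0::nat}. (count_space UNIV :: 's measure)"
  have *: "distr M (count_space UNIV) (X n) = distr (distr M ?P (\<lambda>\<omega>. \<lambda>t\<in>{0}. X (t + n) \<omega>)) (count_space UNIV) (\<lambda>x. x 0)" for n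
    by (subst distr_distr) (auto simp: comp_def intro!: measurable_restrict)
  have "distr M ?P (\<lambda>\<omega>. \<lambda>t\<in>{0}. X (t + n) \<omega>) = distr M ?P (\<lambda>\<omega>. \<lambda>t\<in>{0}. X (t + 0) \<omega>)"
    using assms(1) by (simp add: strictly_stationary_def)
  then show ?thesis
    by (simp only: *[of n] *[of 0])
qed

context forgetful_kernel
begin

text \<open>Comparing times 0 and 1 shows that the marginal of a stationary chain is invariant under
  \<kappa>. Hence both chains have the same initial law, and the common kernel determines the
  rest.\<close>

lemma stationary_law_unique:
  fixes X :: "nat \<Rightarrow> 'a \<Rightarrow> 's" and X' :: "nat \<Rightarrow> 'b \<Rightarrow> 's"
  assumes M: "prob_space M" and M': "prob_space M'"
    and X: "markov_chain M \<kappa> X" and X': "markov_chain M' \<kappa> X'"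
    and st: "strictly_stationary M (count_space UNIV) X"
    and st': "strictly_stationary M' (count_space UNIV) X'"
  shows "process_law M (count_space UNIV) X = process_law M' (count_space UNIV) X'"
proof -
  have invariant: "\<exists>p. bind_pmf p \<kappa> = p \<and> (\<forall>x. cyl N Y [x] = pmf p x)"
    if N: "prob_space N" and Y: "markov_chain N \<kappa> Y"
      and st: "strictly_stationary N (count_space UNIV) Y"
    for N :: "'c measure" and Y :: "nat \<Rightarrow> 'c \<Rightarrow> 's"
  proof -
    interpret N: prob_space N by fact
    have mY [measurable]: "\<And>n. Y n \<in> measurable N (count_space UNIV)"
      using Y by (simp add: markov_chain_def)
    obtain p where p: "measure_pmf p = distr N (count_space UNIV) (Y 0)"
      using N.distr_count_space_pmf[OF mY] .
    have pmf_p: "pmf p x = measure N {\<omega> \<in> space N. Y n \<omega> = x}" for n x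
    proof -
      have "pmf p x = measure (distr N (count_space UNIV) (Y n)) {x}"
        unfolding strictly_stationary_marginal[OF st mY, of n] by (simp add: pmf.rep_eq p)
      also have "\<dots> = measure N {\<omega> \<in> space N. Y n \<omega> = x}"
        by (subst measure_distr) (auto simp: vimage_def Int_def conj_commute)
      finally show ?thesis .
    qed
    have "bind_pmf p \<kappa> = p"
    proof (rule pmf_eqI)
      fix y
      let ?E = "\<lambda>x. {\<omega> \<in> space N. traj Y (Suc (Suc 0)) \<omega> = [x, y]}"
      have "ennreal (pmf (bind_pmf p \<kappa>) y) = (\<integral>\<^sup>+x. ennreal (pmf (\<kappa> x) y) \<partial>measure_pmf p)"
        by (simp add: ennreal_pmf_bind)
      \<comment> \<open>Each summand becomes the probability of the trajectory
        \<open>[x, y]\<close>; summing over \<open>x\<close> yields the marginal at time 1, which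
        stationarity identifies with \<open>p\<close>.\<close>
      also have "\<dots> = (\<integral>\<^sup>+x. ennreal (cyl N Y [x] * pmf (\<kappa> x) y) \<partial>count_space UNIV)"
        by (simp add: nn_integral_measure_pmf cyl_singleton pmf_p[of _ 0, symmetric] ennreal_mult)
      also have "\<dots> = (\<integral>\<^sup>+x. emeasure N (?E x) \<partial>count_space UNIV)"
        using Y by (auto simp: markov_chain_def N.emeasure_eq_measure cyl_def
            intro!: nn_integral_cong dest!: spec[of _ "[]"])
      also have "\<dots> = emeasure N (\<Union>x. ?E x)"
        by (intro emeasure_UN_countable[symmetric] sets_cyl mY)
          (auto simp: disjoint_family_on_def)
      also have "(\<Union>x. ?E x) = {\<omega> \<in> space N. Y 1 \<omega> = y}"
        by (auto simp: traj_def)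
      finally show "pmf (bind_pmf p \<kappa>) y = pmf p y"
        by (simp add: pmf_p[of _ 1] N.emeasure_eq_measure)
    qed
    then show ?thesis
      using pmf_p[of _ 0] by (intro exI[of _ p]) (simp add: cyl_singleton)
  qed
  obtain p where p: "bind_pmf p \<kappa> = p" "\<And>x. cyl M X [x] = pmf p x"
    using invariant[OF M X st] by auto
  obtain q where q: "bind_pmf q \<kappa> = q" "\<And>x. cyl M' X' [x] = pmf q x"
    using invariant[OF M' X' st'] by auto
  show ?thesis
    by (rule markov_chain_law_eq[OF M M' X X']) (simp add: p(2) q(2) invariant_pmf_unique[OF p(1) q(1)])
qed

text \<open>The conditional probability of a shift-invariant event given the past is a harmonic function
  of the present state, hence constant. So the event is independent of the past of every time,
  and therefore of itself.\<close>

lemma stationary_ergodic: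
  fixes X :: "nat \<Rightarrow> 'a \<Rightarrow> 's"
  assumes M: "prob_space M" and X: "markov_chain M \<kappa> X"
    and st: "strictly_stationary M (count_space UNIV) X"
  shows "ergodic_process M (count_space UNIV) X"
  unfolding ergodic_process_def
proof (intro ballI impI)
  interpret M: prob_space M by fact
  let ?P = "\<Pi>\<^sub>M t\<in>(UNIV :: nat set). (count_space UNIV :: 's measure)"
  fix A
  assume A [measurable]: "A \<in> sets ?P" and A_inv: "{x \<in> space ?P. (\<lambda>t. x (Suc t)) \<in> A} = A"
  have inv: "(\<lambda>t. x (Suc t)) \<in> A \<longleftrightarrow> x \<in> A" for x
    using eqset_imp_iff[OF A_inv, of x] by (simp add: space_PiM)
  have invn: "(\<lambda>t. x (n + t)) \<in> A \<longleftrightarrow> x \<in> A" for x n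
  proof (induction n)
    case (Suc n)
    then show ?case using inv[of "\<lambda>t. x (n + t)"] by simp
  qed simp
  have mX [measurable]: "\<And>n. X n \<in> measurable M (count_space UNIV)"
    using X by (simp add: markov_chain_def)
  have mP [measurable]: "(\<lambda>\<omega> t. X t \<omega>) \<in> measurable M ?P"
    by (rule measurable_process) simp
  \<comment> \<open>By stationarity a state that is reached with positive probability at some time
    also has positive probability at time 0.\<close>
  have cyl_le: "cyl M X (xs @ [x]) \<le> cyl M X [x]" for xs x
  proof -
    have "cyl M X (xs @ [x]) \<le> measure M {\<omega> \<in> space M. X (length xs) \<omega> = x}"
      unfolding cyl_def by (intro M.finite_measure_mono) (auto simp: traj_def)
    also have "\<dots> = measure (distr M (count_space UNIV) (X (length xs))) {x}"
      by (subst measure_distr) (auto simp: vimage_def Int_def conj_commute)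
    also have "\<dots> = cyl M X [x]"
      unfolding strictly_stationary_marginal[OF st mX, of "length xs"]
      by (subst measure_distr) (auto simp: vimage_def Int_def conj_commute cyl_singleton)
    finally show ?thesis .
  qed
  have cyl_0: "cyl M X [x] = 0 \<Longrightarrow> cyl M X (xs @ [x]) = 0" for xs x
    using cyl_le[of xs x] by (simp add: antisym)
  define C where "C zs = {\<omega> \<in> space M. traj X (length zs) \<omega> = zs}" for zs
  define B where "B = {\<omega> \<in> space M. (\<lambda>t. X t \<omega>) \<in> A}"
  have sC [measurable]: "C zs \<in> sets M" for zs
    unfolding C_def by (rule sets_cyl) simp
  have sB [measurable]: "B \<in> sets M"
    unfolding B_def by measurable
  have pC: "measure M (C zs) = cyl M X zs" for zs
    by (simp add: C_def cyl_def)
  \<comment> \<open>At states of probability 0 the quotient is 0 by division by zero. So the bounds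
    hold everywhere, whereas the harmonic equation is claimed only at states of positive
    probability.\<close>
  define h where "h x = measure M (C [x] \<inter> B) / measure M (C [x])" for x
  have h_bounds: "0 \<le> h x \<and> h x \<le> 1" for x
    by (auto simp: h_def divide_le_eq_1 zero_less_measure_iff intro!: M.finite_measure_mono)
  have law_A: "measure (process_law (uniform_measure M (C zs)) (count_space UNIV) (\<lambda>k. X (n + k))) A =
      measure M (C zs \<inter> B) / measure M (C zs)" if "measure M (C zs) \<noteq> 0" for zs n
  proof -
    have "measure (process_law (uniform_measure M (C zs)) (count_space UNIV) (\<lambda>k. X (n + k))) A =
        measure (uniform_measure M (C zs)) {\<omega> \<in> space M. (\<lambda>t. X (n + t) \<omega>) \<in> A}"
      unfolding process_law_def
      by (subst measure_distr) (auto intro!: measurable_process arg_cong2[of _ _ _ _ measure])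
    also have "{\<omega> \<in> space M. (\<lambda>t. X (n + t) \<omega>) \<in> A} = B"
      unfolding B_def by (simp add: invn[of "\<lambda>t. X t \<omega>" for \<omega>])
    finally show ?thesis
      using that by (simp add: measure_uniform_measure M.emeasure_eq_measure)
  qed
  \<comment> \<open>The chains restarted after \<open>xs @ [x]\<close> and after \<open>[x]\<close>
    have the same law. Invariance of \<open>A\<close> under shifts lets both compute the conditional
    probability of the same event \<open>B\<close>.\<close>
  have past: "measure M (C (xs @ [x]) \<inter> B) = cyl M X (xs @ [x]) * h x" for xs x
  proof (cases "cyl M X (xs @ [x]) = 0")
    case True
    have "measure M (C (xs @ [x]) \<inter> B) \<le> cyl M X (xs @ [x])"
      unfolding pC[symmetric] by (intro M.finite_measure_mono) auto
    then show ?thesis using True measure_nonneg[of M "C (xs @ [x]) \<inter> B"] by simp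
  next
    case False
    have pos: "cyl M X ([] @ [x]) \<noteq> 0"
      using cyl_0[of x xs] False by auto
    note R = markov_chain_restart[OF M X False] markov_chain_restart[OF M X pos]
    have "process_law (uniform_measure M (C (xs @ [x]))) (count_space UNIV) (\<lambda>k. X (length xs + k)) =
        process_law (uniform_measure M (C [x])) (count_space UNIV) (\<lambda>k. X (0 + k))"
      using R by (intro markov_chain_law_eq) (auto simp: C_def)
    then have "measure M (C (xs @ [x]) \<inter> B) / measure M (C (xs @ [x])) = h x"
      using law_A[of "xs @ [x]" "length xs"] law_A[of "[x]" 0] pos False by (simp add: pC h_def)
    then show ?thesis
      using False by (simp add: pC field_simps)
  qed
  have eB: "emeasure M (C [x] \<inter> B) = ennreal (cyl M X [x] * h x)" for x
    using past[of "[]" x] by (simp add: M.emeasure_eq_measure)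
  \<comment> \<open>In the iteration \<open>g\<close> is a power of the operator applied to
    \<open>h\<close>, known to agree with \<open>h\<close> only at states of positive probability.
    The other states contribute nothing, as they cannot follow \<open>x\<close>.\<close>
  have harmonic: "kernel_op \<kappa> g x = h x" if x: "cyl M X [x] \<noteq> 0"
    and g: "\<And>y. cyl M X [y] \<noteq> 0 \<Longrightarrow> g y = h y" and g_bounds: "\<And>y. 0 \<le> g y \<and> g y \<le> 1" for g x
  proof -
    have "ennreal (cyl M X [x]) * ennreal (kernel_op \<kappa> g x) = 
        ennreal (cyl M X [x]) * (\<integral>\<^sup>+y. ennreal (g y) \<partial>measure_pmf (\<kappa> x))"
      unfolding kernel_op_def using g_bounds
      by (subst nn_integral_eq_integral)
        (auto intro!: measure_pmf.integrable_const_bound[where B=1])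
    also have "\<dots> = (\<integral>\<^sup>+y. ennreal (cyl M X [x]) * (ennreal (pmf (\<kappa> x) y) * ennreal (g y)) \<partial>count_space UNIV)"
      by (simp add: nn_integral_measure_pmf nn_integral_cmult)
    also have "\<dots> = (\<integral>\<^sup>+y. emeasure M (C [x, y] \<inter> B) \<partial>count_space UNIV)"
    proof (rule nn_integral_cong)
      fix y
      have xy: "cyl M X [x, y] = cyl M X [x] * pmf (\<kappa> x) y"
        using X by (auto simp: markov_chain_def dest!: spec[of _ "[]"])
      have "cyl M X [x, y] \<noteq> 0 \<Longrightarrow> g y = h y"
        using cyl_0[of y "[x]"] g[of y] by force
      then have "cyl M X [x, y] * g y = cyl M X [x, y] * h y"
        by auto
      then have "emeasure M (C [x, y] \<inter> B) = ennreal (cyl M X [x] * pmf (\<kappa> x) y * g y)"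
        using past[of "[x]" y] by (auto simp: M.emeasure_eq_measure xy)
      then show "ennreal (cyl M X [x]) * (ennreal (pmf (\<kappa> x) y) * ennreal (g y)) = emeasure M (C [x, y] \<inter> B)"
        using g_bounds[of y] by (simp add: ennreal_mult' ennreal_mult'' mult.assoc)
    qed
    also have "\<dots> = emeasure M (\<Union>y. C [x, y] \<inter> B)"
    proof (rule emeasure_UN_countable[symmetric])
      show "disjoint_family (\<lambda>y. C [x, y] \<inter> B)"
        by (auto simp: disjoint_family_on_def C_def)
    qed auto
    also have "(\<Union>y. C [x, y] \<inter> B) = C [x] \<inter> B"
      by (auto simp: C_def traj_def)
    finally show ?thesis
      using x h_bounds[of x] kernel_op_bounds[where h=g and \<kappa>=\<kappa> and n=1 and x=x] g_bounds
      by (simp add: eB ennreal_mult'[symmetric])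
  qed
  have harmonic_n: "cyl M X [x] \<noteq> 0 \<Longrightarrow> (kernel_op \<kappa> ^^ n) h x = h x" for n x
  proof (induction n arbitrary: x)
    case (Suc n)
    then show ?case
      using harmonic[of x "(kernel_op \<kappa> ^^ n) h"] kernel_op_bounds[of h] h_bounds by simp
  qed simp
  define c where "c = h (SOME x. cyl M X [x] \<noteq> 0)"
  have h_const: "h x = c" if x: "cyl M X [x] \<noteq> 0" for x
  proof -
    define y where "y = (SOME x. cyl M X [x] \<noteq> 0)"
    have y: "cyl M X [y] \<noteq> 0"
      unfolding y_def using x by (rule someI)
    have "(\<lambda>n. h x - h y) \<longlonglongrightarrow> 0"
      using forget[of h x y] h_bounds harmonic_n[OF x] harmonic_n[OF y] by simp
    then show ?thesis
      by (simp add: LIMSEQ_const_iff c_def y_def)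
  qed
  have past': "measure M (C zs \<inter> B) = cyl M X zs * c" if "zs \<noteq> []" for zs
  proof -
    obtain xs x where zs: "zs = xs @ [x]"
      using \<open>zs \<noteq> []\<close> by (cases zs rule: rev_cases) auto
    have "cyl M X zs \<noteq> 0 \<Longrightarrow> h x = c"
      using cyl_0[of x xs] h_const[of x] by (force simp: zs)
    then show ?thesis
      using past[of xs x] by (auto simp: zs)
  qed
  have c: "c = measure M B"
  proof -
    have "0 \<le> c" using h_bounds by (simp add: c_def)
    have "disjoint_family (\<lambda>x. C [x])" "disjoint_family (\<lambda>x. C [x] \<inter> B)"
      by (auto simp: disjoint_family_on_def C_def)
    then have "emeasure M (\<Union>x. C [x]) = (\<integral>\<^sup>+x. emeasure M (C [x]) \<partial>count_space UNIV)"
      "emeasure M (\<Union>x. C [x] \<inter> B) = (\<integral>\<^sup>+x. emeasure M (C [x] \<inter> B) \<partial>count_space UNIV)"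
      by (intro emeasure_UN_countable; simp)+
    moreover have "(\<Union>x. C [x]) = space M" "(\<Union>x. C [x] \<inter> B) = B"
      by (auto simp: C_def traj_def B_def)
    moreover have "emeasure M (C [x] \<inter> B) = emeasure M (C [x]) * ennreal c" for x
      using past'[of "[x]"] \<open>0 \<le> c\<close> by (simp add: M.emeasure_eq_measure pC ennreal_mult'')
    ultimately have "emeasure M B = emeasure M (space M) * ennreal c"
      by (simp add: nn_integral_multc)
    then show ?thesis
      using \<open>0 \<le> c\<close> by (simp add: M.emeasure_space_1) (simp add: M.emeasure_eq_measure)
  qed
  have law: "measure (process_law M (count_space UNIV) X) A = measure M B"
    unfolding process_law_def B_def
    by (subst measure_distr) (auto simp: vimage_def Int_def conj_commute)
  show "measure (process_law M (count_space UNIV) X) A = 0 \<or> measure (process_law M (count_space UNIV) X) A = 1"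
  proof (cases "measure M B = 0")
    case True
    then show ?thesis by (simp add: law)
  next
    case False
    \<comment> \<open>Every nonempty trajectory is independent of \<open>B\<close>, so conditioning
      on \<open>B\<close> does not change the law of the process. \<open>A\<close> has probability 1
      under the conditional law, hence also under the original one.\<close>
    let ?U = "uniform_measure M B"
    have "process_law ?U (count_space UNIV) X = process_law M (count_space UNIV) X"
    proof (rule process_law_eqI)
      show "prob_space ?U"
        using False by (intro prob_space_uniform_measure) (auto simp: M.emeasure_eq_measure)
      fix zs :: "'s list" assume "zs \<noteq> []"
      have "cyl ?U X zs = measure ?U (C zs)"
        by (simp add: cyl_def C_def)
      also have "\<dots> = measure M (C zs \<inter> B) / measure M B"
        using False by (simp add: measure_uniform_measure M.emeasure_eq_measure Int_commute)
      finally show "cyl ?U X zs = cyl M X zs"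
        using past'[OF \<open>zs \<noteq> []\<close>] False by (simp add: c)
    qed (simp_all add: M)
    moreover have "measure (process_law ?U (count_space UNIV) X) A = measure ?U B"
      unfolding process_law_def B_def
      by (subst measure_distr) (auto simp: vimage_def Int_def conj_commute)
    moreover have "measure ?U B = 1"
      using False by (simp add: measure_uniform_measure M.emeasure_eq_measure)
    ultimately show ?thesis by simp
  qed
qed

end

section \<open>The Beta prime distribution\<close>

text \<open>The substitution x = t / (1 - t), for which 1 + x = 1 / (1 - t), turns the integrand
  into that of the Beta integral on (0, 1). General parameters are kept because the normalisation
  uses (m, l + 1) and the mean uses (m + 1, l).\<close>

lemma nn_integral_beta_prime_kernel:
  assumes a: "a > 0" and b: "b > (0 :: real)"
  shows "(\<integral>\<^sup>+x. ennreal (indicator {0<..} x * (x powr (a - 1) * (1 + x) powr (- a - b))) \<partial>lborel) = ennreal (Beta a b)"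
proof -
  define f where "f x = x powr (a - 1) * (1 + x) powr (- a - b)" for x :: real
  define g where "g t = t / (1 - t)" for t :: real
  have g_deriv: "(g has_field_derivative 1 / (1 - t)\<^sup>2) (at t within {0<..<1})" if "t \<in> {0<..<1}" for t
    unfolding g_def using that
    by (auto intro!: derivative_eq_intros simp: field_simps power2_eq_square)
  have g_inj: "inj_on g {0<..<1}"
    by (auto simp: inj_on_def g_def field_simps)
  have g_img: "g ` {0<..<1} = {0<..}"
  proof (intro equalityI subsetI)
    fix x :: real assume "x \<in> {0<..}"
    then show "x \<in> g ` {0<..<1}"
      by (intro image_eqI[of _ _ "x / (1 + x)"]) (auto simp: g_def field_simps)
  qed (auto simp: g_def)
  have eq: "\<bar>1 / (1 - t)\<^sup>2\<bar> * f (g t) = t powr (a - 1) * (1 - t) powr (b - 1)"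
    if t: "t \<in> {0<..<1}" for t
  proof -
    have 1: "1 + g t = (1 - t) powr (-1)"
      using t by (simp add: g_def field_simps powr_minus)
    have 2: "1 / (1 - t)\<^sup>2 = (1 - t) powr (-2)"
      using t by (simp add: powr_minus field_simps)
    have 3: "g t powr (a - 1) = t powr (a - 1) * (1 - t) powr (1 - a)"
      using t powr_minus[of "1 - t" "a - 1"] by (simp add: g_def powr_divide field_simps)
    have 4: "(1 + g t) powr (- a - b) = (1 - t) powr (a + b)"
      unfolding 1 powr_powr by (simp add: add.commute)
    have "\<bar>1 / (1 - t)\<^sup>2\<bar> * f (g t) =
        (1 - t) powr (-2) * (t powr (a - 1) * (1 - t) powr (1 - a) * (1 - t) powr (a + b))"
      using t by (simp add: f_def 2 3 4)
    also have "\<dots> = t powr (a - 1) * ((1 - t) powr (-2) * (1 - t) powr (1 - a) * (1 - t) powr (a + b))"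
      by (simp add: mult_ac)
    also have "(1 - t) powr (-2) * (1 - t) powr (1 - a) * (1 - t) powr (a + b) = (1 - t) powr (b - 1)"
      by (simp flip: powr_add)
    finally show ?thesis .
  qed
  have hB: "((\<lambda>t. t powr (a - 1) * (1 - t) powr (b - 1)) has_integral Beta a b) {0<..<1}"
    using has_integral_Beta_real[OF a b] by (simp add: has_integral_Icc_iff_Ioo)
  then have "((\<lambda>t. \<bar>1 / (1 - t)\<^sup>2\<bar> * f (g t)) has_integral Beta a b) {0<..<1}"
    by (subst has_integral_cong[OF eq]) auto
  moreover from this have "(\<lambda>t. \<bar>1 / (1 - t)\<^sup>2\<bar> * f (g t)) absolutely_integrable_on {0<..<1}"
    by (intro nonnegative_absolutely_integrable_1) (auto simp: f_def has_integral_integrable)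
  ultimately have "f absolutely_integrable_on g ` {0<..<1} \<and> integral (g ` {0<..<1}) f = Beta a b"
    using has_absolute_integral_change_of_variables_1'[OF _ g_deriv g_inj, of f "Beta a b"]
    by (auto simp: integral_unique)
  then have "(f has_integral Beta a b) {0<..}"
    unfolding g_img by (metis absolutely_integrable_on_def integrable_integral)
  then have "((\<lambda>x. if x \<in> {0<..} then f x else 0) has_integral Beta a b) UNIV"
    by (simp only: has_integral_restrict_UNIV)
  also have "(\<lambda>x. if x \<in> {0<..} then f x else 0) = (\<lambda>x. indicator {0<..} x * f x)"
    by (auto simp: fun_eq_iff)
  finally have "((\<lambda>x. indicator {0<..} x * f x) has_integral Beta a b) UNIV" .
  then show ?thesis
    unfolding f_def by (subst nn_integral_has_integral_lborel) auto
qed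

lemma beta_prime_density_eq:
  "beta_prime_density m l x = indicator {0<..} x * (x powr (m - 1) * (1 + x) powr (- m - (l + 1))) / Beta m (l + 1)"
  by (simp add: beta_prime_density_def algebra_simps)

lemma beta_prime_density_nonneg: "m > 0 \<Longrightarrow> l > 0 \<Longrightarrow> 0 \<le> beta_prime_density m l x"
  by (simp add: beta_prime_density_def Beta_def Gamma_real_pos less_imp_le)

lemma borel_measurable_beta_prime_density [measurable]: "beta_prime_density m l \<in> borel_measurable borel"
  unfolding beta_prime_density_def[abs_def] by measurable

lemma sets_beta_prime [measurable_cong, simp]: "sets (beta_prime m l) = sets borel"
  by (simp add: beta_prime_def)

lemma prob_space_beta_prime:
  assumes "m > 0" "l > 0"
  shows "prob_space (beta_prime m l)"
proof
  have B: "Beta m (l + 1) > 0"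
    using assms by (simp add: Beta_def Gamma_real_pos)
  have "emeasure (beta_prime m l) (space (beta_prime m l)) = 
     (\<integral>\<^sup>+x. ennreal (1 / Beta m (l + 1)) * ennreal (indicator {0<..} x * (x powr (m - 1) * (1 + x) powr (- m - (l + 1)))) \<partial>lborel)"
    using B by (auto simp: beta_prime_def emeasure_density beta_prime_density_eq ennreal_mult'[symmetric]
        intro!: nn_integral_cong)
  also have "\<dots> = ennreal (1 / Beta m (l + 1)) * ennreal (Beta m (l + 1))"
    using assms by (subst nn_integral_cmult) (auto simp: nn_integral_beta_prime_kernel)
  also have "\<dots> = 1"
    using B by (simp flip: ennreal_mult'')
  finally show "emeasure (beta_prime m l) (space (beta_prime m l)) = 1" .
qed

text \<open>A factor x moves the parameters from (m, l + 1) to (m + 1, l). Their sum is unchanged,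
  so the denominators of the two Beta values cancel and the recursion of Gamma leaves m / l.\<close>

lemma nn_integral_beta_prime_mean:
  assumes "m > 0" "l > 0"
  shows "(\<integral>\<^sup>+x. ennreal x \<partial>beta_prime m l) = ennreal (m / l)"
proof -
  have B: "Beta m (l + 1) > 0"
    using assms by (simp add: Beta_def Gamma_real_pos)
  have "(\<integral>\<^sup>+x. ennreal x \<partial>beta_prime m l) =
      (\<integral>\<^sup>+x. ennreal (beta_prime_density m l x) * ennreal x \<partial>lborel)"
    unfolding beta_prime_def by (subst nn_integral_density) auto
  also have "\<dots> = (\<integral>\<^sup>+x. ennreal (1 / Beta m (l + 1)) * ennreal (indicator {0<..} x * (x powr (m + 1 - 1) * (1 + x) powr (- (m + 1) - l))) \<partial>lborel)"
  proof (rule nn_integral_cong)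
    fix x :: real
    show "ennreal (beta_prime_density m l x) * ennreal x = 
       ennreal (1 / Beta m (l + 1)) * ennreal (indicator {0<..} x * (x powr (m + 1 - 1) * (1 + x) powr (- (m + 1) - l)))"
    proof (cases "x > 0")
      case True
      have e: "(1 + x) powr (- m - l - 1) = (1 + x) powr (- (m + 1) - l)"
        by (rule arg_cong2[where f="(powr)"]) simp_all
      have xm: "x powr m = x powr (m - 1) * x"
        using powr_mult_base[of x "m - 1"] True by (simp add: mult.commute)
      have "beta_prime_density m l x * x = 
         1 / Beta m (l + 1) * (indicator {0<..} x * (x powr (m + 1 - 1) * (1 + x) powr (- (m + 1) - l)))"
        using True by (simp add: beta_prime_density_def e xm)
      then show ?thesis
        using B beta_prime_density_nonneg[OF assms, of x] True by (simp add: ennreal_mult'[symmetric])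
    next
      case False
      then show ?thesis by (simp add: ennreal_neg)
    qed
  qed
  also have "\<dots> = ennreal (1 / Beta m (l + 1)) * ennreal (Beta (m + 1) l)"
    using assms nn_integral_beta_prime_kernel[of "m + 1" l]
    by (subst nn_integral_cmult) (simp_all del: add_diff_cancel_right')
  also have "\<dots> = ennreal (m / l)"
  proof -
    have "Gamma (m + 1) = m * Gamma m" "Gamma (l + 1) = l * Gamma l"
      using assms by (auto intro!: Gamma_plus1 dest: nonpos_Ints_nonpos)
    moreover have "Gamma m \<noteq> 0" "Gamma l \<noteq> 0" "Gamma (1 + (l + m)) \<noteq> 0"
      using assms by (simp_all add: less_imp_neq[OF Gamma_real_pos, symmetric])
    ultimately have "1 / Beta m (l + 1) * Beta (m + 1) l = m / l"
      using assms by (simp add: Beta_def add_ac field_simps)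
    then show ?thesis
      using B by (simp flip: ennreal_mult')
  qed
  finally show ?thesis .
qed

section \<open>The transition kernel\<close>

lemma mnb_count_pmf_eq_geometric:
  "a > 0 \<Longrightarrow> mnb_count_pmf a k = pmf (geometric_pmf (1 / (1 + a))) k"
  by (subst pmf_geometric) (auto simp: mnb_count_pmf_def field_simps power_divide)

lemma borel_measurable_mnb_count_pmf [measurable]: "(\<lambda>a. mnb_count_pmf a k) \<in> borel_measurable borel"
  unfolding mnb_count_pmf_def by measurable

lemma nn_integral_mnb_count_pmf:
  assumes "a > 0"
  shows "(\<integral>\<^sup>+k. ennreal (real k) * ennreal (mnb_count_pmf a k) \<partial>count_space UNIV) = ennreal a"
proof -
  let ?p = "1 / (1 + a)"
  have p: "?p \<in> {0<..1}" using assms by simp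
  have "(\<integral>\<^sup>+k. ennreal (real k) * ennreal (mnb_count_pmf a k) \<partial>count_space UNIV) =
     (\<integral>\<^sup>+k. ennreal (real k) \<partial>measure_pmf (geometric_pmf ?p))"
    using assms by (simp add: nn_integral_measure_pmf mnb_count_pmf_eq_geometric mult.commute)
  also have "\<dots> = ennreal ((1 - ?p) / ?p)"
    using p by (subst nn_integral_eq_integral)
      (auto simp: integrable_real_geometric_pmf expectation_geometric_pmf)
  also have "(1 - ?p) / ?p = a"
    using assms by (simp add: field_simps)
  finally show ?thesis .
qed

lemma AE_beta_prime_pos: "AE x in beta_prime m l. x > 0"
  unfolding beta_prime_def
  by (subst AE_density) (auto simp: beta_prime_density_def intro!: AE_I2)

lemma mnb_count_pmf_bounds: "a > 0 \<Longrightarrow> 0 \<le> mnb_count_pmf a k \<and> mnb_count_pmf a k \<le> 1"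
  by (metis mnb_count_pmf_eq_geometric pmf_le_1 pmf_nonneg)

text \<open>Exchanging the sum over the values with the expectation over the coefficient leaves the
  mean of the geometric law, which is the coefficient itself. The space is arbitrary because the
  lemma serves both a given solution and the constructed noise.\<close>

lemma (in prob_space) nn_integral_mixed_geometric:
  fixes A :: "'a \<Rightarrow> real" and N :: "'a \<Rightarrow> nat"
  assumes A: "A \<in> borel_measurable M" and distr_A: "distr M lborel A = beta_prime m l"
    and N: "N \<in> measurable M (count_space UNIV)"
    and law: "\<And>k. prob {\<omega> \<in> space M. N \<omega> = k} = (\<integral>\<omega>. mnb_count_pmf (A \<omega>) k \<partial>M)"
    and "m > 0" "l > 0"
  shows "(\<integral>\<^sup>+\<omega>. ennreal (real (N \<omega>)) \<partial>M) = ennreal (m / l)"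
proof -
  note [measurable] = A N
  have pos: "AE \<omega> in M. A \<omega> > 0"
    using AE_beta_prime_pos[of m l] A unfolding distr_A[symmetric]
    by (subst (asm) AE_distr_iff) auto
  obtain p where p: "measure_pmf p = distr M (count_space UNIV) N"
    using distr_count_space_pmf[OF N] .
  have pmf_p: "ennreal (pmf p k) = (\<integral>\<^sup>+\<omega>. ennreal (mnb_count_pmf (A \<omega>) k) \<partial>M)" for k
  proof -
    have "pmf p k = measure (distr M (count_space UNIV) N) {k}"
      by (simp add: pmf.rep_eq p)
    also have "\<dots> = (\<integral>\<omega>. mnb_count_pmf (A \<omega>) k \<partial>M)"
      by (subst measure_distr) (auto simp: law[symmetric] vimage_def Int_def conj_commute)
    finally show ?thesis
      using pos by (subst nn_integral_eq_integral)
        (auto intro!: integrable_const_bound[where B=1] elim!: eventually_mono simp: mnb_count_pmf_bounds)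
  qed
  have "(\<integral>\<^sup>+\<omega>. ennreal (real (N \<omega>)) \<partial>M) = (\<integral>\<^sup>+k. ennreal (real k) \<partial>measure_pmf p)"
    by (simp add: p nn_integral_distr)
  also have "\<dots> = (\<integral>\<^sup>+k. (\<integral>\<^sup>+\<omega>. ennreal (real k) * ennreal (mnb_count_pmf (A \<omega>) k) \<partial>M) \<partial>count_space UNIV)"
    by (simp add: nn_integral_measure_pmf pmf_p nn_integral_cmult mult.commute)
  also have "\<dots> = (\<integral>\<^sup>+\<omega>. (\<integral>\<^sup>+k. ennreal (real k) * ennreal (mnb_count_pmf (A \<omega>) k) \<partial>count_space UNIV) \<partial>M)"
    by (simp add: nn_integral_count_space_nat nn_integral_suminf)
  also have "\<dots> = (\<integral>\<^sup>+\<omega>. ennreal (A \<omega>) \<partial>M)"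
    using pos by (intro nn_integral_cong_AE) (auto elim!: eventually_mono simp: nn_integral_mnb_count_pmf)
  also have "\<dots> = (\<integral>\<^sup>+x. ennreal x \<partial>distr M lborel A)"
    by (subst nn_integral_distr) auto
  also have "\<dots> = ennreal (m / l)"
    unfolding distr_A using assms by (intro nn_integral_beta_prime_mean)
  finally show ?thesis .
qed

lemma measurable_Pair_countable:
  fixes f :: "'a \<Rightarrow> 'b::countable" and g :: "'a \<Rightarrow> 'c::countable"
  assumes "f \<in> measurable M (count_space UNIV)" "g \<in> measurable M (count_space UNIV)"
  shows "(\<lambda>x. (f x, g x)) \<in> measurable M (count_space UNIV)"
  using measurable_Pair[OF assms] by (simp add: pair_measure_countable)

lemma coord_simps [simp]: "coord 1 z = fst z" "coord 2 z = snd z"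
  by (simp_all add: coord_def)

lemma prod_eq_coord_iff: "z = w \<longleftrightarrow> (\<forall>i. coord i z = coord i w)"
  by (auto simp: forall_2 prod_eq_iff)

text \<open>The counts that the operator reads when the previous state is \<open>x\<close>: one more
  than each component of \<open>x\<close>, with indices from 1. Lists keep the value type
  countable.\<close>

definition count_vec :: "(2 \<Rightarrow> nat \<Rightarrow> nat \<Rightarrow> 'a \<Rightarrow> nat) \<Rightarrow> nat \<Rightarrow> nat \<times> nat \<Rightarrow> 'a \<Rightarrow> nat list \<times> nat list" where
  "count_vec G t x \<omega> =
     (map (\<lambda>j. G 1 t (Suc j) \<omega>) [0..<Suc (fst x)], map (\<lambda>j. G 2 t (Suc j) \<omega>) [0..<Suc (snd x)])"

text \<open>Unlike \<open>thinned\<close>, this freezes the previous state, so it is a function of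
  the counting variables alone.\<close>

definition thinned_at :: "(2 \<Rightarrow> nat \<Rightarrow> nat \<Rightarrow> 'a \<Rightarrow> nat) \<Rightarrow> nat \<Rightarrow> nat \<times> nat \<Rightarrow> 'a \<Rightarrow> nat \<times> nat" where
  "thinned_at G t x \<omega> = (mnb_op (\<lambda>j. G 1 t j \<omega>) (fst x), mnb_op (\<lambda>j. G 2 t j \<omega>) (snd x))"

text \<open>The probability that the counts of one component at one time take the values
  \<open>ks\<close>. The integral stands outside the product since these counts share their
  coefficient.\<close>

definition mixture_weight :: "real \<Rightarrow> real \<Rightarrow> nat list \<Rightarrow> real" where
  "mixture_weight m l ks = (\<integral>a. (\<Prod>j<length ks. mnb_count_pmf a (ks ! j)) \<partial>beta_prime m l)"

text \<open>Written in the parameters only, so that all solutions share it. That the weights sum to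
  1 is not computed; \<open>count_vec_law\<close> obtains it from the law of an actual random
  vector.\<close>

definition count_vec_pmf :: "real \<Rightarrow> (2 \<Rightarrow> real) \<Rightarrow> nat \<times> nat \<Rightarrow> (nat list \<times> nat list) pmf" where
  "count_vec_pmf l m x = embed_pmf (\<lambda>v.
     if length (fst v) = Suc (fst x) \<and> length (snd v) = Suc (snd x)
     then mixture_weight (m 1) l (fst v) * mixture_weight (m 2) l (snd v) else 0)"

definition thinned_pmf :: "real \<Rightarrow> (2 \<Rightarrow> real) \<Rightarrow> nat \<times> nat \<Rightarrow> (nat \<times> nat) pmf" where
  "thinned_pmf l m x = map_pmf (map_prod sum_list sum_list) (count_vec_pmf l m x)"

definition brc_kernel :: "real \<Rightarrow> (2 \<Rightarrow> real) \<Rightarrow> (nat \<times> nat) pmf \<Rightarrow> nat \<times> nat \<Rightarrow> (nat \<times> nat) pmf" where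
  "brc_kernel l m f\<^sub>Z x = map_pmf (\<lambda>(w, z). w + z) (pair_pmf (thinned_pmf l m x) f\<^sub>Z)"

lemma mnb_op_eq_sum_list: "mnb_op g n = sum_list (map (\<lambda>j. g (Suc j)) [0..<Suc n])"
proof -
  have "mnb_op g n = (\<Sum>j\<in>{0..<Suc n}. g (Suc j))"
    unfolding mnb_op_def by (rule sum.reindex_bij_witness[of _ Suc "\<lambda>j. j - 1"]) auto
  then show ?thesis
    by (simp only: interv_sum_list_conv_sum_set_nat set_upt)
qed

lemma thinned_at_eq: "thinned_at G t x \<omega> = map_prod sum_list sum_list (count_vec G t x \<omega>)"
  by (simp add: thinned_at_def count_vec_def mnb_op_eq_sum_list del: upt_Suc)

lemma (in prob_space) indep_pairD:
  assumes "indep_pair S U T V" "A \<in> sets S" "B \<in> sets T"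
  shows "prob (U -` A \<inter> V -` B \<inter> space M) = prob (U -` A \<inter> space M) * prob (V -` B \<inter> space M)"
proof -
  have "prob ((U -` A \<inter> space M) \<inter> (V -` B \<inter> space M)) = prob (U -` A \<inter> space M) * prob (V -` B \<inter> space M)"
    using assms unfolding indep_pair_def by (intro indep_setD) auto
  moreover have "(U -` A \<inter> space M) \<inter> (V -` B \<inter> space M) = U -` A \<inter> V -` B \<inter> space M" by auto
  ultimately show ?thesis by simp
qed

section \<open>The Markov property of a solution\<close>

context brcmnbinar
begin

lemma coeff_measurable: "t \<ge> 1 \<Longrightarrow> \<alpha> i t \<in> borel_measurable M"
  using distributed_measurable[OF coeff_distributed[of t i]] by simp

lemma coeff_distr: "t \<ge> 1 \<Longrightarrow> distr M lborel (\<alpha> i t) = beta_prime (m i) l"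
  using coeff_distributed[of t i] by (simp add: distributed_def beta_prime_def)

lemma AE_coeff_pos:
  assumes t: "t \<ge> 1"
  shows "AE \<omega> in M. \<alpha> i t \<omega> > 0"
  using AE_beta_prime_pos[of "m i" l] coeff_measurable[OF t, of i] unfolding coeff_distr[OF t, symmetric]
  by (subst (asm) AE_distr_iff) auto

lemma driver_measurable: "t \<ge> 1 \<Longrightarrow> driver \<alpha> G Z t \<in> measurable M driver_space"
  using driver_indep by (auto simp: indep_vars_def)

lemma count_measurable:
  assumes "t \<ge> 1" "j \<ge> 1"
  shows "G i t j \<in> measurable M (count_space UNIV)"
proof -
  have "(\<lambda>\<omega>. fst (snd (driver \<alpha> G Z t \<omega>)) (i, j)) \<in> measurable M (count_space UNIV)"
    using assms(2) by (intro measurable_compose[OF driver_measurable[OF assms(1)]]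
        measurable_compose[OF measurable_snd] measurable_compose[OF measurable_fst]
        measurable_component_singleton) auto
  then show ?thesis
    using assms by (simp add: driver_def)
qed

lemma innov_measurable: "t \<ge> 1 \<Longrightarrow> Z t \<in> measurable M (count_space UNIV)"
  using innov_indep by (auto simp: indep_vars_def)

lemma coeffs_measurable: "coeffs \<alpha> \<in> measurable M (\<Pi>\<^sub>M p\<in>UNIV \<times> {1..}. borel)"
  unfolding coeffs_def[abs_def]
  by (intro measurable_restrict) (auto intro: coeff_measurable)

text \<open>The expectation of a conditional expectation is the probability itself, so integrating
  \<open>counting_cond_law\<close> removes the conditioning.\<close>

lemma counting_law:
  assumes J: "finite J" "J \<subseteq> UNIV \<times> {1..} \<times> {1..}"
  shows "prob {\<omega> \<in> space M. \<forall>(i, t, j)\<in>J. G i t j \<omega> = k i t j} =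
    expectation (\<lambda>\<omega>. \<Prod>(i, t, j)\<in>J. mnb_count_pmf (\<alpha> i t \<omega>) (k i t j))"
proof -
  let ?F = "vimage_algebra (space M) (coeffs \<alpha>) (\<Pi>\<^sub>M p\<in>UNIV \<times> {1..}. borel)"
  let ?E = "{\<omega> \<in> space M. \<forall>(i, t, j)\<in>J. G i t j \<omega> = k i t j}"
  interpret finite_measure_subalgebra M ?F
    by unfold_locales
      (auto simp: subalgebra_def sets_vimage_algebra
        intro!: sets.sigma_sets_subset measurable_sets[OF coeffs_measurable])
  have [measurable]: "?E \<in> sets M"
  proof -
    have "?E = {\<omega> \<in> space M. \<forall>p\<in>J. G (fst p) (fst (snd p)) (snd (snd p)) \<omega> = k (fst p) (fst (snd p)) (snd (snd p))}"
      by (auto simp: case_prod_beta)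
    also have "\<dots> \<in> sets M"
    proof (rule sets.sets_Collect_finite_All)
      fix p assume "p \<in> J"
      then have [measurable]: "G (fst p) (fst (snd p)) (snd (snd p)) \<in> measurable M (count_space UNIV)"
        using J by (intro count_measurable) auto
      show "{\<omega> \<in> space M. G (fst p) (fst (snd p)) (snd (snd p)) \<omega> = k (fst p) (fst (snd p)) (snd (snd p))} \<in> sets M"
        by measurable
    qed (rule J)
    finally show ?thesis .
  qed
  have int: "integrable M (indicator ?E :: 'a \<Rightarrow> real)"
    by (rule integrable_const_bound[where B=1]) auto
  have "prob ?E = expectation (real_cond_exp M ?F (indicator ?E))"
    unfolding real_cond_exp_int(2)[OF int] by simp
  also have "\<dots> = expectation (\<lambda>\<omega>. \<Prod>(i, t, j)\<in>J. mnb_count_pmf (\<alpha> i t \<omega>) (k i t j))"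
  proof (rule integral_cong_AE)
    show "(\<lambda>\<omega>. \<Prod>(i, t, j)\<in>J. mnb_count_pmf (\<alpha> i t \<omega>) (k i t j)) \<in> borel_measurable M"
      using J by (intro borel_measurable_prod)
        (auto intro!: measurable_compose[OF _ borel_measurable_mnb_count_pmf] coeff_measurable)
  qed (use counting_cond_law[OF J] in auto)
  finally show ?thesis .
qed

lemma count_mean:
  assumes "t \<ge> 1" "j \<ge> 1" "m i > 0" "l > 0"
  shows "(\<integral>\<^sup>+\<omega>. ennreal (real (G i t j \<omega>)) \<partial>M) = ennreal (m i / l)"
proof (rule nn_integral_mixed_geometric)
  show "prob {\<omega> \<in> space M. G i t j \<omega> = k} = (\<integral>\<omega>. mnb_count_pmf (\<alpha> i t \<omega>) k \<partial>M)" for k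
    using counting_law[of "{(i, t, j)}" "\<lambda>_ _ _. k"] assms by simp
qed (use assms coeff_measurable coeff_distr count_measurable in auto)

lemma count_vec_measurable:
  assumes "t \<ge> 1"
  shows "count_vec G t x \<in> measurable M (count_space UNIV)"
proof -
  have "(\<lambda>\<omega>. map (\<lambda>j. G i t (Suc j) \<omega>) [0..<n]) \<in> measurable M (count_space UNIV)" for i n
    using measurable_traj[of "\<lambda>j. G i t (Suc j)" M n] count_measurable[of t] assms
    by (simp add: traj_def[abs_def])
  then show ?thesis
    unfolding count_vec_def[abs_def]
    by (intro measurable_Pair_countable)
qed

text \<open>Given the coefficients the weights form one product per component. The two coefficients
  at time \<open>t\<close> are independent, so the expectation of the two products factors into two
  mixture weights.\<close>

lemma count_vec_law:
  assumes t: "t \<ge> 1" and ml: "m 1 > 0" "m 2 > 0" "l > 0"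
  shows "measure_pmf (count_vec_pmf l m x) = distr M (count_space UNIV) (count_vec G t x)"
proof -
  obtain p where p: "measure_pmf p = distr M (count_space UNIV) (count_vec G t x)"
    using distr_count_space_pmf[OF count_vec_measurable[OF t]] .
  have pmf_p: "pmf p v = (if length (fst v) = Suc (fst x) \<and> length (snd v) = Suc (snd x)
     then mixture_weight (m 1) l (fst v) * mixture_weight (m 2) l (snd v) else 0)" for v
  proof -
    have "pmf p v = measure (distr M (count_space UNIV) (count_vec G t x)) {v}"
      by (simp add: pmf.rep_eq p)
    also have "\<dots> = prob {\<omega> \<in> space M. count_vec G t x \<omega> = v}"
      using count_vec_measurable[OF t, of x]
      by (subst measure_distr) (auto simp: vimage_def Int_def conj_commute)
    finally have *: "pmf p v = prob {\<omega> \<in> space M. count_vec G t x \<omega> = v}" .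
    show ?thesis
    proof (cases "length (fst v) = Suc (fst x) \<and> length (snd v) = Suc (snd x)")
      case False
      then have "{\<omega> \<in> space M. count_vec G t x \<omega> = v} = {}"
        by (auto simp: count_vec_def)
      then show ?thesis
        using False by (simp only: * measure_empty if_False)
    next
      case True
      define n1 n2 where n: "n1 = Suc (fst x)" "n2 = Suc (snd x)"
      define J1 J2 where J12: "J1 = (\<lambda>j. (1::2, t, Suc j)) ` {..<n1}" "J2 = (\<lambda>j. (2::2, t, Suc j)) ` {..<n2}"
      define k where "k i t' j = (if i = (1::2) then fst v ! (j - 1) else snd v ! (j - 1))" for i and t' j :: nat
      define f where "f i ks \<omega> = (\<Prod>j<length ks. mnb_count_pmf (\<alpha> i t \<omega>) (ks ! j))" for i ks \<omega>
      have J: "finite (J1 \<union> J2)" "J1 \<union> J2 \<subseteq> UNIV \<times> {1..} \<times> {1..}" "J1 \<inter> J2 = {}"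
        using t by (auto simp: J12)
      have mw: "expectation (f i ks) = mixture_weight (m i) l ks" for i ks
      proof -
        have "mixture_weight (m i) l ks = (\<integral>a. (\<Prod>j<length ks. mnb_count_pmf a (ks ! j)) \<partial>distr M lborel (\<alpha> i t))"
          by (simp add: mixture_weight_def coeff_distr[OF t])
        also have "\<dots> = expectation (f i ks)"
          using coeff_measurable[OF t, of i] by (subst integral_distr) (auto simp: f_def[abs_def])
        finally show ?thesis by simp
      qed
      have "{\<omega> \<in> space M. count_vec G t x \<omega> = v} = {\<omega> \<in> space M. \<forall>(i, t, j)\<in>J1 \<union> J2. G i t j \<omega> = k i t j}"
        using True by (auto simp: count_vec_def J12 k_def n prod_eq_iff list_eq_iff_nth_eq ball_Un simp del: upt_Suc)
      then have "pmf p v = expectation (\<lambda>\<omega>. \<Prod>(i, t, j)\<in>J1 \<union> J2. mnb_count_pmf (\<alpha> i t \<omega>) (k i t j))"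
        using counting_law[OF J(1,2)] by (simp add: *)
      also have "\<dots> = expectation (\<lambda>\<omega>. f 1 (fst v) \<omega> * f 2 (snd v) \<omega>)"
      proof (intro Bochner_Integration.integral_cong refl)
        fix \<omega>
        show "(\<Prod>(i, t, j)\<in>J1 \<union> J2. mnb_count_pmf (\<alpha> i t \<omega>) (k i t j)) = f 1 (fst v) \<omega> * f 2 (snd v) \<omega>"
          using J True by (subst prod.union_disjoint)
            (auto simp: J12 f_def k_def n prod.reindex inj_on_def)
      qed
      also have "\<dots> = expectation (f 1 (fst v)) * expectation (f 2 (snd v))"
      proof (rule indep_var_lebesgue_integral)
        \<comment> \<open>\<open>coeff_components_indep\<close> concerns the whole coefficient
          sequences; composing with functions of the entry at \<open>t\<close> specialises it to a
          single time.\<close>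
        have b: "(\<lambda>y. \<Prod>j<length ks. mnb_count_pmf (y t) (ks ! j)) \<in> borel_measurable (\<Pi>\<^sub>M t\<in>{1..}. borel)" for ks
          by measurable (use t in auto)
        show "indep_var borel (f 1 (fst v)) borel (f 2 (snd v))"
          using indep_var_compose[OF coeff_components_indep b[of "fst v"] b[of "snd v"]] t
          by (simp add: f_def[abs_def] comp_def)
        have "integrable M (f i ks)" for i ks
        proof (rule integrable_const_bound[where B=1])
          show "f i ks \<in> borel_measurable M"
            unfolding f_def using coeff_measurable[OF t, of i] by measurable
          show "AE \<omega> in M. norm (f i ks \<omega>) \<le> 1"
            using AE_coeff_pos[OF t, of i]
          proof eventually_elim
            case (elim \<omega>)
            then show ?case
              using mnb_count_pmf_bounds[of "\<alpha> i t \<omega>"] by (auto simp: f_def abs_prod intro!: prod_le_1)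
          qed
        qed
        then show "integrable M (f 1 (fst v))" "integrable M (f 2 (snd v))" by auto
      qed
      finally show ?thesis using True by (simp add: mw)
    qed
  qed
  have "count_vec_pmf l m x = embed_pmf (pmf p)"
    by (simp add: count_vec_pmf_def pmf_p[abs_def])
  also have "\<dots> = p"
    by (rule type_definition.Rep_inverse[OF td_pmf_embed_pmf])
  finally show ?thesis by (simp add: p)
qed

lemma thinned_law:
  assumes t: "t \<ge> 1" and ml: "m 1 > 0" "m 2 > 0" "l > 0"
  shows "measure_pmf (thinned_pmf l m x) = distr M (count_space UNIV) (thinned_at G t x)"
  unfolding thinned_pmf_def map_pmf_rep_eq count_vec_law[OF assms]
  using count_vec_measurable[OF t]
  by (subst distr_distr) (auto simp: comp_def thinned_at_eq[abs_def])

text \<open>Two independence assumptions are applied in turn: the innovation is split off from the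
  thinned vector and the past, then the thinned vector from the past. The second step works because
  on trajectories ending in \<open>x\<close> the thinned vector is \<open>thinned_at G t x\<close>,
  a function of the driver.\<close>

lemma prob_trajectory_thinned_innov:
  assumes ml: "m 1 > 0" "m 2 > 0" "l > 0" and len: "t = Suc (length xs)"
  shows "prob {\<omega> \<in> space M. traj X t \<omega> = xs @ [x] \<and> thinned_at G t x \<omega> = w \<and> Z t \<omega> = z} =
    cyl M X (xs @ [x]) * (pmf (thinned_pmf l m x) w * pmf f\<^sub>Z z)"
proof -
  have t: "t \<ge> 1" using len by simp
  define p where "p = (\<lambda>s\<in>{..<t}. (xs @ [x]) ! s)"
  have past_iff: "past X t \<omega> = p \<longleftrightarrow> traj X t \<omega> = xs @ [x]" for \<omega>
    using len by (subst traj_eq_iff) (auto simp: past_def p_def fun_eq_iff restrict_def)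
  have thinned_eq: "thinned G X t \<omega> = thinned_at G t x \<omega>" if "traj X t \<omega> = xs @ [x]" for \<omega>
  proof -
    have "X (length xs) \<omega> = x"
      using that len by (simp add: traj_def)
    then show ?thesis
      by (simp add: thinned_def thinned_at_def len)
  qed
  have p: "{p} \<in> sets (past_space t)"
  proof -
    have "{p} = (\<Pi>\<^sub>E s\<in>{..<t}. {p s})"
      by (rule PiE_singleton[symmetric]) (simp add: p_def)
    also have "\<dots> \<in> sets (past_space t)"
      by (intro sets_PiM_I_finite) auto
    finally show ?thesis .
  qed
  \<comment> \<open>\<open>h\<close> reads the thinned vector off the driver. It evaluates the
    counts at indices from 1 on, where the restricted function in \<open>driver\<close> has its
    proper values.\<close>
  define h where "h d = ((\<Sum>j = 1..fst x + 1. fst (snd d) (1::2, j)), (\<Sum>j = 1..snd x + 1. fst (snd d) (2::2, j)))"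
    for d :: "(real \<times> real) \<times> (2 \<times> nat \<Rightarrow> nat) \<times> (nat \<times> nat)"
  have h_comp: "(\<lambda>d. fst (snd d) (i, j)) \<in> measurable driver_space (count_space UNIV)" if "j \<ge> 1" for i j
    using that by (intro measurable_compose[OF measurable_snd] measurable_compose[OF measurable_fst]
        measurable_component_singleton) auto
  have h_sum: "(\<lambda>d. \<Sum>j = 1..n. fst (snd d) (i, j)) \<in> measurable driver_space (count_space UNIV)" for i n
  proof (induction n)
    case (Suc n)
    then show ?case
      using h_comp[of "Suc n" i] by simp
  qed simp
  have h: "h \<in> measurable driver_space (count_space UNIV)"
    unfolding h_def[abs_def] by (intro measurable_Pair_countable h_sum)
  define D where "D = h -` {w} \<inter> space driver_space"
  have D: "D \<in> sets driver_space"
    unfolding D_def by (rule measurable_sets[OF h]) simp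
  have driver_D: "driver \<alpha> G Z t \<omega> \<in> D \<longleftrightarrow> thinned_at G t x \<omega> = w" if "\<omega> \<in> space M" for \<omega>
    using measurable_space[OF driver_measurable[OF t] that]
    by (auto simp: D_def h_def thinned_at_def mnb_op_def driver_def)
  have "{\<omega> \<in> space M. traj X t \<omega> = xs @ [x] \<and> thinned_at G t x \<omega> = w \<and> Z t \<omega> = z} =
      Z t -` {z} \<inter> (\<lambda>\<omega>. (thinned G X t \<omega>, past X t \<omega>)) -` ({w} \<times> {p}) \<inter> space M"
    (is "?L = ?R")
  proof (rule set_eqI)
    fix \<omega>
    show "\<omega> \<in> ?L \<longleftrightarrow> \<omega> \<in> ?R"
      using thinned_eq[of \<omega>] by (simp add: past_iff) metis
  qed
  then have "prob {\<omega> \<in> space M. traj X t \<omega> = xs @ [x] \<and> thinned_at G t x \<omega> = w \<and> Z t \<omega> = z} =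
      prob (Z t -` {z} \<inter> space M) * prob ((\<lambda>\<omega>. (thinned G X t \<omega>, past X t \<omega>)) -` ({w} \<times> {p}) \<inter> space M)"
    using indep_pairD[OF innov_indep_thinned_past[OF t], of "{z}" "{w} \<times> {p}"] p
    by (simp only: pair_measureI sets_count_space UNIV_I Pow_UNIV)
  also have "prob (Z t -` {z} \<inter> space M) = pmf f\<^sub>Z z"
    using innov_distr[OF t] innov_measurable[OF t]
    by (subst measure_distr[symmetric]) (auto simp: measure_pmf_single)
  also have "(\<lambda>\<omega>. (thinned G X t \<omega>, past X t \<omega>)) -` ({w} \<times> {p}) \<inter> space M =
      driver \<alpha> G Z t -` D \<inter> past X t -` {p} \<inter> space M" (is "?L = ?R")
  proof (rule set_eqI)
    fix \<omega>
    show "\<omega> \<in> ?L \<longleftrightarrow> \<omega> \<in> ?R"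
      using thinned_eq[of \<omega>] driver_D[of \<omega>] by (simp add: past_iff) metis
  qed
  also have "prob \<dots> = prob (driver \<alpha> G Z t -` D \<inter> space M) * prob (past X t -` {p} \<inter> space M)"
    by (rule indep_pairD[OF driver_indep_past[OF t] D p])
  also have "driver \<alpha> G Z t -` D \<inter> space M = thinned_at G t x -` {w} \<inter> space M" (is "?L = ?R")
  proof (rule set_eqI)
    fix \<omega>
    show "\<omega> \<in> ?L \<longleftrightarrow> \<omega> \<in> ?R"
      using driver_D[of \<omega>] by (simp; blast)
  qed
  also have "prob \<dots> = pmf (thinned_pmf l m x) w"
    using count_vec_measurable[OF t, of x] unfolding pmf.rep_eq thinned_law[OF t ml]
    by (subst measure_distr) (auto simp: thinned_at_eq[abs_def])
  also have "past X t -` {p} \<inter> space M = {\<omega> \<in> space M. traj X (length (xs @ [x])) \<omega> = xs @ [x]}"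
    by (rule set_eqI) (simp add: past_iff len[symmetric] conj_commute)
  finally show ?thesis
    by (simp add: cyl_def)
qed

lemma recursion_eq: "t \<ge> 1 \<Longrightarrow> AE \<omega> in M. X t \<omega> = thinned G X t \<omega> + Z t \<omega>"
  using recursion[of t] by (simp add: prod_eq_coord_iff forall_2)

text \<open>The event that \<open>y\<close> follows splits over the countably many pairs (w, z) with
  w + z = y. Each piece factors by \<open>prob_trajectory_thinned_innov\<close>, and the remaining
  sum is the convolution in \<open>brc_kernel\<close>.\<close>

lemma markov_chain_brc:
  assumes ml: "m 1 > 0" "m 2 > 0" "l > 0"
  shows "markov_chain M (brc_kernel l m f\<^sub>Z) X"
  unfolding markov_chain_def
proof (intro conjI allI)
  fix xs :: "(nat \<times> nat) list" and x y :: "nat \<times> nat"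
  define t where "t = Suc (length xs)"
  have t: "t \<ge> 1" by (simp add: t_def)
  note [measurable] = X_measurable innov_measurable[OF t] measurable_traj[of X M, OF X_measurable]
  have [measurable]: "thinned_at G t x \<in> measurable M (count_space UNIV)"
    using count_vec_measurable[OF t, of x] by (simp add: thinned_at_eq[abs_def])
  define S where "S = (\<lambda>(w, z). w + z) -` {y}"
  define E where "E = (\<lambda>(w, z). {\<omega> \<in> space M. traj X t \<omega> = xs @ [x] \<and> thinned_at G t x \<omega> = w \<and> Z t \<omega> = z})"
  have E: "E v \<in> sets M" for v
    unfolding E_def case_prod_beta by measurable
  have "ennreal (cyl M X (xs @ [x, y])) = emeasure M {\<omega> \<in> space M. traj X (Suc t) \<omega> = xs @ [x, y]}"
    by (simp add: cyl_def t_def emeasure_eq_measure)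
  also have "\<dots> = emeasure M (\<Union>v\<in>S. E v)"
  \<comment> \<open>The recursion holds almost surely only, so the two events agree up to a null
    set.\<close>
  proof (rule emeasure_eq_AE)
    show "AE \<omega> in M. \<omega> \<in> {\<omega> \<in> space M. traj X (Suc t) \<omega> = xs @ [x, y]} \<longleftrightarrow> \<omega> \<in> (\<Union>v\<in>S. E v)"
      using recursion_eq[OF t]
    proof eventually_elim
      case (elim \<omega>)
      have "traj X (Suc t) \<omega> = xs @ [x, y] \<longleftrightarrow> traj X t \<omega> = xs @ [x] \<and> X t \<omega> = y"
        using append1_eq_conv[of "traj X t \<omega>" "X t \<omega>" "xs @ [x]" y] by (simp add: traj_def)
      moreover have "thinned G X t \<omega> = thinned_at G t x \<omega>" if "traj X t \<omega> = xs @ [x]"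
        using that by (simp add: t_def traj_def thinned_def thinned_at_def)
      ultimately show ?case
        using elim by (auto simp: S_def E_def)
    qed
    show "(\<Union>v\<in>S. E v) \<in> sets M"
      using E by (intro sets.countable_UN') auto
  qed (intro sets_cyl X_measurable)
  also have "\<dots> = (\<integral>\<^sup>+v. emeasure M (E v) \<partial>count_space S)"
    using E by (intro emeasure_UN_countable) (auto simp: disjoint_family_on_def E_def)
  also have "\<dots> = (\<integral>\<^sup>+v. ennreal (cyl M X (xs @ [x])) * ennreal (pmf (pair_pmf (thinned_pmf l m x) f\<^sub>Z) v) \<partial>count_space S)"
  proof (rule nn_integral_cong)
    fix v :: "(nat \<times> nat) \<times> (nat \<times> nat)"
    obtain w z where "v = (w, z)" by (cases v)
    then show "emeasure M (E v) =
        ennreal (cyl M X (xs @ [x])) * ennreal (pmf (pair_pmf (thinned_pmf l m x) f\<^sub>Z) v)"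
      using prob_trajectory_thinned_innov[OF ml t_def, of x w z]
      by (simp add: E_def emeasure_eq_measure pmf_pair ennreal_mult')
  qed
  also have "\<dots> = ennreal (cyl M X (xs @ [x])) * emeasure (pair_pmf (thinned_pmf l m x) f\<^sub>Z) S"
    by (simp add: nn_integral_cmult nn_integral_pmf)
  also have "emeasure (pair_pmf (thinned_pmf l m x) f\<^sub>Z) S = ennreal (pmf (brc_kernel l m f\<^sub>Z x) y)"
    by (simp add: brc_kernel_def ennreal_pmf_map S_def)
  finally show "cyl M X (xs @ [x, y]) = cyl M X (xs @ [x]) * pmf (brc_kernel l m f\<^sub>Z x) y"
    by (simp flip: ennreal_mult')
qed (rule X_measurable)

end

section \<open>Coupling and contraction in the l1 distance\<close>

definition pdist :: "nat \<times> nat \<Rightarrow> nat \<times> nat \<Rightarrow> real" where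
  "pdist x y = \<bar>real (fst x) - real (fst y)\<bar> + \<bar>real (snd x) - real (snd y)\<bar>"

lemma pdist_nonneg: "0 \<le> pdist x y"
  by (simp add: pdist_def)

lemma pdist_ge_1: "x \<noteq> y \<Longrightarrow> 1 \<le> pdist x y"
  by (cases "fst x = fst y") (auto simp: pdist_def prod_eq_iff abs_if)

lemma pdist_add: "pdist (x + z) (y + z) = pdist x y"
  by (simp add: pdist_def)

text \<open>The operator has one summand more than its argument, so the shared summands end at index
  \<open>min a b + 1\<close> and cancel.\<close>

lemma abs_diff_mnb_op:
  "\<bar>real (mnb_op g a) - real (mnb_op g b)\<bar> = (\<Sum>j\<in>{min a b + 2..max a b + 1}. real (g j))"
proof -
  have *: "real (mnb_op g b) - real (mnb_op g a) = (\<Sum>j\<in>{a + 2..b + 1}. real (g j))" if "a \<le> b" for a b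
  proof -
    have "{1..b + 1} = {1..a + 1} \<union> {a + 2..b + 1}" "{1..a + 1} \<inter> {a + 2..b + 1} = {}"
      using that by auto
    then have "mnb_op g b = mnb_op g a + (\<Sum>j\<in>{a + 2..b + 1}. g j)"
      unfolding mnb_op_def by (simp only: sum.union_disjoint finite_atLeastAtMost)
    then show ?thesis by simp
  qed
  show ?thesis
  proof (cases "a \<le> b")
    case True
    then show ?thesis
      using *[OF True] sum_nonneg[of "{a + 2..b + 1}" "\<lambda>j. real (g j)"]
      by (simp only: min_absorb1 max_absorb2) linarith
  next
    case False
    then have "b \<le> a" by simp
    then show ?thesis
      using *[OF \<open>b \<le> a\<close>] sum_nonneg[of "{b + 2..a + 1}" "\<lambda>j. real (g j)"]
      by (simp only: min_absorb2 max_absorb1) linarith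
  qed
qed

context brcmnbinar
begin

text \<open>The unshared counts in a component are as many as the distance of the two states there,
  and each has mean m_i / l. Linearity of the integral copes with their common coefficient.\<close>

lemma nn_integral_pdist_thinned_at:
  assumes t: "t \<ge> 1" and ml: "\<And>i. m i > 0" "l > 0" and \<rho>: "\<And>i. m i / l \<le> \<rho>"
  shows "(\<integral>\<^sup>+\<omega>. ennreal (pdist (thinned_at G t x \<omega>) (thinned_at G t y \<omega>)) \<partial>M) \<le> ennreal (\<rho> * pdist x y)"
proof -
  have comp: "(\<integral>\<^sup>+\<omega>. ennreal \<bar>real (mnb_op (\<lambda>j. G i t j \<omega>) a) - real (mnb_op (\<lambda>j. G i t j \<omega>) b)\<bar> \<partial>M) \<le>
     ennreal (\<rho> * \<bar>real a - real b\<bar>)" for i a b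
  proof -
    let ?J = "{min a b + 2..max a b + 1}"
    have "(\<integral>\<^sup>+\<omega>. ennreal \<bar>real (mnb_op (\<lambda>j. G i t j \<omega>) a) - real (mnb_op (\<lambda>j. G i t j \<omega>) b)\<bar> \<partial>M) =
        (\<integral>\<^sup>+\<omega>. (\<Sum>j\<in>?J. ennreal (real (G i t j \<omega>))) \<partial>M)"
      unfolding abs_diff_mnb_op by (intro nn_integral_cong sum_ennreal[symmetric]) simp
    also have "\<dots> = (\<Sum>j\<in>?J. (\<integral>\<^sup>+\<omega>. ennreal (real (G i t j \<omega>)) \<partial>M))"
      using count_measurable[OF t, of _ i]
      by (intro nn_integral_sum measurable_compose[OF _ measurable_ennreal] measurable_compose[OF count_measurable[OF t]]) auto
    also have "\<dots> = (\<Sum>j\<in>?J. ennreal (m i / l))"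
      using count_mean[OF t _ ml(1) ml(2)] by (intro sum.cong) auto
    also have "\<dots> = ennreal (\<Sum>j\<in>?J. m i / l)"
      using ml(1)[of i] ml(2) by (intro sum_ennreal) simp
    also have "(\<Sum>j\<in>?J. m i / l) = real (card ?J) * (m i / l)"
      by simp
    also have "real (card ?J) = \<bar>real a - real b\<bar>"
      by (auto simp: min_def max_def abs_if of_nat_diff)
    also have "ennreal (\<bar>real a - real b\<bar> * (m i / l)) \<le> ennreal (\<rho> * \<bar>real a - real b\<bar>)"
      using mult_right_mono[OF \<rho>[of i], of "\<bar>real a - real b\<bar>"] by (intro ennreal_leI) (simp add: mult.commute)
    finally show ?thesis .
  qed
  have \<rho>0: "0 \<le> \<rho>"
    using \<rho>[of 1] ml(1)[of 1] ml(2) by (meson divide_nonneg_nonneg less_imp_le order_trans)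
  have [measurable]: "(\<lambda>\<omega>. mnb_op (\<lambda>j. G i t j \<omega>) a) \<in> measurable M (count_space UNIV)" for i a
  proof -
    have "(\<lambda>\<omega>. \<Sum>j = 1..n. G i t j \<omega>) \<in> measurable M (count_space UNIV)" for n
    proof (induction n)
      case (Suc n)
      then show ?case using count_measurable[OF t, of "Suc n" i] by simp
    qed simp
    then show ?thesis unfolding mnb_op_def .
  qed
  have "(\<integral>\<^sup>+\<omega>. ennreal (pdist (thinned_at G t x \<omega>) (thinned_at G t y \<omega>)) \<partial>M) =
     (\<integral>\<^sup>+\<omega>. ennreal \<bar>real (mnb_op (\<lambda>j. G 1 t j \<omega>) (fst x)) - real (mnb_op (\<lambda>j. G 1 t j \<omega>) (fst y))\<bar> +
       ennreal \<bar>real (mnb_op (\<lambda>j. G 2 t j \<omega>) (snd x)) - real (mnb_op (\<lambda>j. G 2 t j \<omega>) (snd y))\<bar> \<partial>M)"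
    by (simp add: pdist_def thinned_at_def)
  also have "\<dots> = (\<integral>\<^sup>+\<omega>. ennreal \<bar>real (mnb_op (\<lambda>j. G 1 t j \<omega>) (fst x)) - real (mnb_op (\<lambda>j. G 1 t j \<omega>) (fst y))\<bar> \<partial>M) +
       (\<integral>\<^sup>+\<omega>. ennreal \<bar>real (mnb_op (\<lambda>j. G 2 t j \<omega>) (snd x)) - real (mnb_op (\<lambda>j. G 2 t j \<omega>) (snd y))\<bar> \<partial>M)"
    by (intro nn_integral_add) measurable
  also have "\<dots> \<le> ennreal (\<rho> * \<bar>real (fst x) - real (fst y)\<bar>) + ennreal (\<rho> * \<bar>real (snd x) - real (snd y)\<bar>)"
    by (intro add_mono comp)
  also have "\<dots> = ennreal (\<rho> * pdist x y)"
    using \<rho>0 by (simp add: pdist_def distrib_left)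
  finally show ?thesis .
qed

text \<open>The two chains are coupled by using the same counting variables and the same innovation.\<close>

lemma kernel_op_lipschitz:
  assumes ml: "\<And>i. m i > 0" "l > 0" and \<rho>: "\<And>i. m i / l \<le> \<rho>"
    and h: "\<And>x. 0 \<le> h x \<and> h x \<le> 1" and lip: "\<And>x y. \<bar>h x - h y\<bar> \<le> c * pdist x y"
  shows "\<bar>kernel_op (brc_kernel l m f\<^sub>Z) h x - kernel_op (brc_kernel l m f\<^sub>Z) h y\<bar> \<le> (\<rho> * c) * pdist x y"
proof -
  let ?T = "thinned_at G 1"
  have [measurable]: "?T x \<in> measurable M (count_space UNIV)" for x
    using count_vec_measurable[of 1 x] by (simp add: thinned_at_eq[abs_def])
  have mT: "(\<lambda>\<omega>. (?T x \<omega>, ?T y \<omega>)) \<in> measurable M (count_space UNIV)"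
    by (intro measurable_Pair_countable) measurable
  \<comment> \<open>\<open>q\<close> is the coupling: the joint law of the thinnings of
    \<open>x\<close> and \<open>y\<close> by the same counts. Its marginals are the two thinned
    laws, and \<open>?Q\<close> adds one independent innovation for both.\<close>
  obtain q where q: "measure_pmf q = distr M (count_space UNIV) (\<lambda>\<omega>. (?T x \<omega>, ?T y \<omega>))"
    using distr_count_space_pmf[OF mT] .
  have law: "measure_pmf (thinned_pmf l m x) = distr M (count_space UNIV) (?T x)" for x
    using ml by (intro thinned_law) auto
  have qx: "thinned_pmf l m x = map_pmf fst q"
    unfolding measure_pmf_inject[symmetric] map_pmf_rep_eq q law
    by (subst distr_distr) (simp_all add: comp_def mT[unfolded One_nat_def])
  have qy: "thinned_pmf l m y = map_pmf snd q"
    unfolding measure_pmf_inject[symmetric] map_pmf_rep_eq q law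
    by (subst distr_distr) (simp_all add: comp_def mT[unfolded One_nat_def])
  let ?Q = "pair_pmf q f\<^sub>Z"
  have int: "integrable (measure_pmf ?Q) (\<lambda>v. h (f v))" for f
    using h by (intro measure_pmf.integrable_const_bound[where B=1]) auto
  \<comment> \<open>Two points at distance 1 force the Lipschitz constant to be nonnegative.\<close>
  have c: "0 \<le> c"
    using lip[of "(0, 0)" "(1, 0)"] by (simp add: pdist_def) 
  have "kernel_op (brc_kernel l m f\<^sub>Z) h x - kernel_op (brc_kernel l m f\<^sub>Z) h y =
      (\<integral>v. h (fst (fst v) + snd v) - h (snd (fst v) + snd v) \<partial>measure_pmf ?Q)"
    using int by (simp add: kernel_op_def brc_kernel_def qx qy pair_map_pmf1 apfst_def map_prod_def case_prod_beta)
  also have "\<bar>\<dots>\<bar> \<le> (\<integral>v. \<bar>h (fst (fst v) + snd v) - h (snd (fst v) + snd v)\<bar> \<partial>measure_pmf ?Q)"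
    by (rule integral_abs_bound)
  finally have "ennreal \<bar>kernel_op (brc_kernel l m f\<^sub>Z) h x - kernel_op (brc_kernel l m f\<^sub>Z) h y\<bar> \<le>
      ennreal (\<integral>v. \<bar>h (fst (fst v) + snd v) - h (snd (fst v) + snd v)\<bar> \<partial>measure_pmf ?Q)"
    by (rule ennreal_leI)
  also have "\<dots> = (\<integral>\<^sup>+v. ennreal \<bar>h (fst (fst v) + snd v) - h (snd (fst v) + snd v)\<bar> \<partial>measure_pmf ?Q)"
    using int by (intro nn_integral_eq_integral[symmetric]) auto
  also have "\<dots> \<le> (\<integral>\<^sup>+v. ennreal (c * pdist (fst (fst v)) (snd (fst v))) \<partial>measure_pmf ?Q)"
    using lip by (intro nn_integral_mono ennreal_leI) (metis pdist_add)
  also have "\<dots> = (\<integral>\<^sup>+w. ennreal (c * pdist (fst w) (snd w)) \<partial>measure_pmf (map_pmf fst ?Q))"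
    by simp
  also have "\<dots> = ennreal c * (\<integral>\<^sup>+w. ennreal (pdist (fst w) (snd w)) \<partial>measure_pmf q)"
    using c by (simp add: map_fst_pair_pmf ennreal_mult' nn_integral_cmult)
  also have "(\<integral>\<^sup>+w. ennreal (pdist (fst w) (snd w)) \<partial>measure_pmf q) = (\<integral>\<^sup>+\<omega>. ennreal (pdist (?T x \<omega>) (?T y \<omega>)) \<partial>M)"
    unfolding q by (subst nn_integral_distr) (simp_all add: mT[unfolded One_nat_def])
  also have "ennreal c * \<dots> \<le> ennreal c * ennreal (\<rho> * pdist x y)"
    using ml \<rho> by (intro mult_left_mono nn_integral_pdist_thinned_at) auto
  also have "\<dots> = ennreal (\<rho> * c * pdist x y)"
    using c by (simp add: ennreal_mult'[symmetric] mult_ac)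
  finally show ?thesis
    using c \<rho>[of 1] ml(1)[of 1] ml(2) pdist_nonneg[of x y]
    by (subst (asm) ennreal_le_iff) (auto intro!: mult_nonneg_nonneg order_trans[OF _ \<rho>[of 1]])
qed

text \<open>The n-th iterate has Lipschitz constant \<rho>^n. The claim concerns the parameters
  only, but it is proved for a solution because the coupling is realised by the counts of a solution
  at time 1.\<close>

lemma forgetful_brc_kernel:
  assumes ml: "\<And>i. m i > 0 \<and> m i < l" and "l > 0"
  shows "forgetful_kernel (brc_kernel l m f\<^sub>Z)"
proof
  define \<rho> where "\<rho> = max (m 1 / l) (m 2 / l)"
  have \<rho>: "0 \<le> \<rho>" "\<rho> < 1" "m i / l \<le> \<rho>" for i
    using ml[of 1] ml[of 2] \<open>l > 0\<close> exhaust_2[of i] by (auto simp: \<rho>_def le_max_iff_disj)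
  let ?T = "kernel_op (brc_kernel l m f\<^sub>Z)"
  fix h :: "nat \<times> nat \<Rightarrow> real" and x y
  assume h: "\<And>z. 0 \<le> h z \<and> h z \<le> 1"
  have lip: "\<bar>(?T ^^ n) h x - (?T ^^ n) h y\<bar> \<le> \<rho> ^ n * pdist x y" for n x y
  proof (induction n arbitrary: x y)
    case 0
    show ?case
      using h[of x] h[of y] pdist_ge_1[of x y] by (cases "x = y") (auto simp: pdist_def abs_if)
  next
    case (Suc n)
    have "\<bar>?T ((?T ^^ n) h) x - ?T ((?T ^^ n) h) y\<bar> \<le> \<rho> * \<rho> ^ n * pdist x y"
    proof (rule kernel_op_lipschitz)
      show "0 < m i" for i using ml[of i] by simp
      show "0 < l" by fact
      show "m i / l \<le> \<rho>" for i by (rule \<rho>(3))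
      show "0 \<le> (?T ^^ n) h z \<and> (?T ^^ n) h z \<le> 1" for z by (rule kernel_op_bounds[OF h])
      show "\<bar>(?T ^^ n) h z - (?T ^^ n) h w\<bar> \<le> \<rho> ^ n * pdist z w" for z w by (rule Suc)
    qed
    then show ?case by simp
  qed
  have "(\<lambda>n. \<rho> ^ n * pdist x y) \<longlonglongrightarrow> 0 * pdist x y"
    using \<rho>(1,2) by (intro tendsto_intros LIMSEQ_realpow_zero)
  then have lim: "(\<lambda>n. \<rho> ^ n * pdist x y) \<longlonglongrightarrow> 0"
    by simp
  show "(\<lambda>n. (?T ^^ n) h x - (?T ^^ n) h y) \<longlonglongrightarrow> 0"
  proof (rule Lim_null_comparison[OF _ lim])
    show "\<forall>\<^sub>F n in sequentially. norm ((?T ^^ n) h x - (?T ^^ n) h y) \<le> \<rho> ^ n * pdist x y"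
      unfolding real_norm_def by (intro always_eventually allI lip)
  qed
qed

end

section \<open>Functions of independent coordinates\<close>

text \<open>A pointwise substitute for measurability with respect to the coordinates in
  \<open>K\<close>. Together with measurability on the full product it yields independence by
  splicing.\<close>

definition depends_on :: "'i set \<Rightarrow> (('i \<Rightarrow> 'a) \<Rightarrow> 'b) \<Rightarrow> bool" where
  "depends_on K Y \<longleftrightarrow> (\<forall>w w'. (\<forall>c\<in>K. w c = w' c) \<longrightarrow> Y w = Y w')"

lemma depends_onD: "depends_on K Y \<Longrightarrow> (\<And>c. c \<in> K \<Longrightarrow> w c = w' c) \<Longrightarrow> Y w = Y w'"
  by (auto simp: depends_on_def)

lemma depends_on_comp: "depends_on K Y \<Longrightarrow> depends_on K (\<lambda>w. f (Y w))"
  unfolding depends_on_def by metis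

lemma depends_on_mono: "depends_on K Y \<Longrightarrow> K \<subseteq> L \<Longrightarrow> depends_on L Y"
  by (auto simp: depends_on_def subset_iff)

definition splice :: "'i set \<Rightarrow> ('i \<Rightarrow> 'a) \<Rightarrow> ('i \<Rightarrow> 'a) \<Rightarrow> 'i \<Rightarrow> 'a" where
  "splice K w w' c = (if c \<in> K then w c else w' c)"

lemma depends_on_splice1: "depends_on K Y \<Longrightarrow> K \<subseteq> L \<Longrightarrow> Y (splice L w w') = Y w"
  by (erule depends_onD) (auto simp: splice_def)

lemma depends_on_splice2: "depends_on K Y \<Longrightarrow> K \<inter> L = {} \<Longrightarrow> Y (splice L w w') = Y w'"
  by (erule depends_onD) (auto simp: splice_def)

locale coordinate_space = product_prob_space M "UNIV :: 'i set" for M :: "'i \<Rightarrow> 'b measure"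
begin

lemma measurable_splice:
  "(\<lambda>(w, w'). splice K w w') \<in> measurable (PiM UNIV M \<Otimes>\<^sub>M PiM UNIV M) (PiM UNIV M)"
  unfolding splice_def case_prod_beta
proof (rule measurable_PiM_single')
  fix i
  show "(\<lambda>x. if i \<in> K then fst x i else snd x i) \<in> measurable (PiM UNIV M \<Otimes>\<^sub>M PiM UNIV M) (M i)"
    by (cases "i \<in> K") simp_all
qed (auto simp: space_pair_measure space_PiM PiE_iff)

text \<open>Replacing the coordinates outside \<open>K\<close> by those of an independent copy
  preserves the product law. On a finite box the preimage is a rectangle: the sides in
  \<open>K\<close> constrain the first point, the others the second.\<close>

lemma distr_splice:
  shows "distr (PiM UNIV M \<Otimes>\<^sub>M PiM UNIV M) (PiM UNIV M) (\<lambda>(w, w'). splice K w w') = PiM UNIV M"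
proof -
  have "distr (PiM UNIV M \<Otimes>\<^sub>M PiM UNIV M) (PiM UNIV M) (\<lambda>(w, w'). splice K w w') = PiM UNIV M"
  proof (rule PiM_eq)
    fix J F assume J: "finite J" "J \<subseteq> UNIV" and F: "\<And>j. j \<in> J \<Longrightarrow> F j \<in> sets (M j)"
    have emb: "prod_emb UNIV M L (Pi\<^sub>E L F) = {w \<in> space (PiM UNIV M). \<forall>c\<in>L. w c \<in> F c}" for L
      by (auto simp: prod_emb_def space_PiM PiE_iff)
    have "emeasure (distr (PiM UNIV M \<Otimes>\<^sub>M PiM UNIV M) (PiM UNIV M) (\<lambda>(w, w'). splice K w w')) (prod_emb UNIV M J (Pi\<^sub>E J F)) =
      emeasure (PiM UNIV M \<Otimes>\<^sub>M PiM UNIV M)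
        ((\<lambda>(w, w'). splice K w w') -` prod_emb UNIV M J (Pi\<^sub>E J F) \<inter> space (PiM UNIV M \<Otimes>\<^sub>M PiM UNIV M))"
      using J F by (subst emeasure_distr) (auto intro!: sets_PiM_I measurable_splice)
    also have "(\<lambda>(w, w'). splice K w w') -` prod_emb UNIV M J (Pi\<^sub>E J F) \<inter> space (PiM UNIV M \<Otimes>\<^sub>M PiM UNIV M) =
      prod_emb UNIV M (J \<inter> K) (Pi\<^sub>E (J \<inter> K) F) \<times> prod_emb UNIV M (J - K) (Pi\<^sub>E (J - K) F)"
      unfolding emb by (auto simp: space_pair_measure space_PiM splice_def PiE_iff split: if_splits)
    also have "emeasure (PiM UNIV M \<Otimes>\<^sub>M PiM UNIV M) \<dots> =
      emeasure (PiM UNIV M) (prod_emb UNIV M (J \<inter> K) (Pi\<^sub>E (J \<inter> K) F)) * emeasure (PiM UNIV M) (prod_emb UNIV M (J - K) (Pi\<^sub>E (J - K) F))"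
      using J F by (intro P.emeasure_pair_measure_Times sets_PiM_I) auto
    also have "\<dots> = (\<Prod>j\<in>J \<inter> K. emeasure (M j) (F j)) * (\<Prod>j\<in>J - K. emeasure (M j) (F j))"
      using J F by (subst (1 2) emeasure_PiM_emb) auto
    also have "\<dots> = (\<Prod>j\<in>J. emeasure (M j) (F j))"
      using J by (subst prod.union_disjoint[symmetric]) (auto intro!: prod.cong)
    finally show "emeasure (distr (PiM UNIV M \<Otimes>\<^sub>M PiM UNIV M) (PiM UNIV M) (\<lambda>(w, w'). splice K w w'))
      (prod_emb UNIV M J (Pi\<^sub>E J F)) = (\<Prod>j\<in>J. emeasure (M j) (F j))" .
  qed simp
  then show ?thesis by simp
qed

text \<open>Fubini for the coordinates inside and outside \<open>K\<close>. Splicing keeps both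
  points in the full product, which avoids separate product spaces over \<open>K\<close> and its
  complement.\<close>

lemma nn_integral_splice:
  assumes f: "f \<in> borel_measurable (PiM UNIV M)"
  shows "(\<integral>\<^sup>+w. f w \<partial>PiM UNIV M) = (\<integral>\<^sup>+w. \<integral>\<^sup>+w'. f (splice K w w') \<partial>PiM UNIV M \<partial>PiM UNIV M)"
proof -
  have "(\<integral>\<^sup>+w. f w \<partial>PiM UNIV M) = (\<integral>\<^sup>+w. f w \<partial>distr (PiM UNIV M \<Otimes>\<^sub>M PiM UNIV M) (PiM UNIV M) (\<lambda>(w, w'). splice K w w'))"
    by (simp add: distr_splice)
  also have "\<dots> = (\<integral>\<^sup>+z. f (splice K (fst z) (snd z)) \<partial>(PiM UNIV M \<Otimes>\<^sub>M PiM UNIV M))"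
    using f measurable_splice[of K] by (subst nn_integral_distr) (auto simp: case_prod_beta)
  also have "\<dots> = (\<integral>\<^sup>+w. \<integral>\<^sup>+w'. f (splice K w w') \<partial>PiM UNIV M \<partial>PiM UNIV M)"
    using measurable_compose[OF measurable_splice[of K] f]
    by (subst P.nn_integral_fst[symmetric]) (auto simp: case_prod_beta)
  finally show ?thesis .
qed

text \<open>After splicing along \<open>K\<close> the first indicator depends on \<open>w\<close>
  alone and the second on \<open>w'\<close> alone, so the double integral factors.\<close>

lemma indep_coordinates:
  assumes K: "K \<inter> L = {}"
    and D: "D \<in> sets (PiM UNIV M)" "depends_on K (\<lambda>w. w \<in> D)"
    and E: "E \<in> sets (PiM UNIV M)" "depends_on L (\<lambda>w. w \<in> E)"
  shows "measure (PiM UNIV M) (D \<inter> E) = measure (PiM UNIV M) D * measure (PiM UNIV M) E"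
proof -
  have "emeasure (PiM UNIV M) (D \<inter> E) = (\<integral>\<^sup>+w. indicator D w * indicator E w \<partial>PiM UNIV M)"
    using D E by (simp add: nn_integral_indicator[symmetric] indicator_inter_arith)
  also have "\<dots> = (\<integral>\<^sup>+w. \<integral>\<^sup>+w'. indicator D (splice K w w') * indicator E (splice K w w') \<partial>PiM UNIV M \<partial>PiM UNIV M)"
    using D E by (intro nn_integral_splice) auto
  also have "\<dots> = (\<integral>\<^sup>+w. \<integral>\<^sup>+w'. indicator D w * indicator E w' \<partial>PiM UNIV M \<partial>PiM UNIV M)"
    using depends_on_splice1[OF D(2) order_refl] depends_on_splice2[OF E(2), of K] K
    by (intro nn_integral_cong) (auto simp: indicator_def Int_commute)
  also have "\<dots> = emeasure (PiM UNIV M) D * emeasure (PiM UNIV M) E"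
    using D E by (simp add: nn_integral_cmult nn_integral_multc)
  finally show ?thesis
    by (simp add: P.emeasure_eq_measure flip: ennreal_mult')
qed

end

text \<open>The coordinates will be indexed by components and times, but the process has to live on a space
  of sequences. Therefore independence is transferred to any space \<open>M\<close> with a copy \<open>r\<close> of the
  coordinates.\<close>

locale coordinate_copy = N: coordinate_space N + prob_space M
  for N :: "'i \<Rightarrow> 'b measure" and M :: "'a measure" +
  fixes r :: "'a \<Rightarrow> 'i \<Rightarrow> 'b"
  assumes space_N: "\<And>i. space (N i) = UNIV"
    and r: "r \<in> measurable M (PiM UNIV N)" and distr_r: "distr M (PiM UNIV N) r = PiM UNIV N"
begin

lemma space_PiM_UNIV: "space (PiM UNIV N) = UNIV"
  by (simp add: space_PiM space_N)

lemma prob_r: "E \<in> sets (PiM UNIV N) \<Longrightarrow> prob (r -` E \<inter> space M) = measure (PiM UNIV N) E"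
  using measure_distr[OF r, of E] by (simp add: distr_r)

lemma indep_pair_r:
  assumes Y1: "Y1 \<in> measurable (PiM UNIV N) S" "depends_on K Y1"
    and Y2: "Y2 \<in> measurable (PiM UNIV N) T" "depends_on L Y2"
    and KL: "K \<inter> L = {}"
  shows "indep_pair S (\<lambda>\<omega>. Y1 (r \<omega>)) T (\<lambda>\<omega>. Y2 (r \<omega>))"
  unfolding indep_pair_def
proof (intro conjI indep_setI)
  show m1: "(\<lambda>\<omega>. Y1 (r \<omega>)) \<in> measurable M S" and m2: "(\<lambda>\<omega>. Y2 (r \<omega>)) \<in> measurable M T"
    using measurable_compose[OF r] Y1 Y2 by auto
  show "{(\<lambda>\<omega>. Y1 (r \<omega>)) -` A \<inter> space M |A. A \<in> sets S} \<subseteq> events"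
    "{(\<lambda>\<omega>. Y2 (r \<omega>)) -` A \<inter> space M |A. A \<in> sets T} \<subseteq> events"
    using m1 m2 by (auto intro: measurable_sets)
  fix a b assume "a \<in> {(\<lambda>\<omega>. Y1 (r \<omega>)) -` A \<inter> space M |A. A \<in> sets S}"
    "b \<in> {(\<lambda>\<omega>. Y2 (r \<omega>)) -` A \<inter> space M |A. A \<in> sets T}"
  then obtain A B where A: "A \<in> sets S" "a = (\<lambda>\<omega>. Y1 (r \<omega>)) -` A \<inter> space M"
    and B: "B \<in> sets T" "b = (\<lambda>\<omega>. Y2 (r \<omega>)) -` B \<inter> space M"
    by auto
  have sA: "Y1 -` A \<in> sets (PiM UNIV N)" and sB: "Y2 -` B \<in> sets (PiM UNIV N)"
    using measurable_sets[OF Y1(1) A(1)] measurable_sets[OF Y2(1) B(1)] by (simp_all add: space_PiM_UNIV)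
  have "measure (PiM UNIV N) (Y1 -` A \<inter> Y2 -` B) = measure (PiM UNIV N) (Y1 -` A) * measure (PiM UNIV N) (Y2 -` B)"
    using depends_on_comp[OF Y1(2)] depends_on_comp[OF Y2(2)] sA sB by (intro N.indep_coordinates[OF KL]) auto
  moreover have "a \<inter> b = r -` (Y1 -` A \<inter> Y2 -` B) \<inter> space M" "a = r -` (Y1 -` A) \<inter> space M"
    "b = r -` (Y2 -` B) \<inter> space M"
    by (auto simp: A B)
  ultimately show "prob (a \<inter> b) = prob a * prob b"
    using sA sB by (simp only: prob_r sets.Int)
qed

text \<open>Induction on the finite index set: the intersection of the events treated so far depends
  on the union of their blocks, which is disjoint from the block of the new event.\<close>

lemma indep_vars_r:
  assumes Y: "\<And>t. t \<in> T \<Longrightarrow> Y t \<in> measurable (PiM UNIV N) (S t)"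
    and dep: "\<And>t. t \<in> T \<Longrightarrow> depends_on (K t) (Y t)"
    and disj: "disjoint_family_on K T"
  shows "indep_vars S (\<lambda>t \<omega>. Y t (r \<omega>)) T"
  unfolding indep_vars_def2
proof (intro conjI ballI indep_setsI)
  show "(\<lambda>\<omega>. Y t (r \<omega>)) \<in> measurable M (S t)" if "t \<in> T" for t
    using measurable_compose[OF r Y[OF that]] .
  then show "{(\<lambda>\<omega>. Y t (r \<omega>)) -` A \<inter> space M |A. A \<in> sets (S t)} \<subseteq> events" if "t \<in> T" for t
    using that by (auto intro: measurable_sets)
  fix A J assume J: "J \<noteq> {}" "J \<subseteq> T" "finite J"
    and A: "\<forall>t\<in>J. A t \<in> {(\<lambda>\<omega>. Y t (r \<omega>)) -` A \<inter> space M |A. A \<in> sets (S t)}"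
  from A obtain B where B: "\<And>t. t \<in> J \<Longrightarrow> B t \<in> sets (S t)"
      "\<And>t. t \<in> J \<Longrightarrow> A t = (\<lambda>\<omega>. Y t (r \<omega>)) -` B t \<inter> space M"
    by (simp, metis)
  define D where "D t = Y t -` B t \<inter> space (PiM UNIV N)" for t
  have D: "D t \<in> sets (PiM UNIV N)" if "t \<in> J" for t
    unfolding D_def using that J B Y by (intro measurable_sets) auto
  have AD: "A t = r -` D t \<inter> space M" if "t \<in> J" for t
    using B(2)[OF that] measurable_space[OF r] by (auto simp: D_def)
  have DI: "(\<Inter>t\<in>L. D t) \<in> sets (PiM UNIV N)" if "L \<subseteq> J" "L \<noteq> {}" for L
    using that J D by (intro sets.finite_INT) (auto intro: finite_subset)
  have prod: "measure (PiM UNIV N) (\<Inter>t\<in>L. D t) = (\<Prod>t\<in>L. measure (PiM UNIV N) (D t))"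
    if "finite L" "L \<noteq> {}" "L \<subseteq> J" for L
    using that
  proof (induction L rule: finite_ne_induct)
    case (insert t L)
    have dep_D: "depends_on (K s) (\<lambda>w. w \<in> D s)" if "s \<in> J" for s
      using depends_on_comp[OF dep[of s], of "\<lambda>y. y \<in> B s"] that J(2) by (auto simp: D_def space_PiM_UNIV)
    have "measure (PiM UNIV N) (D t \<inter> (\<Inter>s\<in>L. D s)) =
        measure (PiM UNIV N) (D t) * measure (PiM UNIV N) (\<Inter>s\<in>L. D s)"
    proof (rule N.indep_coordinates)
      have "K t \<inter> K s = {}" if "s \<in> L" for s
        using that insert J(2) disj by (intro disjoint_family_onD[OF disj]) auto
      then show "K t \<inter> (\<Union>s\<in>L. K s) = {}" by auto
      show "depends_on (\<Union>s\<in>L. K s) (\<lambda>w. w \<in> (\<Inter>s\<in>L. D s))"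
        unfolding depends_on_def
      proof (intro allI impI)
        fix w w' :: "'i \<Rightarrow> 'b"
        assume eq: "\<forall>c\<in>(\<Union>s\<in>L. K s). w c = w' c"
        have "w \<in> D s \<longleftrightarrow> w' \<in> D s" if "s \<in> L" for s
          by (rule depends_onD[OF dep_D]) (use that eq insert.prems in auto)
        then show "w \<in> (\<Inter>s\<in>L. D s) \<longleftrightarrow> w' \<in> (\<Inter>s\<in>L. D s)"
          by auto
      qed
    qed (use insert D DI dep_D in auto)
    then show ?case using insert by simp
  qed simp
  show "prob (\<Inter>t\<in>J. A t) = (\<Prod>t\<in>J. prob (A t))"
  proof -
    have "(\<Inter>t\<in>J. A t) = r -` (\<Inter>t\<in>J. D t) \<inter> space M"
      using J AD by auto
    then show ?thesis
      using prod[OF \<open>finite J\<close> \<open>J \<noteq> {}\<close> order_refl] prob_r DI[OF order_refl \<open>J \<noteq> {}\<close>] D AD by simp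
  qed
qed

end

section \<open>Construction of the process\<close>

text \<open>The quantile transform for the geometric distribution with mean \<open>a\<close>: the tail probabilities
  are the powers of \<open>a / (1 + a)\<close>.\<close>

definition geom_quantile :: "real \<Rightarrow> real \<Rightarrow> nat" where
  "geom_quantile a u = (LEAST k. (a / (1 + a)) ^ Suc k \<le> u)"

lemma borel_measurable_geom_quantile [measurable (raw)]:
  assumes [measurable]: "f \<in> borel_measurable M" "g \<in> borel_measurable M"
  shows "(\<lambda>x. geom_quantile (f x) (g x)) \<in> measurable M (count_space UNIV)"
  unfolding geom_quantile_def by measurable

text \<open>With q = a / (1 + a) the powers of q decrease from 1 to 0, so the intervals from q^(k+1)
  to q^k, closed on the left, partition (0, 1). Convergence to 0 makes the set under
  \<open>LEAST\<close> nonempty.\<close>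

lemma geom_quantile_eq_iff:
  assumes a: "a > 0" and u: "0 < u" "u < 1"
  shows "geom_quantile a u = k \<longleftrightarrow> (a / (1 + a)) ^ Suc k \<le> u \<and> u < (a / (1 + a)) ^ k"
proof -
  define q where "q = a / (1 + a)"
  have q: "0 < q" "q < 1" using a by (auto simp: q_def)
  have anti: "q ^ j \<le> q ^ i" if "i \<le> j" for i j
    using q that by (intro power_decreasing) auto
  obtain n where n: "q ^ n < u"
    using real_arch_pow_inv[OF u(1) q(2)] by auto
  then have n': "q ^ Suc n \<le> u"
    using anti[of n "Suc n"] by simp
  have L: "q ^ Suc (geom_quantile a u) \<le> u"
    using LeastI[of "\<lambda>k. q ^ Suc k \<le> u", OF n'] by (simp add: geom_quantile_def q_def)
  have L': "geom_quantile a u \<le> k" if "q ^ Suc k \<le> u" for k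
    using Least_le[of "\<lambda>k. q ^ Suc k \<le> u", OF that] by (simp add: geom_quantile_def q_def)
  have U: "u < q ^ geom_quantile a u"
  proof (cases "geom_quantile a u")
    case 0 then show ?thesis using u by simp
  next
    case (Suc j)
    then show ?thesis using L'[of j] by (auto simp: not_le[symmetric])
  qed
  show ?thesis
    unfolding q_def[symmetric]
  proof
    assume "q ^ Suc k \<le> u \<and> u < q ^ k"
    then have "geom_quantile a u \<le> k" "\<not> Suc (geom_quantile a u) \<le> k"
      using L' L anti[of "Suc (geom_quantile a u)" k] by auto
    then show "geom_quantile a u = k" by simp
  qed (use L U in auto)
qed

lemma emeasure_geom_quantile:
  assumes a: "a > 0"
  shows "emeasure (uniform_measure lborel {0<..<1}) {u. geom_quantile a u = k} = ennreal (mnb_count_pmf a k)"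
proof -
  define q where "q = a / (1 + a)"
  have q: "0 < q" "q < 1" using a by (auto simp: q_def)
  have qk: "q ^ Suc k \<le> q ^ k" "q ^ k \<le> 1" "0 < q ^ Suc k"
    using q by (auto intro: power_decreasing power_le_one simp: mult_le_cancel_right1)
  have [measurable]: "{u. geom_quantile a u = k} \<in> sets borel"
    by measurable
  have "{0<..<1} \<inter> {u. geom_quantile a u = k} = {q ^ Suc k..<q ^ k}"
  proof (rule set_eqI)
    fix u
    show "u \<in> {0<..<1} \<inter> {u. geom_quantile a u = k} \<longleftrightarrow> u \<in> {q ^ Suc k..<q ^ k}"
    proof (cases "0 < u \<and> u < 1")
      case True
      then show ?thesis
        using geom_quantile_eq_iff[OF a, of u k] by (simp add: q_def)
    next
      case False
      then show ?thesis using qk by auto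
    qed
  qed
  then have "emeasure (uniform_measure lborel {0<..<1}) {u. geom_quantile a u = k} = ennreal (q ^ k - q ^ Suc k)"
    using qk divide_ennreal[of "q ^ k - q ^ Suc k" 1] by (subst emeasure_uniform_measure) auto
  also have "q ^ k - q ^ Suc k = q ^ k * (1 - q)"
    by (simp add: algebra_simps)
  also have "1 - q = 1 / (1 + a)"
    using a by (simp add: q_def field_simps)
  also have "q ^ k * (1 / (1 + a)) = mnb_count_pmf a k"
    by (simp add: q_def mnb_count_pmf_def power_divide mult.commute)
  finally show ?thesis .
qed

lemma mnb_op_mono: "a \<le> b \<Longrightarrow> mnb_op g a \<le> mnb_op g b"
  unfolding mnb_op_def by (intro sum_mono2) auto

text \<open>A coordinate \<open>(k, i, t, j)\<close> serves component \<open>i\<close> and time \<open>t\<close>. It is a coefficient if \<open>k = 0\<close>, the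
  uniform variable behind the \<open>j\<close>-th counting variable if \<open>k = 1\<close>, and an innovation otherwise.
  Time runs through the integers, so that the state at each time is a function of the infinite past.\<close>

type_synonym noise_index = "nat \<times> 2 \<times> int \<times> nat"

abbreviation noise_time :: "noise_index \<Rightarrow> int" where
  "noise_time c \<equiv> fst (snd (snd c))"

text \<open>All coordinates are real, so that one product measure carries the whole noise. An
  innovation pair is therefore stored as its number under \<open>to_nat\<close>, which
  \<open>innov_at\<close> decodes.\<close>

definition noise_law :: "real \<Rightarrow> (2 \<Rightarrow> real) \<Rightarrow> (nat \<times> nat) pmf \<Rightarrow> noise_index \<Rightarrow> real measure" where
  "noise_law l m f\<^sub>Z c =
     (if fst c = 0 then beta_prime (m (fst (snd c))) l
      else if fst c = 1 then uniform_measure lborel {0<..<1}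
      else distr (measure_pmf f\<^sub>Z) borel (\<lambda>z. real (to_nat z)))"

definition coeff_at :: "2 \<Rightarrow> int \<Rightarrow> (noise_index \<Rightarrow> real) \<Rightarrow> real" where
  "coeff_at i t w = w (0, i, t, 0)"

text \<open>The counts of one component at one time share the coefficient coordinate but have
  separate uniform coordinates. This produces exactly conditional independence given the
  coefficients.\<close>

definition count_at :: "2 \<Rightarrow> int \<Rightarrow> nat \<Rightarrow> (noise_index \<Rightarrow> real) \<Rightarrow> nat" where
  "count_at i t j w = geom_quantile (coeff_at i t w) (w (1, i, t, j))"

definition innov_at :: "int \<Rightarrow> (noise_index \<Rightarrow> real) \<Rightarrow> nat \<times> nat" where
  "innov_at t w = from_nat (nat \<lfloor>w (2, 1, t, 0)\<rfloor>)"

definition thin_at :: "int \<Rightarrow> (noise_index \<Rightarrow> real) \<Rightarrow> nat \<times> nat \<Rightarrow> nat \<times> nat" where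
  "thin_at t w x = (mnb_op (\<lambda>j. count_at 1 t j w) (fst x), mnb_op (\<lambda>j. count_at 2 t j w) (snd x))"

text \<open>The state at time \<open>t\<close> of the process started in 0 at time \<open>t - n\<close>. It is increasing in \<open>n\<close>.\<close>

fun started :: "nat \<Rightarrow> int \<Rightarrow> (noise_index \<Rightarrow> real) \<Rightarrow> nat \<times> nat" where
  "started 0 t w = 0"
| "started (Suc n) t w = thin_at t w (started n (t - 1) w) + innov_at t w"

definition settled :: "int \<Rightarrow> (noise_index \<Rightarrow> real) \<Rightarrow> nat \<Rightarrow> bool" where
  "settled t w n \<longleftrightarrow> (\<forall>k\<ge>n. started k t w = started n t w)"

text \<open>Where the sequence never settles, \<open>LEAST\<close> yields an unspecified number. The
  state is still defined there, and measurability and the shift identity hold without exceptional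
  points.\<close>

definition state_at :: "int \<Rightarrow> (noise_index \<Rightarrow> real) \<Rightarrow> nat \<times> nat" where
  "state_at t w = started (LEAST n. settled t w n) t w"

definition driver_at :: "int \<Rightarrow> (noise_index \<Rightarrow> real) \<Rightarrow> (real \<times> real) \<times> (2 \<times> nat \<Rightarrow> nat) \<times> (nat \<times> nat)" where
  "driver_at t w = ((coeff_at 1 t w, coeff_at 2 t w), (\<lambda>(i, j)\<in>UNIV \<times> {1..}. count_at i t j w), innov_at t w)"

lemma state_at_eq: "settled t w n \<Longrightarrow> n \<le> k \<Longrightarrow> state_at t w = started k t w"
proof -
  assume n: "settled t w n" "n \<le> k"
  have "settled t w (LEAST n. settled t w n)"
    by (rule LeastI[where P="settled t w", OF n(1)])
  moreover have "(LEAST n. settled t w n) \<le> k"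
    using Least_le[where P="settled t w", OF n(1)] n(2) by (rule order_trans)
  ultimately have "started k t w = started (LEAST n. settled t w n) t w"
    unfolding settled_def[of t w "LEAST n. settled t w n"] by blast
  then show ?thesis by (simp add: state_at_def)
qed

text \<open>If time \<open>t - 1\<close> has settled after \<open>n\<close> steps, one application
  of the recursion shows that time \<open>t\<close> has settled after \<open>Suc n\<close>.\<close>

lemma state_at_recursion:
  assumes "settled (t - 1) w n"
  shows "state_at t w = thin_at t w (state_at (t - 1) w) + innov_at t w"
proof -
  have eq: "started (Suc k) t w = thin_at t w (state_at (t - 1) w) + innov_at t w" if "n \<le> k" for k
    using state_at_eq[OF assms that] by simp
  have "settled t w (Suc n)"
    unfolding settled_def
  proof (intro allI impI)
    fix k assume "Suc n \<le> k"
    then obtain k' where k': "k = Suc k'" "n \<le> k'" by (cases k) auto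
    show "started k t w = started (Suc n) t w"
      unfolding k'(1) eq[OF k'(2)] eq[OF order_refl] ..
  qed
  then have "state_at t w = started (Suc n) t w"
    by (rule state_at_eq) simp
  then show ?thesis
    using eq[of n] by simp
qed

text \<open>Starting one step earlier replaces the initial 0 by a state that is at least 0. Thinning
  is monotone in the state for fixed noise, so the order persists up to time
  \<open>t\<close>.\<close>

lemma started_mono: "coord i (started n t w) \<le> coord i (started (Suc n) t w)"
proof -
  have "fst (started n t w) \<le> fst (started (Suc n) t w) \<and> snd (started n t w) \<le> snd (started (Suc n) t w)"
  proof (induction n arbitrary: t)
    case (Suc n)
    show ?case
      using Suc[of "t - 1"] unfolding started.simps(2)[of n t] started.simps(2)[of "Suc n" t]
      by (auto simp: thin_at_def intro!: mnb_op_mono simp del: started.simps)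
  qed simp
  then show ?thesis by (simp add: coord_def)
qed

lemma settledI:
  assumes bdd: "\<And>i n. coord i (started n t w) \<le> b i"
  shows "\<exists>n. settled t w n"
proof -
  have inc: "incseq (\<lambda>n. coord i (started n t w))" for i
    by (intro incseq_SucI started_mono)
  have "\<exists>n. \<forall>k\<ge>n. coord i (started k t w) = coord i (started n t w)" for i
  proof -
    let ?R = "range (\<lambda>n. coord i (started n t w))"
    have fin: "finite ?R"
      using bdd by (intro finite_subset[of ?R "{..b i}"]) auto
    then have "Max ?R \<in> ?R" by (intro Max_in) auto
    then obtain n where n: "Max ?R = coord i (started n t w)" by auto
    have "coord i (started k t w) = coord i (started n t w)" if "k \<ge> n" for k
      using incseqD[OF inc that, of i] Max_ge[OF fin, of "coord i (started k t w)"] n by simp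
    then show ?thesis by blast
  qed
  then obtain n where n: "\<And>i k. k \<ge> n i \<Longrightarrow> coord i (started k t w) = coord i (started (n i) t w)"
    by metis
  have "settled t w (max (n 1) (n 2))"
    unfolding settled_def prod_eq_coord_iff forall_2
    using n[of 1] n[of 2] by (metis max.bounded_iff max.cobounded1 max.cobounded2)
  then show ?thesis ..
qed

definition shift :: "int \<Rightarrow> noise_index \<Rightarrow> noise_index" where
  "shift h = (\<lambda>(k, i, t, j). (k, i, t + h, j))"

lemma started_shift: "started n t (\<lambda>c. w (shift h c)) = started n (t + h) w"
proof (induction n arbitrary: t)
  case (Suc n)
  have "t - 1 + h = t + h - 1" by simp
  then show ?case
    using Suc[of "t - 1", unfolded \<open>t - 1 + h = t + h - 1\<close>] by (simp add: thin_at_def innov_at_def count_at_def coeff_at_def shift_def)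
qed simp

lemma state_at_shift: "state_at t (\<lambda>c. w (shift h c)) = state_at (t + h) w"
  by (simp add: state_at_def settled_def started_shift)

lemma depends_on_coeff_at: "depends_on {(0, i, t, 0)} (coeff_at i t)"
  by (auto simp: depends_on_def coeff_at_def)

lemma depends_on_count_at: "depends_on {(0, i, t, 0), (1, i, t, j)} (count_at i t j)"
  by (auto simp: depends_on_def count_at_def coeff_at_def)

lemma depends_on_innov_at: "depends_on {(2, 1, t, 0)} (innov_at t)"
  by (auto simp: depends_on_def innov_at_def)

text \<open>The condition \<open>fst c < 2\<close> leaves out the innovation coordinates of time
  \<open>t\<close>; it later separates the innovation from the thinned vector.\<close>

lemma depends_on_thin_at: "depends_on {c. noise_time c = t \<and> fst c < 2} (\<lambda>w. thin_at t w x)"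
  by (simp add: depends_on_def thin_at_def count_at_def coeff_at_def)

lemma depends_on_started: "depends_on {c. noise_time c \<le> t} (started n t)"
proof (induction n arbitrary: t)
  case 0
  then show ?case by (simp add: depends_on_def)
next
  case (Suc n)
  have "started (Suc n) t w = started (Suc n) t w'" if eq: "\<And>c. noise_time c \<le> t \<Longrightarrow> w c = w' c" for w w'
  proof -
    have "started n (t - 1) w = started n (t - 1) w'"
      by (rule depends_onD[OF Suc[of "t - 1"]]) (use eq in auto)
    moreover have "thin_at t w x = thin_at t w' x" for x
      by (rule depends_onD[OF depends_on_thin_at]) (use eq in auto)
    moreover have "innov_at t w = innov_at t w'"
      by (rule depends_onD[OF depends_on_innov_at]) (use eq in auto)
    ultimately show ?thesis by simp
  qed
  then show ?case
    unfolding depends_on_def by blast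
qed

lemma depends_on_state_at: "depends_on {c. noise_time c \<le> t} (state_at t)"
proof -
  have "state_at t w = state_at t w'" if eq: "\<forall>c\<in>{c. noise_time c \<le> t}. w c = w' c" for w w'
  proof -
    have "started n t w = started n t w'" for n
      using depends_onD[OF depends_on_started] eq by blast
    then show ?thesis by (simp add: state_at_def settled_def)
  qed
  then show ?thesis unfolding depends_on_def by blast
qed

lemma depends_on_driver_at: "depends_on {c. noise_time c = t} (driver_at t)"
  by (auto simp: depends_on_def driver_at_def coeff_at_def count_at_def innov_at_def restrict_def fun_eq_iff)

lemma coord_add: "coord i (x + y :: nat \<times> nat) = coord i x + coord i y"
  by (simp add: coord_def)

lemma coord_thin_at: "coord i (thin_at t w x) = mnb_op (\<lambda>j. count_at i t j w) (coord i x)"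
  using exhaust_2[of i] by (auto simp: thin_at_def)

section \<open>The noise measure and the limit state\<close>

locale brc_noise =
  fixes l :: real and m :: "2 \<Rightarrow> real" and f\<^sub>Z :: "(nat \<times> nat) pmf"
  assumes l_pos: "l > 0" and m_pos: "\<And>i. m i > 0" and m_less: "\<And>i. m i < l"
    and innov_integrable: "\<And>i. integrable (measure_pmf f\<^sub>Z) (\<lambda>z. real (coord i z))"
begin

abbreviation noise :: "noise_index \<Rightarrow> real measure" where
  "noise \<equiv> noise_law l m f\<^sub>Z"

abbreviation P :: "(noise_index \<Rightarrow> real) measure" where
  "P \<equiv> PiM UNIV noise"

lemma sets_noise [simp, measurable_cong]: "sets (noise c) = sets borel"
  by (simp add: noise_law_def)

lemma space_noise [simp]: "space (noise c) = UNIV"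
  using sets_eq_imp_space_eq[OF sets_noise] by simp

lemma space_P [simp]: "space P = UNIV"
  by (simp add: space_PiM)

lemma prob_space_noise: "prob_space (noise c)"
  unfolding noise_law_def
  using m_pos l_pos
  by (auto intro!: prob_space_beta_prime prob_space_uniform_measure measure_pmf.prob_space_distr)

sublocale N: coordinate_space noise
  unfolding coordinate_space_def by (intro product_prob_spaceI prob_space_noise)

lemma measurable_noise_component [measurable]: "(\<lambda>w. w c) \<in> borel_measurable P"
  using measurable_component_singleton[of c UNIV noise] by simp

lemma measurable_coeff_at [measurable]: "coeff_at i t \<in> borel_measurable P"
  unfolding coeff_at_def[abs_def] by measurable

lemma measurable_count_at [measurable]: "count_at i t j \<in> measurable P (count_space UNIV)"
  unfolding count_at_def[abs_def] by measurable

lemma measurable_innov_at [measurable]: "innov_at t \<in> measurable P (count_space UNIV)"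
  unfolding innov_at_def[abs_def] by measurable

lemma measurable_mnb_op_count_at [measurable]:
  "(\<lambda>w. mnb_op (\<lambda>j. count_at i t j w) n) \<in> measurable P (count_space UNIV)"
  unfolding mnb_op_def by measurable

lemma measurable_thin_at [measurable]: "(\<lambda>w. thin_at t w x) \<in> measurable P (count_space UNIV)"
  unfolding thin_at_def by (intro measurable_Pair_countable) measurable

lemma measurable_add_countable:
  fixes f g :: "'c \<Rightarrow> nat \<times> nat"
  assumes "f \<in> measurable M (count_space UNIV)" "g \<in> measurable M (count_space UNIV)"
  shows "(\<lambda>w. f w + g w) \<in> measurable M (count_space UNIV)"
  using measurable_compose[OF measurable_Pair_countable[OF assms], of "\<lambda>(x, y). x + y" "count_space UNIV"]
  by simp

lemma measurable_thin_at' [measurable (raw)]: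
  assumes "g \<in> measurable P (count_space UNIV)"
  shows "(\<lambda>w. thin_at t w (g w)) \<in> measurable P (count_space UNIV)"
  by (rule measurable_compose_countable[where f="\<lambda>x w. thin_at t w x", OF measurable_thin_at assms])

lemma measurable_started [measurable]: "started n t \<in> measurable P (count_space UNIV)"
proof (induction n arbitrary: t)
  case (Suc n)
  then show ?case
    by (simp add: measurable_add_countable measurable_thin_at')
next
  case 0
  have "started 0 t = (\<lambda>_. 0)" for t
    by (simp add: fun_eq_iff)
  then show ?case by simp
qed

lemma measurable_settled [measurable]: "Measurable.pred P (\<lambda>w. settled t w n)"
  unfolding settled_def by measurable

lemma measurable_state_at [measurable]: "state_at t \<in> measurable P (count_space UNIV)"
proof -
  have "(\<lambda>w. LEAST n. settled t w n) \<in> measurable P (count_space UNIV)"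
    by measurable
  then show ?thesis
    unfolding state_at_def[abs_def]
    by (rule measurable_compose_countable[where f="\<lambda>n w. started n t w", OF measurable_started])
qed

lemma measurable_driver_at [measurable]: "driver_at t \<in> measurable P driver_space"
proof -
  have "(\<lambda>w. \<lambda>(i, j)\<in>UNIV \<times> {1..}. count_at i t j w) \<in> measurable P (\<Pi>\<^sub>M p\<in>UNIV \<times> {1..}. count_space UNIV)"
    by (intro measurable_restrict) auto
  then show ?thesis
    unfolding driver_at_def[abs_def] by (intro measurable_Pair) (auto simp: case_prod_beta)
qed

lemma distr_noise_component: "distr P borel (\<lambda>w. w c) = noise c"
proof -
  have "distr P borel (\<lambda>w. w c) = distr P (noise c) (\<lambda>w. w c)"
    by (rule distr_cong) simp_all
  then show ?thesis
    by (simp add: N.PiM_component)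
qed

lemma distr_coeff_at: "distr P lborel (coeff_at i t) = beta_prime (m i) l"
proof -
  have "distr P lborel (coeff_at i t) = distr P borel (\<lambda>w. w (0, i, t, 0))"
    by (rule distr_cong) (simp_all add: coeff_at_def)
  then show ?thesis
    by (simp add: distr_noise_component noise_law_def)
qed

lemma distr_innov_at: "distr P (count_space UNIV) (innov_at t) = measure_pmf f\<^sub>Z"
proof -
  let ?c = "(2, 1, t, 0) :: noise_index"
  have "distr P (count_space UNIV) (innov_at t) =
      distr (distr P borel (\<lambda>w. w ?c)) (count_space UNIV) (\<lambda>u. from_nat (nat \<lfloor>u\<rfloor>))"
    by (subst distr_distr) (auto simp: comp_def innov_at_def[abs_def])
  also have "distr P borel (\<lambda>w. w ?c) = distr (measure_pmf f\<^sub>Z) borel (\<lambda>z. real (to_nat z))"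
    by (simp add: distr_noise_component noise_law_def)
  also have "distr \<dots> (count_space UNIV) (\<lambda>u. from_nat (nat \<lfloor>u\<rfloor>)) = distr (measure_pmf f\<^sub>Z) (count_space UNIV) (\<lambda>z. z)"
    by (subst distr_distr) (auto simp: comp_def)
  also have "\<dots> = measure_pmf f\<^sub>Z"
    by (simp add: distr_id2)
  finally show ?thesis .
qed

lemma AE_coeff_at_pos: "AE w in P. \<forall>i t. coeff_at i t w > 0"
proof -
  have "AE w in P. coeff_at i t w > 0" for i t
    using AE_beta_prime_pos[of "m i" l] unfolding distr_coeff_at[of i t, symmetric]
    by (subst (asm) AE_distr_iff) auto
  then show ?thesis
    by (simp add: AE_all_countable)
qed

lemma emeasure_P_cylinder:
  assumes "finite L" "\<And>c. c \<in> L \<Longrightarrow> B c \<in> sets borel"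
  shows "emeasure P {w. \<forall>c\<in>L. w c \<in> B c} = (\<Prod>c\<in>L. emeasure (noise c) (B c))"
proof -
  have "{w. \<forall>c\<in>L. w c \<in> B c} = prod_emb UNIV noise L (Pi\<^sub>E L B)"
    by (auto simp: prod_emb_def PiE_iff)
  then show ?thesis
    using assms by (simp add: N.emeasure_PiM_emb)
qed

text \<open>Keep the coefficients and resample all other coordinates. This does not affect
  \<open>D\<close>, and for given coefficients the counts are quantile transforms of independent
  uniforms. With \<open>D\<close> ranging over coefficient events, this is the defining identity of
  the conditional law.\<close>

lemma counting_at:
  assumes J: "finite J" and D: "D \<in> sets P" "depends_on {c. fst c = 0} (\<lambda>w. w \<in> D)"
  shows "emeasure P (D \<inter> {w. \<forall>(i, t, j)\<in>J. count_at i t j w = k i t j}) =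
    (\<integral>\<^sup>+w. indicator D w * (\<Prod>(i, t, j)\<in>J. ennreal (mnb_count_pmf (coeff_at i t w) (k i t j))) \<partial>P)"
proof -
  let ?K = "{c. fst c = 0} :: noise_index set"
  define E where "E = {w. \<forall>(i, t, j)\<in>J. count_at i t j w = k i t j}"
  have E: "E \<in> sets P"
  proof -
    have "{w \<in> space P. \<forall>p\<in>J. count_at (fst p) (fst (snd p)) (snd (snd p)) w = k (fst p) (fst (snd p)) (snd (snd p))} \<in> sets P"
      using J by measurable
    then show ?thesis by (simp add: E_def case_prod_beta)
  qed
  have inner: "emeasure P {w'. splice ?K w w' \<in> E} =
      (\<Prod>(i, t, j)\<in>J. ennreal (mnb_count_pmf (coeff_at i t w) (k i t j)))"
    if pos: "\<And>i t. coeff_at i t w > 0" for w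
  proof -
    \<comment> \<open>Distinct triples use distinct uniform coordinates, so once the coefficients
      are fixed the event is a cylinder.\<close>
    define g where "g = (\<lambda>(i, t, j). (1, i, t, j) :: noise_index)"
    define B where "B = (\<lambda>(_ :: nat, i, t, j). {u. geom_quantile (coeff_at i t w) u = k i t j})"
    have "{w'. splice ?K w w' \<in> E} = {w'. \<forall>c\<in>g ` J. w' c \<in> B c}"
      by (auto simp: E_def g_def B_def count_at_def coeff_at_def splice_def)
    also have "emeasure P \<dots> = (\<Prod>c\<in>g ` J. emeasure (noise c) (B c))"
      using J by (intro emeasure_P_cylinder) (auto simp: B_def)
    also have "\<dots> = (\<Prod>p\<in>J. emeasure (noise (g p)) (B (g p)))"
      by (rule prod.reindex_cong[of g]) (auto simp: g_def inj_on_def)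
    also have "\<dots> = (\<Prod>(i, t, j)\<in>J. ennreal (mnb_count_pmf (coeff_at i t w) (k i t j)))"
      using pos by (intro prod.cong refl) (auto simp: g_def B_def noise_law_def emeasure_geom_quantile
          simp del: emeasure_uniform_measure)
    finally show ?thesis .
  qed
  have "emeasure P (D \<inter> E) = (\<integral>\<^sup>+w. indicator D w * indicator E w \<partial>P)"
    using D E by (simp add: nn_integral_indicator[symmetric] indicator_inter_arith)
  also have "\<dots> = (\<integral>\<^sup>+w. \<integral>\<^sup>+w'. indicator D (splice ?K w w') * indicator E (splice ?K w w') \<partial>P \<partial>P)"
    using D E by (intro N.nn_integral_splice) auto
  also have "\<dots> = (\<integral>\<^sup>+w. indicator D w * (\<Prod>(i, t, j)\<in>J. ennreal (mnb_count_pmf (coeff_at i t w) (k i t j))) \<partial>P)"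
    using AE_coeff_at_pos
  proof (intro nn_integral_cong_AE, eventually_elim)
    case (elim w)
    have m: "{w'. splice ?K w w' \<in> E} \<in> sets P"
    proof -
      have "(\<lambda>w'. (w, w')) \<in> measurable P (P \<Otimes>\<^sub>M P)" by simp
      from measurable_sets[OF measurable_compose[OF this N.measurable_splice] E]
      show ?thesis by (simp add: vimage_def)
    qed
    have "(\<integral>\<^sup>+w'. indicator D (splice ?K w w') * indicator E (splice ?K w w') \<partial>P) =
        (\<integral>\<^sup>+w'. indicator D w * indicator {w'. splice ?K w w' \<in> E} w' \<partial>P)"
      using depends_on_splice1[OF D(2) order_refl, of w]
      by (intro nn_integral_cong) (auto simp: indicator_def)
    also have "\<dots> = indicator D w * emeasure P {w'. splice ?K w w' \<in> E}"
      using m by (simp add: nn_integral_cmult)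
    finally show ?case
      using elim by (simp add: inner)
  qed
  finally show ?thesis by (simp add: E_def)
qed

lemma nn_integral_count_at: "(\<integral>\<^sup>+w. ennreal (real (count_at i t j w)) \<partial>P) = ennreal (m i / l)"
proof (rule N.nn_integral_mixed_geometric)
  fix k
  have "emeasure P {w. count_at i t j w = k} = (\<integral>\<^sup>+w. ennreal (mnb_count_pmf (coeff_at i t w) k) \<partial>P)"
    using counting_at[of "{(i, t, j)}" UNIV "\<lambda>_ _ _. k"] sets.top[of P] by (simp add: depends_on_def)
  moreover have "(\<integral>w. mnb_count_pmf (coeff_at i t w) k \<partial>P) = enn2real (\<integral>\<^sup>+w. ennreal (mnb_count_pmf (coeff_at i t w) k) \<partial>P)"
    using AE_coeff_at_pos by (intro integral_eq_nn_integral) (auto elim!: eventually_mono simp: mnb_count_pmf_bounds)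
  ultimately show "measure P {w \<in> space P. count_at i t j w = k} = (\<integral>w. mnb_count_pmf (coeff_at i t w) k \<partial>P)"
    by (simp add: measure_def)
qed (use m_pos l_pos distr_coeff_at in auto)

text \<open>A form of Wald's identity: \<open>g\<close> reads only noise before time
  \<open>t\<close>, so the counts at time \<open>t\<close> can be resampled while \<open>g\<close>
  stays fixed. The added 1 is the extra summand of the operator.\<close>

lemma nn_integral_thin_at:
  assumes g: "g \<in> measurable P (count_space UNIV)" and dep: "depends_on {c. noise_time c < t} g"
  shows "(\<integral>\<^sup>+w. ennreal (real (coord i (thin_at t w (g w)))) \<partial>P) =
    ennreal (m i / l) * ((\<integral>\<^sup>+w. ennreal (real (coord i (g w))) \<partial>P) + 1)"
proof -
  let ?K = "{c. noise_time c < t} :: noise_index set"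
  note [measurable] = g
  have inner: "(\<integral>\<^sup>+w. ennreal (real (mnb_op (\<lambda>j. count_at i t j w) n)) \<partial>P) = ennreal (m i / l) * (ennreal (real n) + 1)" for n
  proof -
    have "(\<integral>\<^sup>+w. ennreal (real (mnb_op (\<lambda>j. count_at i t j w) n)) \<partial>P) =
        (\<integral>\<^sup>+w. (\<Sum>j = 1..n + 1. ennreal (real (count_at i t j w))) \<partial>P)"
      unfolding mnb_op_def of_nat_sum by (intro nn_integral_cong sum_ennreal[symmetric]) simp
    also have "\<dots> = (\<Sum>j = 1..n + 1. ennreal (m i / l))"
      by (subst nn_integral_sum) (simp_all only: nn_integral_count_at, measurable)
    also have "\<dots> = ennreal (m i / l) * ennreal (real (n + 1))"
      by (simp add: ennreal_of_nat_eq_real_of_nat mult.commute)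
    finally show ?thesis by (simp add: add.commute)
  qed
  have "(\<integral>\<^sup>+w. ennreal (real (coord i (thin_at t w (g w)))) \<partial>P) =
     (\<integral>\<^sup>+w. \<integral>\<^sup>+w'. ennreal (real (coord i (thin_at t (splice ?K w w') (g (splice ?K w w'))))) \<partial>P \<partial>P)"
    by (intro N.nn_integral_splice) measurable
  also have "\<dots> = (\<integral>\<^sup>+w. \<integral>\<^sup>+w'. ennreal (real (mnb_op (\<lambda>j. count_at i t j w') (coord i (g w)))) \<partial>P \<partial>P)"
  proof (intro nn_integral_cong)
    fix w w'
    have "g (splice ?K w w') = g w"
      by (rule depends_on_splice1[OF dep order_refl])
    moreover have "count_at i t j (splice ?K w w') = count_at i t j w'" for j
      by (rule depends_on_splice2[OF depends_on_count_at]) auto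
    ultimately show "ennreal (real (coord i (thin_at t (splice ?K w w') (g (splice ?K w w'))))) =
        ennreal (real (mnb_op (\<lambda>j. count_at i t j w') (coord i (g w))))"
      by (simp add: coord_thin_at)
  qed
  also have "\<dots> = (\<integral>\<^sup>+w. ennreal (m i / l) * (ennreal (real (coord i (g w))) + 1) \<partial>P)"
    by (simp only: inner)
  also have "\<dots> = ennreal (m i / l) * ((\<integral>\<^sup>+w. ennreal (real (coord i (g w))) \<partial>P) + 1)"
    by (subst nn_integral_cmult) (simp_all add: nn_integral_add N.P.emeasure_space_1[simplified])
  finally show ?thesis .
qed

lemma nn_integral_innov_at:
  "(\<integral>\<^sup>+w. ennreal (real (coord i (innov_at t w))) \<partial>P) = ennreal (measure_pmf.expectation f\<^sub>Z (\<lambda>z. real (coord i z)))"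
proof -
  have "(\<integral>\<^sup>+w. ennreal (real (coord i (innov_at t w))) \<partial>P) =
      (\<integral>\<^sup>+z. ennreal (real (coord i z)) \<partial>distr P (count_space UNIV) (innov_at t))"
    by (subst nn_integral_distr) auto
  also have "\<dots> = ennreal (measure_pmf.expectation f\<^sub>Z (\<lambda>z. real (coord i z)))"
    unfolding distr_innov_at using innov_integrable by (intro nn_integral_eq_integral) auto
  finally show ?thesis .
qed

text \<open>The bound is the fixed point of the recursion for the mean.\<close>

lemma nn_integral_started_le:
  fixes i :: 2
  defines "\<mu> \<equiv> measure_pmf.expectation f\<^sub>Z (\<lambda>z. real (coord i z))" and "a \<equiv> m i / l"
  shows "(\<integral>\<^sup>+w. ennreal (real (coord i (started n t w))) \<partial>P) \<le> ennreal ((a + \<mu>) / (1 - a))"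
proof (induction n arbitrary: t)
  case 0
  then show ?case by (simp add: coord_def)
next
  case (Suc n)
  have a: "0 \<le> a" "a < 1"
    using m_pos[of i] m_less[of i] l_pos by (auto simp: a_def)
  have \<mu>: "0 \<le> \<mu>"
    by (simp add: \<mu>_def)
  define C where "C = (a + \<mu>) / (1 - a)"
  have C: "0 \<le> C" "a * (C + 1) + \<mu> = C"
    using a \<mu> by (auto simp: C_def field_simps)
  have "(\<integral>\<^sup>+w. ennreal (real (coord i (started (Suc n) t w))) \<partial>P) =
      (\<integral>\<^sup>+w. ennreal (real (coord i (thin_at t w (started n (t - 1) w)))) + ennreal (real (coord i (innov_at t w))) \<partial>P)"
    by (simp add: coord_add)
  also have "\<dots> = (\<integral>\<^sup>+w. ennreal (real (coord i (thin_at t w (started n (t - 1) w)))) \<partial>P) + ennreal \<mu>"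
    by (subst nn_integral_add) (simp_all add: nn_integral_innov_at \<mu>_def)
  also have "(\<integral>\<^sup>+w. ennreal (real (coord i (thin_at t w (started n (t - 1) w)))) \<partial>P) =
      ennreal a * ((\<integral>\<^sup>+w. ennreal (real (coord i (started n (t - 1) w))) \<partial>P) + 1)"
    unfolding a_def
    by (intro nn_integral_thin_at measurable_started depends_on_mono[OF depends_on_started]) auto
  also have "\<dots> + ennreal \<mu> \<le> ennreal a * (ennreal C + 1) + ennreal \<mu>"
    using Suc[of "t - 1"] by (intro add_mono mult_left_mono) (auto simp: C_def)
  also have "\<dots> = ennreal (a * (C + 1) + \<mu>)"
    using a \<mu> C(1) by (simp add: ennreal_mult)
  finally show ?case
    by (simp only: C(2) C_def[symmetric])
qed

text \<open>The mean bound is uniform in n, so by monotone convergence the supremum over n has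
  finite mean and is finite almost surely. A bounded increasing sequence of naturals is eventually
  constant.\<close>

lemma AE_settled: "AE w in P. \<exists>n. settled t w n"
proof -
  have "AE w in P. \<exists>b. \<forall>n. coord i (started n t w) \<le> b" for i
  proof -
    let ?f = "\<lambda>n w. ennreal (real (coord i (started n t w)))"
    have inc: "incseq ?f"
      using started_mono by (intro incseq_SucI le_funI ennreal_leI) simp
    have "(\<integral>\<^sup>+w. (SUP n. ?f n w) \<partial>P) = (SUP n. \<integral>\<^sup>+w. ?f n w \<partial>P)"
      by (intro nn_integral_monotone_convergence_SUP inc) measurable
    also have "\<dots> \<le> ennreal ((m i / l + measure_pmf.expectation f\<^sub>Z (\<lambda>z. real (coord i z))) / (1 - m i / l))"
      by (intro SUP_least nn_integral_started_le)
    also have "\<dots> < \<infinity>" by simp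
    finally have "AE w in P. (SUP n. ?f n w) \<noteq> \<infinity>"
      by (intro nn_integral_noteq_infinite) auto
    then show ?thesis
    proof eventually_elim
      case (elim w)
      obtain b where b: "(SUP n. ?f n w) < of_nat b"
        using ennreal_Ex_less_of_nat[OF elim[unfolded infinity_ennreal_def less_top]] by blast
      have "coord i (started n t w) \<le> b" for n
      proof -
        have "?f n w \<le> (SUP n. ?f n w)"
          by (rule SUP_upper) simp
        also note b
        finally show ?thesis
          by (simp add: ennreal_of_nat_eq_real_of_nat ennreal_less_iff)
      qed
      then show ?case by blast
    qed
  qed
  then have "AE w in P. \<forall>i. \<exists>b. \<forall>n. coord i (started n t w) \<le> b"
    by (simp add: AE_all_countable)
  then show ?thesis
  proof eventually_elim
    case (elim w)
    then obtain b where "\<And>i n. coord i (started n t w) \<le> b i" by metis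
    then show ?case by (rule settledI)
  qed
qed

lemma AE_state_at_recursion: "AE w in P. state_at t w = thin_at t w (state_at (t - 1) w) + innov_at t w"
  using AE_settled[of "t - 1"] by eventually_elim (auto intro: state_at_recursion)

end

section \<open>Verification of the defining conditions and of stationarity\<close>

locale brc_model = brc_noise l m f\<^sub>Z + coordinate_copy "noise_law l m f\<^sub>Z" M r
  for l m f\<^sub>Z and M :: "'a measure" and r
begin

definition \<alpha>_model :: "2 \<Rightarrow> nat \<Rightarrow> 'a \<Rightarrow> real" where
  "\<alpha>_model i t \<omega> = coeff_at i (int t) (r \<omega>)"

definition G_model :: "2 \<Rightarrow> nat \<Rightarrow> nat \<Rightarrow> 'a \<Rightarrow> nat" where
  "G_model i t j \<omega> = count_at i (int t) j (r \<omega>)"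

definition Z_model :: "nat \<Rightarrow> 'a \<Rightarrow> nat \<times> nat" where
  "Z_model t \<omega> = innov_at (int t) (r \<omega>)"

definition X_model :: "nat \<Rightarrow> 'a \<Rightarrow> nat \<times> nat" where
  "X_model t \<omega> = state_at (int t) (r \<omega>)"

lemma distr_r_compose: "f \<in> measurable P S \<Longrightarrow> distr M S (\<lambda>\<omega>. f (r \<omega>)) = distr P S f"
  using distr_distr[OF _ r, of f S] by (simp add: distr_r comp_def)

lemma AE_r: "AE w in P. Q w \<Longrightarrow> AE \<omega> in M. Q (r \<omega>)"
  by (rule AE_distrD[OF r]) (simp only: distr_r)

lemma emeasure_r: "E \<in> sets P \<Longrightarrow> emeasure M (r -` E \<inter> space M) = emeasure P E"
  using emeasure_distr[OF r, of E] by (simp add: distr_r)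

lemma nn_integral_r: "f \<in> borel_measurable P \<Longrightarrow> (\<integral>\<^sup>+\<omega>. f (r \<omega>) \<partial>M) = (\<integral>\<^sup>+w. f w \<partial>P)"
  using nn_integral_distr[OF r, of f] by (simp add: distr_r)

lemma measurable_r: "f \<in> measurable P S \<Longrightarrow> (\<lambda>\<omega>. f (r \<omega>)) \<in> measurable M S"
  by (rule measurable_compose[OF r])

lemma thinned_eq: "t \<ge> 1 \<Longrightarrow> thinned G_model X_model t \<omega> = thin_at (int t) (r \<omega>) (state_at (int t - 1) (r \<omega>))"
  by (simp add: thinned_def thin_at_def G_model_def[abs_def] X_model_def of_nat_diff)

lemma past_eq: "past X_model t \<omega> = (\<lambda>w. \<lambda>s\<in>{..<t}. state_at (int s) w) (r \<omega>)"
  by (simp add: past_def X_model_def)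

lemma driver_eq: "driver \<alpha>_model G_model Z_model t \<omega> = driver_at (int t) (r \<omega>)"
  by (simp add: driver_def driver_at_def \<alpha>_model_def G_model_def Z_model_def)

lemma measurable_past_at: "(\<lambda>w. \<lambda>s\<in>{..<t}. state_at (int s) w) \<in> measurable P (past_space t)"
  by (intro measurable_restrict measurable_state_at)

lemma depends_on_past_at: "depends_on {c. noise_time c < int t} (\<lambda>w. \<lambda>s\<in>{..<t}. state_at (int s) w)"
proof -
  have "(\<lambda>s\<in>{..<t}. state_at (int s) w) = (\<lambda>s\<in>{..<t}. state_at (int s) w')"
    if "\<forall>c\<in>{c. noise_time c < int t}. w c = w' c" for w w'
    by (intro restrict_ext depends_onD[OF depends_on_state_at]) (use that in auto)
  then show ?thesis unfolding depends_on_def by blast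
qed

lemma measurable_coeffs': "(\<lambda>w. \<lambda>(i, t)\<in>UNIV \<times> {1::nat..}. coeff_at i (int t) w) \<in> measurable P (\<Pi>\<^sub>M p\<in>UNIV \<times> {1..}. borel)"
  by (intro measurable_restrict) auto

lemma depends_on_coeffs': "depends_on {c. fst c = 0} (\<lambda>w. \<lambda>(i, t)\<in>UNIV \<times> {1::nat..}. coeff_at i (int t) w)"
  by (auto simp: depends_on_def coeff_at_def restrict_def fun_eq_iff)

text \<open>By the characterisation of conditional expectation it suffices to compare integrals over
  events generated by the coefficients. Each such event is the preimage of some \<open>D\<close>
  under \<open>r\<close>, and \<open>counting_at\<close> gives the equality.\<close>

lemma counting_cond_law':
  assumes J: "finite J" "J \<subseteq> UNIV \<times> {1..} \<times> {1..}"
  shows "AE \<omega> in M. real_cond_exp M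
      (vimage_algebra (space M) (coeffs \<alpha>_model) (\<Pi>\<^sub>M p\<in>UNIV \<times> {1..}. borel))
      (indicator {\<omega> \<in> space M. \<forall>(i, t, j)\<in>J. G_model i t j \<omega> = k i t j}) \<omega> =
    (\<Prod>(i, t, j)\<in>J. mnb_count_pmf (\<alpha>_model i t \<omega>) (k i t j))"
proof -
  let ?S = "\<Pi>\<^sub>M p\<in>UNIV \<times> {1::nat..}. (borel :: real measure)"
  let ?F = "vimage_algebra (space M) (coeffs \<alpha>_model) ?S"
  let ?cf = "\<lambda>w. \<lambda>(i, t)\<in>UNIV \<times> {1::nat..}. coeff_at i (int t) w"
  let ?g = "\<lambda>\<omega>. \<Prod>(i, t, j)\<in>J. mnb_count_pmf (\<alpha>_model i t \<omega>) (k i t j)"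
  have coeffs: "coeffs \<alpha>_model = (\<lambda>\<omega>. ?cf (r \<omega>))"
    by (simp add: coeffs_def[abs_def] \<alpha>_model_def)
  have mc: "coeffs \<alpha>_model \<in> measurable M ?S"
    unfolding coeffs by (rule measurable_r[OF measurable_coeffs'])
  interpret F: finite_measure_subalgebra M ?F
    by unfold_locales
      (auto simp: subalgebra_def sets_vimage_algebra intro!: sets.sigma_sets_subset measurable_sets[OF mc])
  \<comment> \<open>\<open>h\<close> and \<open>k'\<close> translate between the natural times of
    the process and the integer times of the noise.\<close>
  define h where "h = (\<lambda>(i :: 2, t, j :: nat). (i, int t, j))"
  define J' where "J' = h ` J"
  define k' where "k' i t j = k i (nat t) j" for i t j
  define E where "E = {w. \<forall>(i, t, j)\<in>J'. count_at i t j w = k' i t j}"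
  define Q where "Q w = (\<Prod>(i, t, j)\<in>J'. ennreal (mnb_count_pmf (coeff_at i t w) (k' i t j)))" for w
  have J': "finite J'" using J by (simp add: J'_def)
  have E: "E \<in> sets P"
  proof -
    have "{w \<in> space P. \<forall>p\<in>J'. count_at (fst p) (fst (snd p)) (snd (snd p)) w = k' (fst p) (fst (snd p)) (snd (snd p))} \<in> sets P"
      using J' by measurable
    then show ?thesis by (simp add: E_def case_prod_beta)
  qed
  have event: "{\<omega> \<in> space M. \<forall>(i, t, j)\<in>J. G_model i t j \<omega> = k i t j} = r -` E \<inter> space M"
    by (auto simp: E_def J'_def h_def k'_def G_model_def)
  have pos: "AE \<omega> in M. \<forall>i t. \<alpha>_model i t \<omega> > 0"
    using AE_r[OF AE_coeff_at_pos] by eventually_elim (auto simp: \<alpha>_model_def)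
  have m\<alpha> [measurable]: "\<alpha>_model i t \<in> borel_measurable M" for i t
    unfolding \<alpha>_model_def[abs_def] by (rule measurable_r) simp
  have mg: "?g \<in> borel_measurable M"
    unfolding case_prod_beta by measurable
  have g_Q: "AE \<omega> in M. ennreal (?g \<omega>) = Q (r \<omega>) \<and> 0 \<le> ?g \<omega> \<and> ?g \<omega> \<le> 1"
    using pos
  proof eventually_elim
    case (elim \<omega>)
    have "Q (r \<omega>) = (\<Prod>(i, t, j)\<in>J. ennreal (mnb_count_pmf (\<alpha>_model i t \<omega>) (k i t j)))"
      unfolding Q_def J'_def
      by (subst prod.reindex) (auto simp: h_def inj_on_def k'_def \<alpha>_model_def comp_def intro!: prod.cong)
    also have "\<dots> = ennreal (?g \<omega>)"
      using elim mnb_count_pmf_bounds unfolding case_prod_beta by (intro prod_ennreal) auto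
    finally show ?case
      using elim mnb_count_pmf_bounds by (auto intro!: prod_nonneg prod_le_1)
  qed
  have int_g: "integrable M ?g"
  proof (rule integrable_const_bound[where B=1])
    show "AE \<omega> in M. norm (?g \<omega>) \<le> 1"
      using g_Q by eventually_elim auto
  qed (rule mg)
  have rE: "r -` E \<inter> space M \<in> sets M"
    using measurable_sets[OF r E] .
  have int_E: "integrable M (indicator (r -` E \<inter> space M) :: 'a \<Rightarrow> real)"
    by (rule integrable_const_bound[where B=1]) (use rE in auto)
  show ?thesis
    unfolding event
  proof (rule F.real_cond_exp_charact[OF _ int_E int_g])
    fix A assume "A \<in> sets ?F"
    then obtain B where B: "B \<in> sets ?S" "A = coeffs \<alpha>_model -` B \<inter> space M"
      using measurable_space[OF mc] by (subst (asm) sets_vimage_algebra2) auto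
    define D where "D = ?cf -` B"
    have D: "D \<in> sets P"
      using measurable_sets[OF measurable_coeffs' B(1)] by (simp add: D_def)
    have dep_D: "depends_on {c. fst c = 0} (\<lambda>w. w \<in> D)"
      using depends_on_comp[OF depends_on_coeffs', of "\<lambda>y. y \<in> B"] by (simp add: D_def)
    have A: "A = r -` D \<inter> space M"
      unfolding B(2) coeffs D_def by auto
    have A_M: "A \<in> sets M"
      unfolding A using measurable_sets[OF r D] .
    have Q [measurable]: "Q \<in> borel_measurable P"
      unfolding Q_def[abs_def] case_prod_beta by measurable
    have "ennreal (measure M (A \<inter> (r -` E \<inter> space M))) = emeasure M (r -` (D \<inter> E) \<inter> space M)"
      by (simp add: emeasure_eq_measure A) (rule arg_cong[where f="measure M"], auto)
    also have "\<dots> = emeasure P (D \<inter> E)"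
      using D E by (intro emeasure_r) auto
    also have "\<dots> = (\<integral>\<^sup>+w. indicator D w * Q w \<partial>P)"
      unfolding E_def Q_def by (rule counting_at[OF J' D dep_D])
    also have "\<dots> = (\<integral>\<^sup>+\<omega>. indicator D (r \<omega>) * Q (r \<omega>) \<partial>M)"
      using D by (intro nn_integral_r[symmetric]) simp
    also have "\<dots> = (\<integral>\<^sup>+\<omega>. ennreal (indicator A \<omega> * ?g \<omega>) \<partial>M)"
      using g_Q AE_space by (intro nn_integral_cong_AE, eventually_elim) (auto simp: A indicator_def)
    finally have "measure M (A \<inter> (r -` E \<inter> space M)) = enn2real (\<integral>\<^sup>+\<omega>. ennreal (indicator A \<omega> * ?g \<omega>) \<partial>M)"
      by (metis enn2real_ennreal measure_nonneg)
    also have "\<dots> = (\<integral>\<omega>. indicator A \<omega> * ?g \<omega> \<partial>M)"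
    proof (rule integral_eq_nn_integral[symmetric])
      show "AE \<omega> in M. 0 \<le> indicator A \<omega> * ?g \<omega>"
        using g_Q by eventually_elim (simp add: indicator_def)
    qed (use mg A_M in measurable)
    finally show "(\<integral>\<omega>\<in>A. indicator (r -` E \<inter> space M) \<omega> \<partial>M) = (\<integral>\<omega>\<in>A. ?g \<omega> \<partial>M)"
      using A_M rE by (simp add: set_lebesgue_integral_def indicator_inter_arith[symmetric])
  next
    \<comment> \<open>The times in \<open>J\<close> are at least 1, so the coefficients in the
      product are components of the restricted family \<open>coeffs\<close>.\<close>
    show "?g \<in> borel_measurable ?F"
      unfolding case_prod_beta
    proof (rule borel_measurable_prod)
      fix p assume "p \<in> J"
      then have p: "(fst p, fst (snd p)) \<in> UNIV \<times> {1..}" using J by auto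
      have "(\<lambda>\<omega>. coeffs \<alpha>_model \<omega> (fst p, fst (snd p))) \<in> borel_measurable ?F"
        using measurable_space[OF mc]
        by (intro measurable_compose[OF measurable_vimage_algebra1 measurable_component_singleton[OF p]]) auto
      then have "\<alpha>_model (fst p) (fst (snd p)) \<in> borel_measurable ?F"
        using p by (simp add: coeffs_def)
      then show "(\<lambda>\<omega>. mnb_count_pmf (\<alpha>_model (fst p) (fst (snd p)) \<omega>) (k (fst p) (fst (snd p)) (snd (snd p)))) \<in> borel_measurable ?F"
        by (rule measurable_compose[OF _ borel_measurable_mnb_count_pmf])
    qed
  qed
qed

lemma brcmnbinar_model: "brcmnbinar M l m f\<^sub>Z \<alpha>_model G_model Z_model X_model"
proof
  show X: "X_model t \<in> measurable M (count_space UNIV)" for t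
    unfolding X_model_def[abs_def] by (rule measurable_r) simp
  show "AE \<omega> in M. \<forall>i. coord i (X_model t \<omega>) = coord i (thinned G_model X_model t \<omega>) + coord i (Z_model t \<omega>)" if "t \<ge> 1" for t
    using AE_r[OF AE_state_at_recursion[of "int t"]]
    by eventually_elim (simp add: thinned_eq[OF that] X_model_def Z_model_def coord_add[symmetric])
  show "distributed M lborel (\<alpha>_model i t) (\<lambda>x. ennreal (beta_prime_density (m i) l x))" for i t
    using distr_r_compose[of "coeff_at i (int t)" lborel] measurable_r[of "coeff_at i (int t)" lborel]
    by (simp add: distributed_def distr_coeff_at \<alpha>_model_def[abs_def] beta_prime_def[symmetric])
  show "indep_vars (\<lambda>_. borel) (\<alpha>_model i) {1..}" for i
    unfolding \<alpha>_model_def[abs_def]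
    by (rule indep_vars_r[where Y="\<lambda>t. coeff_at i (int t)"], measurable, rule depends_on_coeff_at)
      (auto simp: disjoint_family_on_def)
  show "indep_var (\<Pi>\<^sub>M t\<in>{1..}. borel) (\<lambda>\<omega>. \<lambda>t\<in>{1..}. \<alpha>_model 1 t \<omega>) (\<Pi>\<^sub>M t\<in>{1..}. borel) (\<lambda>\<omega>. \<lambda>t\<in>{1..}. \<alpha>_model 2 t \<omega>)"
  proof -
    \<comment> \<open>\<open>indep_var\<close> is independence of a family indexed by truth values.
      The two coefficient sequences read coordinates of different components.\<close>
    let ?Y = "\<lambda>b w. \<lambda>t\<in>{1::nat..}. coeff_at (if b then 1 else 2) (int t) w"
    have "indep_vars (\<lambda>_. \<Pi>\<^sub>M t\<in>{1..}. borel) (\<lambda>b \<omega>. ?Y b (r \<omega>)) UNIV"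
    proof (rule indep_vars_r[where K="\<lambda>b. {c. fst (snd c) = (if b then 1 else 2)}"])
      show "?Y b \<in> measurable P (\<Pi>\<^sub>M t\<in>{1..}. borel)" for b
        by (intro measurable_restrict) simp
      show "depends_on {c. fst (snd c) = (if b then 1 else 2)} (?Y b)" for b
        by (auto simp: depends_on_def coeff_at_def restrict_def fun_eq_iff)
    qed (auto simp: disjoint_family_on_def)
    then show ?thesis
      unfolding indep_var_def \<alpha>_model_def
      by (rule indep_vars_cong[THEN iffD1, rotated 3]) (auto split: bool.split)
  qed
  show "distr M (count_space UNIV) (Z_model t) = measure_pmf f\<^sub>Z" for t
    using distr_r_compose[of "innov_at (int t)"] by (simp add: Z_model_def[abs_def] distr_innov_at)
  show "indep_vars (\<lambda>_. count_space UNIV) Z_model {1..}"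
    unfolding Z_model_def[abs_def]
    by (rule indep_vars_r[where Y="\<lambda>t. innov_at (int t)"], measurable, rule depends_on_innov_at)
      (auto simp: disjoint_family_on_def)
  show "indep_pair (count_space UNIV) (Z_model t) (count_space UNIV \<Otimes>\<^sub>M past_space t) (\<lambda>\<omega>. (thinned G_model X_model t \<omega>, past X_model t \<omega>))"
    if t: "t \<ge> 1" for t
    unfolding Z_model_def[abs_def] thinned_eq[OF t] past_eq
  \<comment> \<open>The innovation occupies the coordinate (2, 1, t, 0). \<open>L\<close> omits it,
    since at time \<open>t\<close> it admits only coordinates with first entry below 2.\<close>
  proof (rule indep_pair_r[where L="{c. noise_time c \<le> int t \<and> (noise_time c < int t \<or> fst c < 2)}"])
    show "(\<lambda>w. (thin_at (int t) w (state_at (int t - 1) w), \<lambda>s\<in>{..<t}. state_at (int s) w))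
        \<in> measurable P (count_space UNIV \<Otimes>\<^sub>M past_space t)"
      by (intro measurable_Pair measurable_thin_at' measurable_state_at measurable_past_at)
    show "depends_on {c. noise_time c \<le> int t \<and> (noise_time c < int t \<or> fst c < 2)}
        (\<lambda>w. (thin_at (int t) w (state_at (int t - 1) w), \<lambda>s\<in>{..<t}. state_at (int s) w))"
      (is "depends_on ?L _")
      unfolding depends_on_def
    proof (intro allI impI)
      fix w w' :: "noise_index \<Rightarrow> real"
      assume eq: "\<forall>c\<in>?L. w c = w' c"
      have "state_at (int t - 1) w = state_at (int t - 1) w'"
        by (rule depends_onD[OF depends_on_state_at]) (use eq in auto)
      moreover have "thin_at (int t) w x = thin_at (int t) w' x" for x
        by (rule depends_onD[OF depends_on_thin_at]) (use eq in auto)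
      moreover have "(\<lambda>s\<in>{..<t}. state_at (int s) w) = (\<lambda>s\<in>{..<t}. state_at (int s) w')"
        by (rule depends_onD[OF depends_on_past_at]) (use eq in auto)
      ultimately show "(thin_at (int t) w (state_at (int t - 1) w), \<lambda>s\<in>{..<t}. state_at (int s) w) =
          (thin_at (int t) w' (state_at (int t - 1) w'), \<lambda>s\<in>{..<t}. state_at (int s) w')"
        by simp
    qed
  qed (auto intro: depends_on_innov_at)
  show "AE \<omega> in M. real_cond_exp M
      (vimage_algebra (space M) (coeffs \<alpha>_model) (\<Pi>\<^sub>M p\<in>UNIV \<times> {1..}. borel))
      (indicator {\<omega> \<in> space M. \<forall>(i, t, j)\<in>J. G_model i t j \<omega> = k i t j}) \<omega> =
    (\<Prod>(i, t, j)\<in>J. mnb_count_pmf (\<alpha>_model i t \<omega>) (k i t j))"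
    if "finite J" "J \<subseteq> UNIV \<times> {1..} \<times> {1..}" for J k
    using counting_cond_law'[OF that] .
  show "indep_vars (\<lambda>_. driver_space) (driver \<alpha>_model G_model Z_model) {1..}"
    unfolding driver_eq[abs_def]
    by (rule indep_vars_r[where Y="\<lambda>t. driver_at (int t)"], rule measurable_driver_at, rule depends_on_driver_at)
      (auto simp: disjoint_family_on_def)
  show "indep_pair driver_space (driver \<alpha>_model G_model Z_model t) (past_space t) (past X_model t)" for t
    unfolding driver_eq[abs_def] past_eq[abs_def]
    by (rule indep_pair_r[OF measurable_driver_at depends_on_driver_at measurable_past_at depends_on_past_at]) auto
qed

text \<open>\<open>noise_law\<close> ignores the time entry, so shifting time is a reindexing that
  preserves the product measure; the state commutes with this shift.\<close>

lemma strictly_stationary_model: "strictly_stationary M (count_space UNIV) X_model"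
  unfolding strictly_stationary_def
proof (intro allI impI)
  fix T :: "nat set" and h :: nat
  let ?S = "\<Pi>\<^sub>M t\<in>T. (count_space UNIV :: (nat \<times> nat) measure)"
  let ?f = "\<lambda>w. \<lambda>t\<in>T. state_at (int t) w"
  let ?s = "\<lambda>w c. w (shift (int h) c)"
  have f: "?f \<in> measurable P ?S"
    by (intro measurable_restrict measurable_state_at)
  have law: "noise (shift (int h) c) = noise c" for c
    by (auto simp: noise_law_def shift_def split: prod.split)
  have "distr P (\<Pi>\<^sub>M c\<in>UNIV. noise (shift (int h) c)) (\<lambda>w. \<lambda>c\<in>UNIV. w (shift (int h) c)) =
      (\<Pi>\<^sub>M c\<in>UNIV. noise (shift (int h) c))"
    by (rule distr_PiM_reindex) (auto simp: prob_space_noise inj_on_def shift_def)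
  then have s: "distr P P ?s = P"
    by (simp add: law restrict_def)
  have ms: "?s \<in> measurable P P"
    by (intro measurable_PiM_single') auto
  have "(\<lambda>\<omega>. \<lambda>t\<in>T. X_model (t + h) \<omega>) = (\<lambda>\<omega>. ?f (?s (r \<omega>)))"
    by (simp add: X_model_def state_at_shift)
  then have "distr M ?S (\<lambda>\<omega>. \<lambda>t\<in>T. X_model (t + h) \<omega>) = distr P ?S (\<lambda>w. ?f (?s w))"
    using distr_r_compose[OF measurable_compose[OF ms f]] by simp
  also have "\<dots> = distr (distr P P ?s) ?S ?f"
    using distr_distr[OF f ms] by (simp add: comp_def)
  also have "\<dots> = distr M ?S (\<lambda>\<omega>. \<lambda>t\<in>T. X_model t \<omega>)"
    using distr_r_compose[OF f] by (simp add: s X_model_def)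
  finally show "distr M ?S (\<lambda>\<omega>. \<lambda>t\<in>T. X_model (t + h) \<omega>) = distr M ?S (\<lambda>\<omega>. \<lambda>t\<in>T. X_model t \<omega>)" .
qed

end

text \<open>The noise indices are countable, so the noise can be enumerated by the naturals.
  Coordinate n receives the law of the index \<open>from_nat n\<close>, and \<open>r\<close> reads
  index c at position \<open>to_nat c\<close>.\<close>

lemma brc_model_exists:
  assumes "brc_noise l m f\<^sub>Z"
  shows "\<exists>(M :: (nat \<Rightarrow> real) measure) r. brc_model l m f\<^sub>Z M r"
proof -
  interpret brc_noise l m f\<^sub>Z by fact
  define M where "M = PiM (UNIV :: nat set) (\<lambda>n. noise (from_nat n))"
  define r where "r = (\<lambda>(\<omega> :: nat \<Rightarrow> real) c. \<omega> (to_nat (c :: noise_index)))"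
  interpret M: prob_space M
    unfolding M_def by (intro prob_space_PiM prob_space_noise)
  have r: "r \<in> measurable M P"
    unfolding r_def M_def
    using measurable_component_singleton[of "to_nat c" UNIV "\<lambda>n. noise (from_nat n)" for c :: noise_index]
    by (intro measurable_PiM_single') auto
  have "distr M (\<Pi>\<^sub>M c\<in>UNIV. noise (from_nat (to_nat c))) (\<lambda>\<omega>. \<lambda>c\<in>UNIV. \<omega> (to_nat c)) =
      (\<Pi>\<^sub>M c\<in>UNIV. noise (from_nat (to_nat (c :: noise_index))))"
    unfolding M_def by (rule distr_PiM_reindex) (auto simp: prob_space_noise)
  then have "distr M P r = P"
    by (simp add: r_def restrict_def)
  then have "coordinate_copy noise M r"
    by (intro coordinate_copy.intro coordinate_copy_axioms.intro N.coordinate_space_axioms M.prob_space_axioms r)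
      simp_all
  then have "brc_model l m f\<^sub>Z M r"
    by (intro brc_model.intro assms)
  then show ?thesis by blast
qed

theorem proposition2p3:
  fixes l :: real and m :: "2 \<Rightarrow> real"
    and a var_a :: "2 \<Rightarrow> real"
    and f\<^sub>Z :: "(nat \<times> nat) pmf"
    and \<mu> var_Z :: "2 \<Rightarrow> real" and \<phi> :: real
  assumes "l > 1"
    and "\<And>i. 0 < m i \<and> m i < l"
    and "\<And>i. integrable (measure_pmf f\<^sub>Z) (\<lambda>z. (real (coord i z))\<^sup>2)"
    and "\<And>i. \<mu> i = measure_pmf.expectation f\<^sub>Z (\<lambda>z. real (coord i z))"
    and "\<And>i. var_Z i = measure_pmf.variance f\<^sub>Z (\<lambda>z. real (coord i z))"
    and "\<phi> = measure_pmf.expectation f\<^sub>Z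
                (\<lambda>z. (real (coord 1 z) - \<mu> 1) * (real (coord 2 z) - \<mu> 2))"
    and "(m 1, \<mu> 1) \<noteq> (m 2, \<mu> 2)"
    and "\<And>i. a i = (\<integral>x. x \<partial>beta_prime (m i) l)"
    and "\<And>i. var_a i = (\<integral>x. (x - a i)\<^sup>2 \<partial>beta_prime (m i) l)"
    and "\<And>i. 0 < (a i)\<^sup>2 + var_a i \<and> (a i)\<^sup>2 + var_a i < 1"
  shows "(\<exists>(M :: (nat \<Rightarrow> real) measure) \<alpha> G Z X.
            stationary_ergodic_brcmnbinar M l m f\<^sub>Z \<alpha> G Z X) \<and>
         (\<forall>(M :: 'a measure) \<alpha> G Z X (M' :: 'b measure) \<alpha>' G' Z' X'.
            stationary_ergodic_brcmnbinar M l m f\<^sub>Z \<alpha> G Z X \<longrightarrow>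
            stationary_ergodic_brcmnbinar M' l m f\<^sub>Z \<alpha>' G' Z' X' \<longrightarrow>
            process_law M (count_space UNIV) X = process_law M' (count_space UNIV) X')"
proof (intro conjI allI impI)
  have l: "l > 0" and m: "\<And>i. 0 < m i" "\<And>i. m i < l"
    using assms(1,2) by auto
  \<comment> \<open>The sample space is generic, since these facts serve the constructed model as
    well as the two given solutions.\<close>
  have chain: "markov_chain M (brc_kernel l m f\<^sub>Z) X" "forgetful_kernel (brc_kernel l m f\<^sub>Z)" "prob_space M"
    if "brcmnbinar M l m f\<^sub>Z \<alpha> G Z X" for M :: "'c measure" and \<alpha> G Z X
  proof -
    interpret brcmnbinar M l m f\<^sub>Z \<alpha> G Z X by fact
    show "markov_chain M (brc_kernel l m f\<^sub>Z) X"
      by (intro markov_chain_brc m l)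
    show "forgetful_kernel (brc_kernel l m f\<^sub>Z)"
      using assms(2) l by (rule forgetful_brc_kernel)
    show "prob_space M" by (rule prob_space_axioms)
  qed
  {
    \<comment> \<open>A natural number is at most its square, so the second moment dominates the
      first.\<close>
    have "integrable (measure_pmf f\<^sub>Z) (\<lambda>z. real (coord i z))" for i
      using assms(3)[of i]
      by (rule Bochner_Integration.integrable_bound) (auto simp: power2_eq_square of_nat_mult[symmetric] simp del: of_nat_mult)
    then have "brc_noise l m f\<^sub>Z"
      using m l by unfold_locales
    then obtain M :: "(nat \<Rightarrow> real) measure" and r where "brc_model l m f\<^sub>Z M r"
      using brc_model_exists by blast
    then interpret brc_model l m f\<^sub>Z M r .
    \<comment> \<open>The model is itself a solution, so its own counts provide the coupling behind
      forgetfulness.\<close>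
    interpret K: forgetful_kernel "brc_kernel l m f\<^sub>Z"
      by (rule chain(2)[OF brcmnbinar_model])
    have "ergodic_process M (count_space UNIV) X_model"
      by (rule K.stationary_ergodic[OF prob_space_axioms chain(1)[OF brcmnbinar_model] strictly_stationary_model])
    then have "stationary_ergodic_brcmnbinar M l m f\<^sub>Z \<alpha>_model G_model Z_model X_model"
      by (simp add: stationary_ergodic_brcmnbinar_def brcmnbinar_model strictly_stationary_model)
    then show "\<exists>(M :: (nat \<Rightarrow> real) measure) \<alpha> G Z X. stationary_ergodic_brcmnbinar M l m f\<^sub>Z \<alpha> G Z X"
      by blast
  }
  fix M :: "'a measure" and \<alpha> G Z X and M' :: "'b measure" and \<alpha>' G' Z' X'
  assume S: "stationary_ergodic_brcmnbinar M l m f\<^sub>Z \<alpha> G Z X"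
    and S': "stationary_ergodic_brcmnbinar M' l m f\<^sub>Z \<alpha>' G' Z' X'"
  then have B: "brcmnbinar M l m f\<^sub>Z \<alpha> G Z X" and B': "brcmnbinar M' l m f\<^sub>Z \<alpha>' G' Z' X'"
    and st: "strictly_stationary M (count_space UNIV) X" "strictly_stationary M' (count_space UNIV) X'"
    by (simp_all add: stationary_ergodic_brcmnbinar_def)
  show "process_law M (count_space UNIV) X = process_law M' (count_space UNIV) X'"
    by (rule forgetful_kernel.stationary_law_unique[OF chain(2)[OF B] chain(3)[OF B] chain(3)[OF B']
          chain(1)[OF B] chain(1)[OF B'] st])
qed

end
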